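(* There exists an absolute constant $c>1$ such that the following holds with probability at least $1-2n^{-2}$. Let $n_1,n_2,d_1,d_2,r$ be positive integers with $r\le d_i\le n_i$, $n=\max\{n_1,n_2\}$. Let $A\in\mathbb R^{n_1\times d_1}$, $B\in\mathbb R^{n_2\times d_2}$ be isometries with $\|A\|_{2,\infty}\le\sqrt{\mu d_1/n_1}$ and $\|B\|_{2,\infty}\le\sqrt{\mu d_2/n_2}$, and let $X^*\in\mathbb R^{n_1\times n_2}$ be a rank-$r$ matrix whose column space lies in the column span of $A$ and whose row space lies in the column span of $B$. Let $\sigma_r^*=\sigma_r(X^* )$ and $\gamma=c/(2\sigma_r^* )$. Let $\Omega\subseteq[n_1]\times[n_2]$ be drawn uniformly at random among subsets of size $|\Omega|\ge 32\mu^2d_1d_2\log n$, and let $Y=\mathcal P_\Omega(X^* )$. Then for any initial pair $(U_0,V_0)\in\mathbb R^{d_1\times r}\times\mathbb R^{d_2\times r}$ satisfying $$\|AU_0V_0^\top B^\top-X^*\|_F\le\sigma_r^*/c\quad\text{and}\quad\|U_0^\top U_0-V_0^\top V_0\|_F\le\sigma_r^*/(2c),$$ the iterates of GNIMC, $X_t=AU_tV_t^\top B^\top$, satisfy $$\|X_{t+1}-X^*\|_F\le\gamma\,\|X_t-X^*\|_F^2\quad\text{for all }t=0,1,2,\dots.$$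
   Context: An isometry is a matrix $A$ with $A^\top A=I$; $\|X\|_{2,\infty}$ is the largest Euclidean row norm of $X$; $\sigma_r(X)$ is the $r$-th largest singular value. $\mathcal P_\Omega(X)$ keeps the entries $X_{ij}$, $(i,j)\in\Omega$, and zeros the others. GNIMC (Gauss–Newton inductive matrix completion): given $(U_t,V_t)$, let $(\Delta U_{t+1},\Delta V_{t+1})$ be, among all minimizers over $(\Delta U,\Delta V)\in\mathbb R^{d_1\times r}\times\mathbb R^{d_2\times r}$ of the linear least squares problem $$\|\mathcal P_\Omega[A(U_tV_t^\top+U_t\Delta V^\top+\Delta U V_t^\top)B^\top]-Y\|_F^2,$$ the one with minimal $\|\Delta U\|_F^2+\|\Delta V\|_F^2$; then set $U_{t+1}=U_t+\Delta U_{t+1}$, $V_{t+1}=V_t+\Delta V_{t+1}$. *)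

theory Defs
  imports "Jordan_Normal_Form.DL_Rank" "Jordan_Normal_Form.Char_Poly"
    "HOL-Probability.Probability_Mass_Function"
begin

definition frob_norm :: "real mat \<Rightarrow> real" where
  "frob_norm X = sqrt (\<Sum>i<dim_row X. \<Sum>j<dim_col X. (X $$ (i,j))\<^sup>2)"

definition norm_2inf :: "real mat \<Rightarrow> real" where
  "norm_2inf X = Max ({sqrt (\<Sum>j<dim_col X. (X $$ (i,j))\<^sup>2) | i. i < dim_row X} \<union> {0})"

definition isometry :: "real mat \<Rightarrow> bool" where
  "isometry A \<longleftrightarrow> transpose_mat A * A = 1\<^sub>m (dim_col A)"

text \<open>k-th largest singular value (k \<ge> 1): square root of the k-th largest
  eigenvalue (with multiplicity) of the symmetric PSD matrix X^T X.\<close>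
definition sing_val :: "nat \<Rightarrow> real mat \<Rightarrow> real" where
  "sing_val k X = sqrt (rev (sorted_list_of_multiset
      (proots (char_poly (transpose_mat X * X)))) ! (k - 1))"

definition proj_Omega :: "(nat \<times> nat) set \<Rightarrow> real mat \<Rightarrow> real mat" where
  "proj_Omega \<Omega> X = Matrix.mat (dim_row X) (dim_col X)
      (\<lambda>(i,j). if (i,j) \<in> \<Omega> then X $$ (i,j) else 0)"

definition gnimc_obj ::
  "real mat \<Rightarrow> real mat \<Rightarrow> (nat \<times> nat) set \<Rightarrow> real mat \<Rightarrow> real mat \<Rightarrow> real mat
   \<Rightarrow> real mat \<Rightarrow> real mat \<Rightarrow> real" where
  "gnimc_obj A B \<Omega> Y U V dU dV =
     (frob_norm (proj_Omega \<Omega> (A * (U * transpose_mat V + U * transpose_mat dV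
        + dU * transpose_mat V) * transpose_mat B) - Y))\<^sup>2"

definition gnimc_step ::
  "real mat \<Rightarrow> real mat \<Rightarrow> (nat \<times> nat) set \<Rightarrow> real mat \<Rightarrow> nat \<Rightarrow> nat \<Rightarrow> nat
   \<Rightarrow> real mat \<Rightarrow> real mat \<Rightarrow> real mat \<Rightarrow> real mat \<Rightarrow> bool" where
  "gnimc_step A B \<Omega> Y d1 d2 r U V dU dV \<longleftrightarrow>
     (let minimizers = {(P, Q). P \<in> carrier_mat d1 r \<and> Q \<in> carrier_mat d2 r \<and>
            (\<forall>P' \<in> carrier_mat d1 r. \<forall>Q' \<in> carrier_mat d2 r.
               gnimc_obj A B \<Omega> Y U V P Q \<le> gnimc_obj A B \<Omega> Y U V P' Q')}
      in (dU, dV) \<in> minimizers \<and>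
         (\<forall>(P, Q) \<in> minimizers. (frob_norm dU)\<^sup>2 + (frob_norm dV)\<^sup>2
                                 \<le> (frob_norm P)\<^sup>2 + (frob_norm Q)\<^sup>2))"

definition gnimc_iterates ::
  "real mat \<Rightarrow> real mat \<Rightarrow> (nat \<times> nat) set \<Rightarrow> real mat \<Rightarrow> nat \<Rightarrow> nat \<Rightarrow> nat
   \<Rightarrow> (nat \<Rightarrow> real mat) \<Rightarrow> (nat \<Rightarrow> real mat) \<Rightarrow> bool" where
  "gnimc_iterates A B \<Omega> Y d1 d2 r U V \<longleftrightarrow>
     (\<forall>t. U t \<in> carrier_mat d1 r \<and> V t \<in> carrier_mat d2 r \<and>
          gnimc_step A B \<Omega> Y d1 d2 r (U t) (V t) (U (Suc t) - U t) (V (Suc t) - V t))"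

end

theory Submission
  imports Defs "Jordan_Normal_Form.Schur_Decomposition"
begin

text \<open>
  With \<open>M = A\<^sup>T X\<^sup>* B\<close>, the observation map \<open>Z \<mapsto> P\<^sub>\<Omega>(A Z B\<^sup>T)\<close> has, for a random sample, lower and upper
  isometry constants with bounded ratio on all \<open>d\<^sub>1 \<times> d\<^sub>2\<close> matrices: it is a random partial sum
  \<open>S = \<Sum> x x\<^sup>T\<close> of a tight frame whose vectors have squared norm at most \<open>R\<close>. Instead of the matrix exponential
  the potential is \<open>tr (H\<^sup>p)\<close> with \<open>H = h + S\<close> (upper tail) or \<open>H = h + 1 - S\<close> (lower tail), \<open>h = p R\<close>, \<open>p\<close> large.
  A rank-one update changes it in a controlled way, because the mixed terms \<open>x\<^sup>T H\<^sup>a K\<^sup>b x\<close> obey a recurrence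
  in which Chebyshev's inequality \<open>m\<^sub>a m\<^sub>b \<le> R m\<^bsub>a+b\<^esub>\<close> for the moments \<open>m\<^sub>a = x\<^sup>T H\<^sup>a x\<close> replaces the Golden-Thompson
  inequality. Averaging over the next sampled element and Markov's inequality give the tails.

  Given the isometry constants, write \<open>E = U V\<^sup>T - M\<close> and let \<open>G\<close> be the pseudo-inverse of \<open>M\<close>. The matrix
  \<open>M - E G E\<close> lies in the tangent space at \<open>(U, V)\<close>, so the least squares residual is at most a constant times
  \<open>\<parallel>E\<parallel>\<^sup>2 / \<sigma>\<close>. Minimality of the norm forces \<open>U\<^sup>T \<Delta>U = \<Delta>V\<^sup>T V\<close>; hence the two parts of the tangent step have a
  non-negative inner product, which bounds \<open>\<Delta>U\<close> and \<open>\<Delta>V\<close>, and \<open>U\<^sup>T U - V\<^sup>T V\<close> changes only to second order.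
\<close>

unbundle no inner_syntax
no_notation Finite_Cartesian_Product.vec_nth (infixl \<open>$\<close> 90)
hide_type (open) Finite_Cartesian_Product.vec
hide_const (open) Finite_Cartesian_Product.mat Finite_Cartesian_Product.row
  Finite_Cartesian_Product.vec Finite_Cartesian_Product.column Determinants.det

section \<open>Spectral theorem and compact singular value decomposition\<close>

text \<open>Isometry constants with a bounded ratio suffice because the least squares residual is
  already of second order in the error: a ratio of 1600 = 40^2 only multiplies it by 40, and
  \<gamma> absorbs the constant. The sample operator is never shown to be close to its mean, and the
  crude thresholds 16 m/N and m/(100 N) leave room for a lossy potential. As the bounds cover all d1
  by d2 matrices, one sampling event serves all initial pairs and all iterates. The shift h = p R
  makes each rank-one update a relative perturbation of size 1/p, so p-fold products of such factors
  stay bounded however large p is. Sampling is without replacement: the next element comes from the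
  unsampled ones, whose frame operator is 1 - S. The upper tail replaces this by 1 and so requires
  half of the elements to be left; the lower tail uses it exactly, as a decrease that acts only on
  large eigenvalues. Infinitely many steps are controlled because the error at least halves each
  time, so the second-order drifts of the balance form a convergent geometric series.\<close>

lemma exists_real_eigenvalue:
  fixes A :: "real mat"
  assumes A: "A \<in> carrier_mat n n" and sym: "A\<^sup>T = A" and n: "0 < n"
  shows "\<exists>e. eigenvalue A e"
proof -
  let ?C = "map_mat complex_of_real A"
  have C: "?C \<in> carrier_mat n n" using A by simp
  obtain as where as: "char_poly ?C = (\<Prod>a\<leftarrow>as. [:- a, 1:])" "length as = n"
    using char_poly_factorized[OF C] by blast
  obtain z where z: "z \<in> set as" using as n by (cases as) auto
  have root: "poly (char_poly ?C) z = 0"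
    unfolding as using z by (simp add: poly_prod_list prod_list_zero_iff image_iff)
  then have "eigenvalue ?C z" using eigenvalue_root_char_poly[OF C] by simp
  then obtain v where v: "v \<in> carrier_vec n" "v \<noteq> 0\<^sub>v n" "?C *\<^sub>v v = z \<cdot>\<^sub>v v"
    unfolding eigenvalue_def eigenvector_def using C by auto
  \<comment> \<open>A real symmetric matrix can be moved across the Hermitian product, so
    \<open>z\<close> equals its own conjugate. It is then a root of the real characteristic
    polynomial.\<close>
  have Csym: "?C\<^sup>T = ?C" using sym by (metis map_mat_transpose)
  have conjC: "conjugate (?C *\<^sub>v v) = ?C *\<^sub>v conjugate v"
    by (rule eq_vecI) (use A v(1) in \<open>auto simp: scalar_prod_def\<close>)
  have "z * (v \<bullet>c v) = (?C *\<^sub>v v) \<bullet>c v"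
    unfolding v(3) using v(1) by simp
  also have "\<dots> = v \<bullet> (?C *\<^sub>v conjugate v)"
    using transpose_vec_mult_scalar[of ?C n n "conjugate v" v] C v(1) Csym
    by (metis carrier_vec_conjugate)
  also have "\<dots> = v \<bullet>c (?C *\<^sub>v v)" by (simp only: conjC)
  also have "\<dots> = cnj z * (v \<bullet>c v)"
    unfolding v(3) using v(1) by (simp add: conjugate_smult_vec)
  finally have "z = cnj z" using v by (simp add: conjugate_square_eq_0_vec)
  then have zr: "z = complex_of_real (Re z)"
    by (metis complex_cnj_cancel_iff complex_is_Real_iff of_real_Re Reals_cnj_iff)
  have "poly (map_poly complex_of_real (char_poly A)) (complex_of_real (Re z)) = 0"
    using root by (simp only: of_real_hom.char_poly_hom[OF A] zr[symmetric])
  then have "poly (char_poly A) (Re z) = 0" by simp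
  then show ?thesis using eigenvalue_root_char_poly[OF A] by blast
qed

text \<open>Gram-Schmidt on a basis completing \<open>v\<close>, followed by normalisation of the
  columns. The scalar \<open>a\<close> stays unspecified because an eigenvector matters only up to
  scaling.\<close>

lemma orthogonal_mat_with_first_col:
  fixes v :: "real vec"
  assumes v: "v \<in> carrier_vec n" "v \<noteq> 0\<^sub>v n"
  shows "\<exists>W a. W \<in> carrier_mat n n \<and> W\<^sup>T * W = 1\<^sub>m n \<and> col W 0 = a \<cdot>\<^sub>v v"
proof -
  interpret cof_vec_space n "TYPE(real)" .
  have n: "0 < n" using v by (cases n) auto
  define b where "b = basis_completion v"
  define ws where "ws = gram_schmidt n b"
  from basis_completion[OF v, folded b_def]
  have dist_b: "distinct b" and indep: "\<not> lin_dep (set b)" and b: "set b \<subseteq> carrier_vec n"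
    and hdb: "hd b = v" and len_b: "length b = n" by auto
  from hdb len_b n obtain vs where bv: "b = v # vs" by (cases b) auto
  from gram_schmidt_result[OF b dist_b indep refl, folded ws_def]
  have ws: "set ws \<subseteq> carrier_vec n" "corthogonal ws" "length ws = n" by (auto simp: len_b)
  from gram_schmidt_hd[OF v(1), of vs, folded bv] have hdws: "hd ws = v" unfolding ws_def .
  have ws0: "ws ! 0 = v" using hdws ws n by (metis hd_conv_nth length_0_conv less_numeral_extra(3))
  have wsc: "ws ! i \<in> carrier_vec n" if "i < n" for i using ws that by (simp add: subset_iff)
  have orth: "ws ! i \<bullet> ws ! j = 0 \<longleftrightarrow> i \<noteq> j" if "i < n" "j < n" for i j
    using corthogonalD[OF ws(2), of i j] that ws(3) by simp
  define c where "c i = 1 / sqrt (ws ! i \<bullet> ws ! i)" for i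
  define W where "W = mat_of_cols n (map (\<lambda>i. c i \<cdot>\<^sub>v ws ! i) [0..<n])"
  have W: "W \<in> carrier_mat n n"
    unfolding W_def using mat_of_cols_carrier(1)[of n "map (\<lambda>i. c i \<cdot>\<^sub>v ws ! i) [0..<n]"] by simp
  have colW: "col W i = c i \<cdot>\<^sub>v ws ! i" if "i < n" for i
    unfolding W_def using that wsc[OF that] by (subst col_mat_of_cols) auto
  have pos: "0 < ws ! i \<bullet> ws ! i" if "i < n" for i
  proof -
    have "0 \<le> ws ! i \<bullet> ws ! i" by (auto simp: scalar_prod_def intro!: sum_nonneg)
    then show ?thesis using orth[OF that that] by linarith
  qed
  have "W\<^sup>T * W = 1\<^sub>m n"
  proof (rule eq_matI)
    fix i j assume "i < dim_row (1\<^sub>m n :: real mat)" "j < dim_col (1\<^sub>m n :: real mat)"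
    then have ij: "i < n" "j < n" by auto
    have "(W\<^sup>T * W) $$ (i,j) = col W i \<bullet> col W j" using W ij by simp
    also have "\<dots> = c i * c j * (ws ! i \<bullet> ws ! j)"
      using smult_scalar_prod_distrib[OF wsc[OF ij(1)], of "c j \<cdot>\<^sub>v ws ! j"] wsc[OF ij(2)]
        scalar_prod_smult_distrib[OF wsc[OF ij(1)] wsc[OF ij(2)]]
      by (simp add: colW ij)
    also have "\<dots> = 1\<^sub>m n $$ (i,j)"
    proof (cases "i = j")
      case True
      have "c i * c i * (ws ! i \<bullet> ws ! i) = 1"
        using pos[OF ij(1)] by (simp add: c_def)
      then show ?thesis using True ij by simp
    next
      case False then show ?thesis using orth ij by simp
    qed
    finally show "(W\<^sup>T * W) $$ (i,j) = 1\<^sub>m n $$ (i,j)" .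
  qed (use W in auto)
  then show ?thesis using W colW[OF n] ws0 by metis
qed

text \<open>Deflation: conjugation by an orthogonal matrix whose first column is an eigenvector
  clears the rest of the first column, and symmetry then clears the first row. The remaining block
  is symmetric of smaller size.\<close>

theorem real_spectral_theorem:
  fixes A :: "real mat"
  assumes "A \<in> carrier_mat n n" and "A\<^sup>T = A"
  shows "\<exists>Q l. Q \<in> carrier_mat n n \<and> Q\<^sup>T * Q = 1\<^sub>m n \<and> A = Q * mat_diag n l * Q\<^sup>T"
  using assms
proof (induction n arbitrary: A)
  case 0
  show ?case
    by (rule exI[of _ "1\<^sub>m 0"], rule exI[of _ "\<lambda>_. 0"]) (use 0 in auto)
next
  case (Suc n A)
  note A = Suc.prems(1) and sym = Suc.prems(2)
  obtain e where "eigenvalue A e" using exists_real_eigenvalue[OF A sym] by auto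
  then obtain v where v: "v \<in> carrier_vec (Suc n)" "v \<noteq> 0\<^sub>v (Suc n)" "A *\<^sub>v v = e \<cdot>\<^sub>v v"
    unfolding eigenvalue_def eigenvector_def using A by auto
  obtain W a where W: "W \<in> carrier_mat (Suc n) (Suc n)" "W\<^sup>T * W = 1\<^sub>m (Suc n)"
    "col W 0 = a \<cdot>\<^sub>v v"
    using orthogonal_mat_with_first_col[OF v(1,2)] by blast
  have WW: "W * W\<^sup>T = 1\<^sub>m (Suc n)"
    using mat_mult_left_right_inverse[of "W\<^sup>T" "Suc n" W] W by simp
  define B where "B = W\<^sup>T * (A * W)"
  have B: "B \<in> carrier_mat (Suc n) (Suc n)" using A W by (simp add: B_def)
  have Bsym: "B\<^sup>T = B"
  proof -
    have "B\<^sup>T = (A * W)\<^sup>T * W" unfolding B_def using A W by (subst transpose_mult) auto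
    also have "\<dots> = (W\<^sup>T * A) * W" using A W sym by (subst transpose_mult) auto
    also have "\<dots> = B" unfolding B_def using A W by (subst assoc_mult_mat) auto
    finally show ?thesis .
  qed
  have B0: "B $$ (i, 0) = (if i = 0 then e else 0)" if i: "i < Suc n" for i
  proof -
    have "B $$ (i, 0) = col W i \<bullet> col (A * W) 0"
      unfolding B_def using A W(1) i by simp
    also have "col (A * W) 0 = A *\<^sub>v col W 0"
      by (rule col_mult2[OF A W(1)]) simp
    also have "A *\<^sub>v col W 0 = e \<cdot>\<^sub>v col W 0"
      using A v by (simp add: W(3) mult_mat_vec smult_smult_assoc mult.commute)
    also have "col W i \<bullet> (e \<cdot>\<^sub>v col W 0) = e * (W\<^sup>T * W) $$ (i,0)"
      using W(1) i by simp
    finally show ?thesis using W i by simp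
  qed
  have B0': "B $$ (0, i) = (if i = 0 then e else 0)" if i: "i < Suc n" for i
    using B0[OF i] Bsym B i by (metis carrier_matD index_transpose_mat(1) zero_less_Suc)
  define B3 where "B3 = mat n n (\<lambda>(i,j). B $$ (Suc i, Suc j))"
  have B3: "B3 \<in> carrier_mat n n" "B3\<^sup>T = B3"
  proof -
    show "B3\<^sup>T = B3"
      unfolding B3_def by (rule eq_matI) (use Bsym B in \<open>auto, metis Suc_less_eq carrier_matD index_transpose_mat(1)\<close>)
  qed (simp add: B3_def)
  obtain Q3 l3 where Q3: "Q3 \<in> carrier_mat n n" "Q3\<^sup>T * Q3 = 1\<^sub>m n" "B3 = Q3 * mat_diag n l3 * Q3\<^sup>T"
    using Suc.IH[OF B3] by blast
  define l where "l i = (case i of 0 \<Rightarrow> e | Suc j \<Rightarrow> l3 j)" for i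
  define F where "F X = four_block_mat (1\<^sub>m 1) (0\<^sub>m 1 n) (0\<^sub>m n 1) X" for X :: "real mat"
  let ?e = "mat 1 1 (\<lambda>_. e)"
  have Bblock: "B = four_block_mat ?e (0\<^sub>m 1 n) (0\<^sub>m n 1) B3"
    by (rule eq_matI) (use B B0 B0' in \<open>auto simp: B3_def\<close>)
  have lblock: "mat_diag (Suc n) l = four_block_mat ?e (0\<^sub>m 1 n) (0\<^sub>m n 1) (mat_diag n l3)"
    by (rule eq_matI) (auto simp: mat_diag_def l_def split: nat.splits)
  have FQ: "F Q3 \<in> carrier_mat (Suc n) (Suc n)" using Q3 unfolding F_def by auto
  have FT: "(F Q3)\<^sup>T = F (Q3\<^sup>T)"
    unfolding F_def using Q3
    by (subst transpose_four_block_mat[of _ 1 1 _ n _ n]) auto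
  have F1: "(F Q3)\<^sup>T * F Q3 = 1\<^sub>m (Suc n)"
    unfolding FT unfolding F_def using Q3
    by (subst mult_four_block_mat[of _ 1 1 _ n _ n _ _ 1 _ n]) (auto simp: four_block_one_mat)
  have QD: "Q3 * mat_diag n l3 \<in> carrier_mat n n" and QDQ: "Q3 * mat_diag n l3 * Q3\<^sup>T \<in> carrier_mat n n"
    using Q3 by auto
  have FB: "F Q3 * mat_diag (Suc n) l * (F Q3)\<^sup>T = B"
    unfolding FT lblock Bblock Q3(3) unfolding F_def using Q3
    by (simp add: mult_four_block_mat[of _ 1 1 _ n _ n _ _ 1 _ n]
        left_mult_zero_mat[OF mat_diag_dim] right_mult_zero_mat[OF QD] left_add_zero_mat[OF QDQ])
  define Q where "Q = W * F Q3"
  have Q: "Q \<in> carrier_mat (Suc n) (Suc n)" using W FQ by (simp add: Q_def)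
  have QT: "Q\<^sup>T = (F Q3)\<^sup>T * W\<^sup>T" unfolding Q_def using W FQ by (rule_tac transpose_mult) auto
  let ?F = "F Q3" and ?L = "mat_diag (Suc n) l"
  have FTc: "?F\<^sup>T \<in> carrier_mat (Suc n) (Suc n)" using FQ by simp
  have WT: "W\<^sup>T \<in> carrier_mat (Suc n) (Suc n)" using W by simp
  have "Q\<^sup>T * Q = ?F\<^sup>T * W\<^sup>T * (W * ?F)"
    unfolding QT by (simp only: Q_def)
  also have "\<dots> = ?F\<^sup>T * (W\<^sup>T * (W * ?F))"
    using W FQ WT FTc by (intro assoc_mult_mat) auto
  also have "W\<^sup>T * (W * ?F) = (W\<^sup>T * W) * ?F" using W FQ WT by (intro assoc_mult_mat[symmetric]) auto
  finally have QQ: "Q\<^sup>T * Q = 1\<^sub>m (Suc n)" using W F1 FQ by simp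
  have "Q * ?L * Q\<^sup>T = W * ?F * ?L * (?F\<^sup>T * W\<^sup>T)"
    unfolding QT by (simp only: Q_def)
  also have "\<dots> = W * (?F * ?L * ?F\<^sup>T) * W\<^sup>T"
    using W FQ WT FTc mat_diag_dim[of "Suc n" l]
    by (smt (verit, best) assoc_mult_mat mult_carrier_mat)
  also have "\<dots> = (W * W\<^sup>T) * A * (W * W\<^sup>T)"
    unfolding FB B_def using W WT A by (smt (verit, best) assoc_mult_mat mult_carrier_mat)
  finally have "Q * ?L * Q\<^sup>T = A" using WW A by simp
  then show ?case using Q QQ by metis
qed

section \<open>Traces, rank-one matrices and an orthonormal eigenbasis\<close>

definition mat_trace :: "real mat \<Rightarrow> real" where
  "mat_trace M = (\<Sum>i<dim_row M. M $$ (i,i))"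

definition outer :: "real vec \<Rightarrow> real mat" where
  "outer x = mat (dim_vec x) (dim_vec x) (\<lambda>(i,j). x $ i * x $ j)"

lemma outer_carrier [simp]: "x \<in> carrier_vec n \<Longrightarrow> outer x \<in> carrier_mat n n"
  by (simp add: outer_def carrier_vecD)

lemma outer_mult_vec:
  assumes "x \<in> carrier_vec n" "y \<in> carrier_vec n"
  shows "outer x *\<^sub>v y = (x \<bullet> y) \<cdot>\<^sub>v x"
  by (rule eq_vecI) (use assms in \<open>auto simp: outer_def scalar_prod_def sum_distrib_left ac_simps intro!: sum.cong\<close>)

lemma mat_trace_comm:
  assumes "A \<in> carrier_mat n m" "B \<in> carrier_mat m n"
  shows "mat_trace (A * B) = mat_trace (B * A)"
proof -
  have "mat_trace (A * B) = (\<Sum>i<n. \<Sum>j<m. A $$ (i,j) * B $$ (j,i))"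
    using assms by (auto simp: mat_trace_def scalar_prod_def atLeast0LessThan intro!: sum.cong)
  also have "\<dots> = (\<Sum>j<m. \<Sum>i<n. B $$ (j,i) * A $$ (i,j))"
    by (subst sum.swap) (simp add: mult.commute)
  also have "\<dots> = mat_trace (B * A)"
    using assms by (auto simp: mat_trace_def scalar_prod_def atLeast0LessThan intro!: sum.cong)
  finally show ?thesis .
qed

lemma mat_trace_add:
  assumes "A \<in> carrier_mat n n" "B \<in> carrier_mat n n"
  shows "mat_trace (A + B) = mat_trace A + mat_trace B"
  using assms by (simp add: mat_trace_def sum.distrib)

lemma mat_trace_smult: "mat_trace (c \<cdot>\<^sub>m A) = c * mat_trace A" if "A \<in> carrier_mat n n"
  using that by (simp add: mat_trace_def sum_distrib_left)

lemma mat_trace_mult_outer: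
  assumes M: "M \<in> carrier_mat n n" and x: "x \<in> carrier_vec n"
  shows "mat_trace (M * outer x) = x \<bullet> (M *\<^sub>v x)"
  using assms
  by (auto simp: mat_trace_def outer_def scalar_prod_def atLeast0LessThan sum_distrib_left ac_simps intro!: sum.cong)

text \<open>Fixes one eigenbasis, so that traces of powers become power sums of \<open>l\<close>,
  and quadratic forms become sums of the same powers weighted by the squared coordinates
  \<open>(col Q i \<bullet> x)\<^sup>2\<close>. Every later scalar inequality is applied to these
  sums.\<close>

locale spectral =
  fixes n :: nat and A Q :: "real mat" and l :: "nat \<Rightarrow> real"
  assumes Q [simp]: "Q \<in> carrier_mat n n" and QQ: "Q\<^sup>T * Q = 1\<^sub>m n"
    and A_eq: "A = Q * mat_diag n l * Q\<^sup>T"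
begin

lemma QT [simp]: "Q\<^sup>T \<in> carrier_mat n n" by simp

lemma QQ': "Q * Q\<^sup>T = 1\<^sub>m n"
  using mat_mult_left_right_inverse[OF QT Q QQ] .

lemma col_orth: "i < n \<Longrightarrow> j < n \<Longrightarrow> col Q i \<bullet> col Q j = (if i = j then 1 else 0)"
  using arg_cong[OF QQ, of "\<lambda>M. M $$ (i,j)"] Q by (simp del: Q add: carrier_matD[OF Q])

lemma col_carrier [simp]: "i < n \<Longrightarrow> col Q i \<in> carrier_vec n"
  by (rule carrier_vecI) (simp add: carrier_matD[OF Q])

lemma A_carrier [simp]: "A \<in> carrier_mat n n"
  unfolding A_eq by (meson Q QT mat_diag_dim mult_carrier_mat)

lemma pow_eq: "A ^\<^sub>m k = Q * mat_diag n (\<lambda>i. l i ^ k) * Q\<^sup>T"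
proof (induction k)
  case 0
  show ?case using QQ' right_mult_one_mat[OF Q] by (simp add: carrier_matD[OF A_carrier] mat_diag_one[unfolded one_mat_def])
next
  case (Suc k)
  let ?D = "mat_diag n (\<lambda>i. l i ^ k)" and ?E = "mat_diag n l"
  have "A ^\<^sub>m Suc k = (Q * ?D * Q\<^sup>T) * (Q * ?E * Q\<^sup>T)"
    by (simp add: Suc A_eq[symmetric])
  also have "\<dots> = Q * ?D * (Q\<^sup>T * Q) * ?E * Q\<^sup>T"
    using Q QT mat_diag_dim[of n "\<lambda>i. l i ^ k"] mat_diag_dim[of n l]
    by (smt (verit, best) assoc_mult_mat mult_carrier_mat)
  also have "\<dots> = Q * (?D * ?E) * Q\<^sup>T"
    unfolding QQ using Q QT mat_diag_dim[of n "\<lambda>i. l i ^ k"] mat_diag_dim[of n l]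
    by (smt (verit, best) assoc_mult_mat mult_carrier_mat right_mult_one_mat)
  finally show ?case by (simp add: mult.commute)
qed

lemma trace_diag: "mat_trace (Q * mat_diag n f * Q\<^sup>T) = (\<Sum>i<n. f i)"
proof -
  have "mat_trace (Q * mat_diag n f * Q\<^sup>T) = mat_trace (Q\<^sup>T * (Q * mat_diag n f))"
    by (intro mat_trace_comm[of _ n n]) (use mult_carrier_mat[OF Q mat_diag_dim] in auto)
  also have "Q\<^sup>T * (Q * mat_diag n f) = mat_diag n f"
    using assoc_mult_mat[OF QT Q mat_diag_dim, of f, symmetric] left_mult_one_mat[OF mat_diag_dim, of n f]
    by (simp only: QQ)
  finally show ?thesis by (simp add: mat_trace_def mat_diag_def)
qed

lemma quad_diag:
  assumes x: "x \<in> carrier_vec n"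
  shows "x \<bullet> ((Q * mat_diag n f * Q\<^sup>T) *\<^sub>v x) = (\<Sum>i<n. f i * (col Q i \<bullet> x)\<^sup>2)"
proof -
  let ?y = "Q\<^sup>T *\<^sub>v x"
  have y: "?y \<in> carrier_vec n" using QT x by (rule mult_mat_vec_carrier)
  have yi: "?y $ i = col Q i \<bullet> x" if "i < n" for i using that by (simp add: carrier_matD[OF Q])
  have Dy: "mat_diag n f *\<^sub>v ?y \<in> carrier_vec n" using mat_diag_dim y by (rule mult_mat_vec_carrier)
  have "(Q * mat_diag n f * Q\<^sup>T) *\<^sub>v x = Q *\<^sub>v (mat_diag n f *\<^sub>v ?y)"
    using Q QT x y mat_diag_dim[of n f] by (smt (verit, best) assoc_mult_mat_vec mult_carrier_mat)
  then have "x \<bullet> ((Q * mat_diag n f * Q\<^sup>T) *\<^sub>v x) = ?y \<bullet> (mat_diag n f *\<^sub>v ?y)"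
    using transpose_vec_mult_scalar[OF Q Dy x] by simp
  also have "\<dots> = (\<Sum>i<n. ?y $ i * (mat_diag n f *\<^sub>v ?y) $ i)"
    unfolding scalar_prod_def atLeast0LessThan carrier_vecD[OF Dy] ..
  also have "\<dots> = (\<Sum>i<n. f i * (?y $ i)\<^sup>2)"
  proof (rule sum.cong[OF refl])
    fix i assume "i \<in> {..<n}"
    then have i: "i < n" by simp
    have "(mat_diag n f *\<^sub>v ?y) $ i = (\<Sum>j<n. (if i = j then f j else 0) * ?y $ j)"
      using i y by (simp add: mat_diag_def scalar_prod_def atLeast0LessThan carrier_vecD[OF y] del: index_mult_mat_vec dim_mult_mat_vec)
        (simp add: scalar_prod_def atLeast0LessThan carrier_vecD[OF y] del: dim_mult_mat_vec)
    also have "\<dots> = f i * ?y $ i" using i by (subst sum.remove[of _ i]) (auto intro!: sum.neutral)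
    finally show "?y $ i * (mat_diag n f *\<^sub>v ?y) $ i = f i * (?y $ i)\<^sup>2"
      by (simp add: power2_eq_square)
  qed
  finally show ?thesis using yi by simp
qed

lemma trace_pow: "mat_trace (A ^\<^sub>m k) = (\<Sum>i<n. l i ^ k)"
  by (simp only: pow_eq trace_diag)

lemma quad_pow: "x \<in> carrier_vec n \<Longrightarrow> x \<bullet> ((A ^\<^sub>m k) *\<^sub>v x) = (\<Sum>i<n. l i ^ k * (col Q i \<bullet> x)\<^sup>2)"
  by (simp only: pow_eq quad_diag)

lemma quad: "x \<in> carrier_vec n \<Longrightarrow> x \<bullet> (A *\<^sub>v x) = (\<Sum>i<n. l i * (col Q i \<bullet> x)\<^sup>2)"
  unfolding A_eq by (rule quad_diag)

lemma parseval: "x \<in> carrier_vec n \<Longrightarrow> x \<bullet> x = (\<Sum>i<n. (col Q i \<bullet> x)\<^sup>2)"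
  using quad_diag[of x "\<lambda>_. 1"] QQ' Q by simp

lemma quad_col: "i < n \<Longrightarrow> col Q i \<bullet> (A *\<^sub>v col Q i) = l i"
  using quad[of "col Q i"] col_orth[of _ i] Q
  by (simp add: carrier_matD[OF Q] if_distrib sum.remove[of _ i] cong: if_cong)

lemma eigenvalue_ge:
  assumes "\<And>v. v \<in> carrier_vec n \<Longrightarrow> h * (v \<bullet> v) \<le> v \<bullet> (A *\<^sub>v v)" and "i < n"
  shows "h \<le> l i"
  using assms(1)[of "col Q i"] quad_col[OF assms(2)] col_orth[OF assms(2,2)] assms(2)
  by simp

lemma eigenvalue_le:
  assumes "\<And>v. v \<in> carrier_vec n \<Longrightarrow> v \<bullet> (A *\<^sub>v v) \<le> h * (v \<bullet> v)" and "i < n"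
  shows "l i \<le> h"
  using assms(1)[of "col Q i"] quad_col[OF assms(2)] col_orth[OF assms(2,2)] assms(2)
  by simp

text \<open>A weighted mean of eigenvalues cannot exceed their maximum. This turns a direction in
  which an operator is too large into an eigenvalue that a trace power detects.\<close>

lemma exists_large_eigenvalue:
  assumes v: "v \<in> carrier_vec n" and "y * (v \<bullet> v) < v \<bullet> (A *\<^sub>v v)"
  shows "\<exists>i<n. y < l i"
proof (rule ccontr)
  assume *: "\<not> ?thesis"
  have "l i \<le> y" if "i < n" for i using that * by (meson not_less)
  then have "(\<Sum>i<n. l i * (col Q i \<bullet> v)\<^sup>2) \<le> (\<Sum>i<n. y * (col Q i \<bullet> v)\<^sup>2)"
    by (intro sum_mono mult_right_mono) auto
  then show False using assms quad[OF v] parseval[OF v] by (simp add: sum_distrib_left)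
qed

end

lemma spectral_exists:
  assumes "A \<in> carrier_mat n n" "A\<^sup>T = A"
  obtains Q l where "spectral n A Q l"
  using real_spectral_theorem[OF assms] unfolding spectral_def by blast


section \<open>Singular values from the characteristic polynomial\<close>

lemma scalar_prod_self_nonneg: "0 \<le> (v :: real vec) \<bullet> v"
  by (auto simp: scalar_prod_def intro!: sum_nonneg)

text \<open>Sorting a nonnegative list puts the zeros first, so with \<open>r\<close> nonzero
  entries the \<open>r\<close>-th largest, at index \<open>r - 1\<close>, is the least nonzero one.
  This identifies \<open>sing_val r\<close> of a rank \<open>r\<close> matrix as its least positive
  singular value.\<close>

lemma rev_sort_nth_card_nonzero:
  fixes xs :: "real list"
  assumes nonneg: "\<And>x. x \<in> set xs \<Longrightarrow> 0 \<le> x" and r: "r = length (filter (\<lambda>x. x \<noteq> 0) xs)" "0 < r"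
  shows "0 < rev (sort xs) ! (r - 1)"
    and "x \<in> set xs \<Longrightarrow> x \<noteq> 0 \<Longrightarrow> rev (sort xs) ! (r - 1) \<le> x"
proof -
  define ys where "ys = sort (filter (\<lambda>x. x \<noteq> 0) xs)"
  have len: "length ys = r" by (simp add: ys_def r)
  have set_ys: "set ys = {x \<in> set xs. x \<noteq> 0}" by (simp add: ys_def)
  have sorted: "sorted ys" by (simp add: ys_def)
  have "sort xs = replicate (length (filter (\<lambda>x. x = 0) xs)) 0 @ ys"
  proof (rule properties_for_sort)
    have "mset xs = mset (filter (\<lambda>x. x = 0) xs) + mset (filter (\<lambda>x. x \<noteq> 0) xs)"
      by (induction xs) auto
    moreover have "filter (\<lambda>x. x = 0) xs = replicate (length (filter (\<lambda>x. x = 0) xs)) 0"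
      by (induction xs) auto
    ultimately show "mset (replicate (length (filter (\<lambda>x. x = 0) xs)) 0 @ ys) = mset xs"
      unfolding ys_def by (metis mset_append mset_sort)
    show "sorted (replicate (length (filter (\<lambda>x. x = 0) xs)) 0 @ ys)"
      using sorted nonneg by (auto simp: sorted_append set_ys)
  qed
  then have "rev (sort xs) ! (r - 1) = ys ! 0"
    using r len by (simp add: nth_append rev_nth)
  moreover have "ys ! 0 \<in> set ys" using len r by simp
  moreover have "ys ! 0 \<le> x" if "x \<in> set ys" for x
    using sorted that by (metis in_set_conv_nth sorted_nth_mono zero_le)
  ultimately show "0 < rev (sort xs) ! (r - 1)"
    and "x \<in> set xs \<Longrightarrow> x \<noteq> 0 \<Longrightarrow> rev (sort xs) ! (r - 1) \<le> x"
    using nonneg set_ys by (auto simp: order_less_le)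
qed

lemma proots_prod_list_linear: "proots (\<Prod>a\<leftarrow>as. [:- a, 1:]) = mset (as :: real list)"
proof (induction as)
  case (Cons a as)
  have "(\<Prod>a\<leftarrow>as. [:- a, 1:]) \<noteq> 0" by (auto simp: prod_list_zero_iff)
  then have "proots ([:- a, 1:] * (\<Prod>a\<leftarrow>as. [:- a, 1:])) = {#a#} + mset as"
    using Cons by (subst proots_mult) (auto simp del: mult_pCons_left)
  then show ?case by (simp del: mult_pCons_left)
qed simp

lemma (in spectral) proots_char_poly: "proots (char_poly A) = mset (map l [0..<n])"
proof -
  have "similar_mat A (mat_diag n l)"
    unfolding similar_mat_def
    using similar_mat_witI[OF QQ' QQ A_eq A_carrier mat_diag_dim Q QT] by blast
  then have "char_poly A = char_poly (mat_diag n l)" by (rule char_poly_similar)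
  also have "\<dots> = (\<Prod>a\<leftarrow>diag_mat (mat_diag n l). [:- a, 1:])"
    by (rule char_poly_upper_triangular[of _ n]) (auto simp: mat_diag_def)
  also have "diag_mat (mat_diag n l) = map l [0..<n]"
    by (simp add: diag_mat_def mat_diag_def)
  finally show ?thesis by (simp only: proots_prod_list_linear)
qed

text \<open>\<open>P * mat_diag k s\<close> is injective, so its \<open>k\<close> columns are
  independent, and \<open>X\<close> has the same column space because \<open>N\<^sup>T\<close> is
  onto. It shows that the number of nonzero eigenvalues of \<open>X\<^sup>T * X\<close> is the
  rank.\<close>

lemma (in vec_space) rank_compact_svd:
  fixes P :: "'a mat"
  assumes P: "P \<in> carrier_mat n k" and N: "N \<in> carrier_mat nc k"
    and PP: "P\<^sup>T * P = 1\<^sub>m k" and NN: "N\<^sup>T * N = 1\<^sub>m k" and s: "\<And>i. i < k \<Longrightarrow> s i \<noteq> 0"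
    and X: "X = P * mat_diag k s * N\<^sup>T"
  shows "rank X = k"
proof -
  let ?S = "mat_diag k s" and ?S' = "mat_diag k (\<lambda>i. inverse (s i))"
  have S: "?S \<in> carrier_mat k k" "?S' \<in> carrier_mat k k" by simp_all
  let ?J = "P * ?S"
  have J: "?J \<in> carrier_mat n k" using P S by (rule_tac mult_carrier_mat)
  have NT: "N\<^sup>T \<in> carrier_mat k nc" and PT: "P\<^sup>T \<in> carrier_mat k n" using N P by auto
  have Xc: "X \<in> carrier_mat n nc" unfolding X using J NT by (rule mult_carrier_mat)
  have S'S: "?S' * ?S = 1\<^sub>m k"
    unfolding mat_diag_diag mat_diag_one[symmetric] using s by (auto simp: mat_diag_def)
  have inj: "v = 0\<^sub>v k" if v: "v \<in> carrier_vec k" "?J *\<^sub>v v = 0\<^sub>v n" for v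
  proof -
    have Sv: "?S *\<^sub>v v \<in> carrier_vec k" using mult_mat_vec_carrier[OF S(1) v(1)] .
    have "?S *\<^sub>v v = (P\<^sup>T * P) *\<^sub>v (?S *\<^sub>v v)" using PP Sv by simp
    also have "\<dots> = P\<^sup>T *\<^sub>v (?J *\<^sub>v v)"
      using assoc_mult_mat_vec[OF PT P Sv] assoc_mult_mat_vec[OF P S(1) v(1)] by simp
    also have "\<dots> = 0\<^sub>v k" using v PT by auto
    finally have "?S' *\<^sub>v (?S *\<^sub>v v) = 0\<^sub>v k"
      by (simp only:) (rule eq_vecI, auto simp: mat_diag_def)
    then show ?thesis using assoc_mult_mat_vec[OF S(2,1) v(1)] S'S v by simp
  qed
  \<comment> \<open>Independence is a property of the set of columns, so coinciding columns have to
    be excluded separately: they would put a difference of two unit vectors into the kernel.\<close>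
  have dist: "distinct (cols ?J)"
  proof (rule ccontr)
    assume "\<not> distinct (cols ?J)"
    then obtain i j where ij: "i < k" "j < k" "i \<noteq> j" "col ?J i = col ?J j"
      using J by (auto simp: distinct_conv_nth)
    have mu: "?J *\<^sub>v unit_vec k i = col ?J i" if "i < k" for i
      by (rule eq_vecI) (use that J in auto)
    let ?v = "unit_vec k i - unit_vec k j :: 'a vec"
    have "?J *\<^sub>v ?v = 0\<^sub>v n"
      using mult_minus_distrib_mat_vec[OF J, of "unit_vec k i" "unit_vec k j"] ij J
      by (simp only: mu unit_vec_carrier) auto
    then have "?v = 0\<^sub>v k" by (intro inj) auto
    then have "?v $ i = 0" using ij by simp
    then show False using ij by simp
  qed
  have indpt: "lin_indpt (set (cols ?J))"
    using lin_depE[OF J _ dist] inj by metis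
  have rJ: "rank ?J = k" using lin_indpt_full_rank[OF J dist indpt] .
  have "col_space X = col_space ?J"
    unfolding col_space_eq[OF Xc] col_space_eq[OF J]
  proof (intro Collect_eqI iffI conj_cong; elim conjE bexE)
    fix y x assume "x \<in> carrier_vec (dim_col X)" "X *\<^sub>v x = y" "y \<in> carrier_vec (dim_row X)"
    then show "y \<in> carrier_vec (dim_row ?J) \<and> (\<exists>x\<in>carrier_vec (dim_col ?J). ?J *\<^sub>v x = y)"
      using Xc J NT assoc_mult_mat_vec[OF J NT, of x] unfolding X
      by (intro conjI bexI[of _ "N\<^sup>T *\<^sub>v x"]) auto
  next
    fix y x assume x: "x \<in> carrier_vec (dim_col ?J)" "?J *\<^sub>v x = y" "y \<in> carrier_vec (dim_row ?J)"
    have xk: "x \<in> carrier_vec k" using x(1) unfolding carrier_matD(2)[OF J] .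
    have Nx: "N *\<^sub>v x \<in> carrier_vec nc" using N xk by auto
    have "X *\<^sub>v (N *\<^sub>v x) = ?J *\<^sub>v (N\<^sup>T *\<^sub>v (N *\<^sub>v x))"
      unfolding X using assoc_mult_mat_vec[OF J NT Nx] .
    also have "N\<^sup>T *\<^sub>v (N *\<^sub>v x) = x" using assoc_mult_mat_vec[OF NT N xk] NN xk by simp
    finally show "y \<in> carrier_vec (dim_row X) \<and> (\<exists>x\<in>carrier_vec (dim_col X). X *\<^sub>v x = y)"
      using x Xc J Nx by (intro conjI bexI[of _ "N *\<^sub>v x"]) auto
  qed
  then show ?thesis using rJ unfolding rank_def col_space_def by simp
qed

text \<open>Eigenvectors of \<open>X\<^sup>T * X\<close> with nonzero eigenvalue are the right
  singular vectors, and their normalised images under \<open>X\<close> are the left ones.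
  \<open>X\<close> annihilates the other eigenvectors, so they drop out of the expansion of
  \<open>X\<close>.\<close>

theorem compact_svd:
  fixes X :: "real mat"
  assumes X: "X \<in> carrier_mat n1 n2" and rank: "vec_space.rank n1 X = r" and r: "0 < r"
  obtains P N s where "P \<in> carrier_mat n1 r" "N \<in> carrier_mat n2 r"
    "P\<^sup>T * P = 1\<^sub>m r" "N\<^sup>T * N = 1\<^sub>m r" "X = P * mat_diag r s * N\<^sup>T"
    "0 < sing_val r X" "\<And>i. i < r \<Longrightarrow> sing_val r X \<le> s i"
proof -
  have XT: "X\<^sup>T \<in> carrier_mat n2 n1" using X by simp
  have XX: "X\<^sup>T * X \<in> carrier_mat n2 n2" using mult_carrier_mat[OF XT X] .
  have sym: "(X\<^sup>T * X)\<^sup>T = X\<^sup>T * X" using transpose_mult[OF XT X] by simp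
  obtain Q l where sp: "spectral n2 (X\<^sup>T * X) Q l" using spectral_exists[OF XX sym] .
  interpret spectral n2 "X\<^sup>T * X" Q l by (rule sp)
  have Xq: "X *\<^sub>v col Q i \<in> carrier_vec n1" if "i < n2" for i
    using mult_mat_vec_carrier[OF X col_carrier[OF that]] .
  have gram: "(X *\<^sub>v col Q i) \<bullet> (X *\<^sub>v col Q j) = (if i = j then l j else 0)" if ij: "i < n2" "j < n2" for i j
  proof -
    have "(X *\<^sub>v col Q i) \<bullet> (X *\<^sub>v col Q j) = ((X\<^sup>T * X) *\<^sub>v col Q i) \<bullet> col Q j"
      using transpose_vec_mult_scalar[OF X col_carrier[OF ij(2)] Xq[OF ij(1)]]
        assoc_mult_mat_vec[OF XT X col_carrier[OF ij(1)]] by simp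
    also have "(X\<^sup>T * X) *\<^sub>v col Q i = l i \<cdot>\<^sub>v col Q i"
    proof -
      have QL: "Q * mat_diag n2 l \<in> carrier_mat n2 n2" using Q mat_diag_dim by (rule mult_carrier_mat)
      have "(X\<^sup>T * X) * Q = Q * mat_diag n2 l * Q\<^sup>T * Q" by (simp only: A_eq)
      also have "\<dots> = Q * mat_diag n2 l"
        using assoc_mult_mat[OF QL QT Q] right_mult_one_mat[OF QL] by (simp only: QQ)
      finally have "col ((X\<^sup>T * X) * Q) i = col (Q * mat_diag n2 l) i" by simp
      also have "\<dots> = l i \<cdot>\<^sub>v col Q i"
        unfolding mat_diag_mult_right[OF Q] using ij by (intro eq_vecI) (auto simp: carrier_matD[OF Q])
      finally show ?thesis using col_mult2[OF XX Q ij(1)] by simp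
    qed
    finally show ?thesis using col_orth[OF ij] ij by simp
  qed
  have l0: "0 \<le> l i" if "i < n2" for i
    using gram[OF that that] scalar_prod_self_nonneg[of "X *\<^sub>v col Q i"] by simp
  define J where "J = {i. i < n2 \<and> l i \<noteq> 0}"
  define k where "k = card J"
  have finJ: "finite J" by (simp add: J_def)
  \<comment> \<open>The enumeration is arbitrary, so the diagonal \<open>s\<close> is unsorted;
    \<open>sing_val r X\<close> enters only as a lower bound for it.\<close>
  obtain f where f: "bij_betw f {..<k} J"
    using ex_bij_betw_nat_finite[OF finJ] by (auto simp: k_def atLeast0LessThan)
  have fJ: "f i < n2" "l (f i) \<noteq> 0" "0 < l (f i)" if "i < k" for i
    using bij_betwE[OF f] that l0[of "f i"] by (auto simp: J_def less_le)
  have finj: "f i = f j \<longleftrightarrow> i = j" if "i < k" "j < k" for i j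
    using f that by (auto simp: bij_betw_def inj_on_def)
  define s where "s i = sqrt (l (f i))" for i
  have s0: "0 < s i" if "i < k" for i using fJ[OF that] by (simp add: s_def)
  define N where "N = mat n2 k (\<lambda>(a,i). Q $$ (a, f i))"
  define P where "P = mat n1 k (\<lambda>(a,i). (X *\<^sub>v col Q (f i)) $ a / s i)"
  have N: "N \<in> carrier_mat n2 k" and P: "P \<in> carrier_mat n1 k" by (auto simp: N_def P_def)
  have colN: "col N i = col Q (f i)" if "i < k" for i
    using that fJ by (intro eq_vecI) (auto simp: N_def carrier_matD[OF Q])
  have colP: "col P i = (1 / s i) \<cdot>\<^sub>v (X *\<^sub>v col Q (f i))" if "i < k" for i
    using that fJ X by (intro eq_vecI) (auto simp: P_def)
  have NN: "N\<^sup>T * N = 1\<^sub>m k"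
    by (rule eq_matI) (use N in \<open>auto simp: colN col_orth fJ finj\<close>)
  have PP: "P\<^sup>T * P = 1\<^sub>m k"
  proof (rule eq_matI)
    fix i j assume "i < dim_row (1\<^sub>m k :: real mat)" "j < dim_col (1\<^sub>m k :: real mat)"
    then have ij: "i < k" "j < k" by auto
    have "(P\<^sup>T * P) $$ (i,j) = (1 / s i) * ((1 / s j) * ((X *\<^sub>v col Q (f i)) \<bullet> (X *\<^sub>v col Q (f j))))"
      using ij P colP fJ Xq[of "f i"] Xq[of "f j"] by simp
    also have "\<dots> = (if i = j then 1 else 0)"
      using ij fJ s0[of j] by (simp add: gram finj) (simp add: s_def less_imp_le)
    finally show "(P\<^sup>T * P) $$ (i,j) = 1\<^sub>m k $$ (i,j)" using ij by simp
  qed (use P in auto)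
  have Xeq: "X = P * mat_diag k s * N\<^sup>T"
  proof (rule eq_matI)
    fix a b assume "a < dim_row (P * mat_diag k s * N\<^sup>T)" "b < dim_col (P * mat_diag k s * N\<^sup>T)"
    then have ab: "a < n1" "b < n2" using P N by auto
    have Z: "(X *\<^sub>v col Q i) $ a = 0" if i: "i < n2" "l i = 0" for i
    proof -
      have "(X *\<^sub>v col Q i) \<bullet> (X *\<^sub>v col Q i) = 0" using gram[OF i(1,1)] i(2) by simp
      then have "X *\<^sub>v col Q i = 0\<^sub>v n1" using conjugate_square_eq_0_vec[OF Xq[OF i(1)]] by simp
      then show ?thesis using ab by simp
    qed
    have "X = (X * Q) * Q\<^sup>T" using assoc_mult_mat[OF X Q QT] QQ' X by simp
    then have "X $$ (a,b) = ((X * Q) * Q\<^sup>T) $$ (a,b)" by (rule arg_cong)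
    also have "\<dots> = (\<Sum>i<n2. (X *\<^sub>v col Q i) $ a * Q $$ (b,i))"
      using ab X by (auto simp: scalar_prod_def atLeast0LessThan carrier_matD[OF Q] intro!: sum.cong)
    also have "\<dots> = (\<Sum>i\<in>J. (X *\<^sub>v col Q i) $ a * Q $$ (b,i))"
      by (intro sum.mono_neutral_right) (auto simp: J_def Z)
    also have "\<dots> = (\<Sum>i<k. (X *\<^sub>v col Q (f i)) $ a * Q $$ (b, f i))"
      by (rule sum.reindex_bij_betw[OF f, symmetric])
    also have "\<dots> = (\<Sum>i<k. P $$ (a,i) * s i * N $$ (b,i))"
      using ab s0 by (intro sum.cong refl) (force simp: P_def N_def)
    also have "\<dots> = (P * mat_diag k s * N\<^sup>T) $$ (a,b)"
      using ab P N mat_diag_mult_right[OF P, of s]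
      by (simp add: scalar_prod_def atLeast0LessThan)
    finally show "X $$ (a,b) = (P * mat_diag k s * N\<^sup>T) $$ (a,b)" .
  qed (use X P N in auto)
  have "vec_space.rank n1 X = k"
    using vec_space.rank_compact_svd[OF P N PP NN _ Xeq] s0 by (metis less_irrefl)
  then have kr: "k = r" using rank by simp
  let ?xs = "map l [0..<n2]"
  have sv: "sing_val r X = sqrt (rev (sort ?xs) ! (r - 1))"
    unfolding sing_val_def proots_char_poly sorted_list_of_multiset_mset ..
  have cardJ: "r = length (filter (\<lambda>x. x \<noteq> 0) ?xs)"
  proof -
    have "length (filter (\<lambda>x. x \<noteq> 0) ?xs) = card {i. i < n2 \<and> l i \<noteq> 0}"
      by (simp add: length_filter_conv_card cong: conj_cong)
    then show ?thesis using kr by (simp add: k_def J_def)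
  qed
  have nonneg: "0 \<le> x" if "x \<in> set ?xs" for x using that l0 by auto
  note srt = rev_sort_nth_card_nonzero[OF nonneg cardJ r]
  show ?thesis
  proof (rule that[of P N s])
    show "0 < sing_val r X" unfolding sv using srt(1) by simp
    show "sing_val r X \<le> s i" if "i < r" for i
      unfolding sv s_def using srt(2)[of "l (f i)"] fJ[of i] that kr by simp
  qed (use P N PP NN Xeq kr in auto)
qed

section \<open>Trace powers under rank-one updates\<close>

lemma pow_mat_Suc_left:
  assumes "A \<in> carrier_mat n n"
  shows "A ^\<^sub>m Suc k = A * A ^\<^sub>m k"
proof (induction k)
  case 0
  show ?case using assms by simp
next
  case (Suc k)
  have "A ^\<^sub>m Suc (Suc k) = A * A ^\<^sub>m k * A" using Suc by simp
  also have "\<dots> = A * A ^\<^sub>m Suc k" using assms pow_carrier_mat[OF assms, of k] by (simp add: assoc_mult_mat[OF assms _ assms])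
  finally show ?case .
qed

text \<open>Factors \<open>K\<close> in the power are exchanged for \<open>H\<close> one at a time.
  By cyclicity of the trace, an exchange with \<open>b\<close> factors \<open>K\<close> and
  \<open>a\<close> factors \<open>H\<close> left contributes \<open>e\<close> times the mixed form
  \<open>g b a\<close>. The recurrence comes from splitting the leftmost \<open>K\<close> of
  \<open>K ^\<^sub>m Suc b\<close> in the same way.\<close>

lemma trace_pow_rank_one:
  fixes e :: real
  assumes H: "H \<in> carrier_mat n n" and x: "x \<in> carrier_vec n"
  defines "K \<equiv> H + e \<cdot>\<^sub>m outer x"
  defines "g \<equiv> \<lambda>b a. x \<bullet> (H ^\<^sub>m a *\<^sub>v (K ^\<^sub>m b *\<^sub>v x))"
  shows "g (Suc b) a = g b (Suc a) + e * (g 0 a * g b 0)"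
    and "mat_trace (K ^\<^sub>m p) = mat_trace (H ^\<^sub>m p) + e * (\<Sum>b<p. g b (p - 1 - b))"
proof -
  have O: "outer x \<in> carrier_mat n n" using x by simp
  have eO: "e \<cdot>\<^sub>m outer x \<in> carrier_mat n n" using O by simp
  have K: "K \<in> carrier_mat n n" using H O unfolding K_def by simp
  have Kv: "K *\<^sub>v y = H *\<^sub>v y + (e \<cdot>\<^sub>m outer x) *\<^sub>v y" if "y \<in> carrier_vec n" for y
    unfolding K_def by (rule add_mult_distrib_mat_vec[OF H eO that])
  note Hp = pow_carrier_mat[OF H] and Kp = pow_carrier_mat[OF K]
  have gb0: "g b 0 = x \<bullet> (K ^\<^sub>m b *\<^sub>v x)" for b
    using H mult_mat_vec_carrier[OF Kp x] by (simp add: g_def)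
  have g0a: "g 0 a = x \<bullet> (H ^\<^sub>m a *\<^sub>v x)" for a
    using K x by (simp add: g_def)
  show "g (Suc b) a = g b (Suc a) + e * (g 0 a * g b 0)"
  proof -
    let ?y = "K ^\<^sub>m b *\<^sub>v x"
    have y: "?y \<in> carrier_vec n" using Kp x by (rule mult_mat_vec_carrier)
    have Hy: "H *\<^sub>v ?y \<in> carrier_vec n" using H y by (rule mult_mat_vec_carrier)
    have Hx: "H ^\<^sub>m a *\<^sub>v x \<in> carrier_vec n" using Hp x by (rule mult_mat_vec_carrier)
    have Oy: "(e \<cdot>\<^sub>m outer x) *\<^sub>v ?y = (e * (x \<bullet> ?y)) \<cdot>\<^sub>v x"
    proof -
      have "(e \<cdot>\<^sub>m outer x) *\<^sub>v ?y = e \<cdot>\<^sub>v (outer x *\<^sub>v ?y)"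
        using O y x by (intro eq_vecI) (auto simp: outer_def)
      then show ?thesis using outer_mult_vec[OF x y] by (simp add: smult_smult_assoc)
    qed
    have "K ^\<^sub>m Suc b *\<^sub>v x = K *\<^sub>v ?y"
      using pow_mat_Suc_left[OF K] assoc_mult_mat_vec[OF K Kp x] by simp
    also have "\<dots> = H *\<^sub>v ?y + (e * (x \<bullet> ?y)) \<cdot>\<^sub>v x"
      unfolding Kv[OF y] Oy ..
    finally have "g (Suc b) a = x \<bullet> (H ^\<^sub>m a *\<^sub>v (H *\<^sub>v ?y + (e * (x \<bullet> ?y)) \<cdot>\<^sub>v x))"
      by (simp add: g_def)
    also have "H ^\<^sub>m a *\<^sub>v (H *\<^sub>v ?y + (e * (x \<bullet> ?y)) \<cdot>\<^sub>v x)
        = H ^\<^sub>m a *\<^sub>v (H *\<^sub>v ?y) + (e * (x \<bullet> ?y)) \<cdot>\<^sub>v (H ^\<^sub>m a *\<^sub>v x)"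
      using mult_add_distrib_mat_vec[OF Hp Hy, of "(e * (x \<bullet> ?y)) \<cdot>\<^sub>v x"] x mult_mat_vec[OF Hp x] by simp
    also have "H ^\<^sub>m a *\<^sub>v (H *\<^sub>v ?y) = H ^\<^sub>m Suc a *\<^sub>v ?y"
      using assoc_mult_mat_vec[OF Hp H y] by simp
    also have "x \<bullet> (H ^\<^sub>m Suc a *\<^sub>v ?y + (e * (x \<bullet> ?y)) \<cdot>\<^sub>v (H ^\<^sub>m a *\<^sub>v x))
       = x \<bullet> (H ^\<^sub>m Suc a *\<^sub>v ?y) + (e * (x \<bullet> ?y)) * (x \<bullet> (H ^\<^sub>m a *\<^sub>v x))"
      using scalar_prod_add_distrib[OF x mult_mat_vec_carrier[OF Hp y] smult_carrier_vec[THEN iffD2, OF Hx]]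
        scalar_prod_smult_distrib[OF x Hx] by metis
    finally show ?thesis unfolding gb0 g0a by (simp add: g_def ac_simps)
  qed
  have step: "mat_trace (K ^\<^sub>m Suc b * H ^\<^sub>m a) = mat_trace (K ^\<^sub>m b * H ^\<^sub>m Suc a) + e * g b a" for a b
  proof -
    have KH: "K ^\<^sub>m b * H ^\<^sub>m Suc a \<in> carrier_mat n n" using Kp Hp by (rule mult_carrier_mat)
    have OH: "outer x * H ^\<^sub>m a \<in> carrier_mat n n" using O Hp by (rule mult_carrier_mat)
    have KOH: "K ^\<^sub>m b * (outer x * H ^\<^sub>m a) \<in> carrier_mat n n" using Kp OH by (rule mult_carrier_mat)
    have HK: "H ^\<^sub>m a * K ^\<^sub>m b \<in> carrier_mat n n" using Hp Kp by (rule mult_carrier_mat)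
    have "K ^\<^sub>m Suc b * H ^\<^sub>m a = K ^\<^sub>m b * (K * H ^\<^sub>m a)"
      using assoc_mult_mat[OF Kp K Hp] by simp
    also have "K * H ^\<^sub>m a = H ^\<^sub>m Suc a + e \<cdot>\<^sub>m (outer x * H ^\<^sub>m a)"
      unfolding pow_mat_Suc_left[OF H] using add_mult_distrib_mat[OF H eO Hp] mult_smult_assoc_mat[OF O Hp]
      by (metis K_def)
    also have "K ^\<^sub>m b * (H ^\<^sub>m Suc a + e \<cdot>\<^sub>m (outer x * H ^\<^sub>m a))
       = K ^\<^sub>m b * H ^\<^sub>m Suc a + e \<cdot>\<^sub>m (K ^\<^sub>m b * (outer x * H ^\<^sub>m a))"
      using mult_add_distrib_mat[OF Kp Hp smult_carrier_mat[OF OH]] mult_smult_distrib[OF Kp OH] by metis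
    finally have 1: "mat_trace (K ^\<^sub>m Suc b * H ^\<^sub>m a)
        = mat_trace (K ^\<^sub>m b * H ^\<^sub>m Suc a) + e * mat_trace (K ^\<^sub>m b * (outer x * H ^\<^sub>m a))"
      using mat_trace_add[OF KH smult_carrier_mat[OF KOH]] mat_trace_smult[OF KOH] by metis
    have "K ^\<^sub>m b * (outer x * H ^\<^sub>m a) = (K ^\<^sub>m b * outer x) * H ^\<^sub>m a"
      using assoc_mult_mat[OF Kp O Hp] by simp
    then have "mat_trace (K ^\<^sub>m b * (outer x * H ^\<^sub>m a)) = mat_trace (H ^\<^sub>m a * (K ^\<^sub>m b * outer x))"
      using mat_trace_comm[OF mult_carrier_mat[OF Kp O] Hp] by simp
    also have "\<dots> = mat_trace (H ^\<^sub>m a * K ^\<^sub>m b * outer x)"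
      using assoc_mult_mat[OF Hp Kp O] by simp
    also have "\<dots> = x \<bullet> ((H ^\<^sub>m a * K ^\<^sub>m b) *\<^sub>v x)" using mat_trace_mult_outer[OF HK x] .
    also have "\<dots> = g b a" unfolding g_def using assoc_mult_mat_vec[OF Hp Kp x] by simp
    finally show ?thesis using 1 by simp
  qed
  \<comment> \<open>The telescoped identity with \<open>b\<close> factors \<open>K\<close>. The
    summation variable shadows the outer \<open>b\<close>, which is the upper limit of the
    sum.\<close>
  have "mat_trace (K ^\<^sub>m b * H ^\<^sub>m (p - b)) = mat_trace (H ^\<^sub>m p) + e * (\<Sum>b<b. g b (p - 1 - b))"
    if "b \<le> p" for b
    using that
  proof (induction b)
    case 0
    show ?case using left_mult_one_mat[OF Hp] K by simp
  next
    case (Suc b)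
    have s: "Suc (p - Suc b) = p - b" "p - 1 - b = p - Suc b" using Suc.prems by auto
    show ?case using Suc step[of b "p - Suc b"] by (simp add: s algebra_simps del: pow_mat.simps)
  qed
  from this[of p] show "mat_trace (K ^\<^sub>m p) = mat_trace (H ^\<^sub>m p) + e * (\<Sum>b<p. g b (p - 1 - b))"
    using right_mult_one_mat[OF Kp] H by simp
qed

text \<open>Powers of nonnegative numbers are ordered alike, so every product of differences
  \<open>(l i ^ a - l j ^ a) * (l i ^ b - l j ^ b)\<close> is nonnegative. Averaging over pairs with
  weights \<open>w i * w j\<close> gives the claim.\<close>

lemma chebyshev_moments:
  fixes l w :: "nat \<Rightarrow> real"
  assumes "\<And>i. i < n \<Longrightarrow> 0 \<le> l i" "\<And>i. i < n \<Longrightarrow> 0 \<le> w i"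
  shows "(\<Sum>i<n. l i ^ a * w i) * (\<Sum>i<n. l i ^ b * w i)
    \<le> (\<Sum>i<n. w i) * (\<Sum>i<n. l i ^ (a + b) * w i)"
proof -
  have nonneg: "0 \<le> (l i ^ a - l j ^ a) * (l i ^ b - l j ^ b)" if "i < n" "j < n" for i j
  proof (cases "l i \<le> l j")
    case True
    then show ?thesis using assms(1) that by (intro mult_nonpos_nonpos) (auto intro: power_mono)
  next
    case False
    then show ?thesis using assms(1) that by (intro mult_nonneg_nonneg) (auto intro: power_mono)
  qed
  have "0 \<le> (\<Sum>i<n. \<Sum>j<n. w i * w j * ((l i ^ a - l j ^ a) * (l i ^ b - l j ^ b)))"
    by (intro sum_nonneg) (simp add: nonneg assms(2))
  also have "\<dots> = (\<Sum>i<n. \<Sum>j<n. l i ^ (a+b) * w i * w j + w i * (l j ^ (a+b) * w j)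
      - (l i ^ a * w i) * (l j ^ b * w j) - (l i ^ b * w i) * (l j ^ a * w j))"
    by (intro sum.cong refl) (simp add: algebra_simps power_add)
  also have "\<dots> = 2 * ((\<Sum>i<n. w i) * (\<Sum>i<n. l i ^ (a + b) * w i))
      - 2 * ((\<Sum>i<n. l i ^ a * w i) * (\<Sum>i<n. l i ^ b * w i))"
    by (simp add: sum.distrib sum_subtractf sum_product[symmetric])
  finally show ?thesis by simp
qed

text \<open>The product term is at most \<open>R\<close> times the moment of degree a + b, and the
  growth by \<open>h\<close> turns this into \<open>R / h\<close> times the moment of degree a + b +
  1. That is the degree of the leading term, so each step costs a factor 1 + R/h.\<close>

lemma moment_recurrence_up:
  fixes g :: "nat \<Rightarrow> nat \<Rightarrow> real"
  assumes rec: "\<And>b a. g (Suc b) a = g b (Suc a) + g 0 a * g b 0"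
    and pos: "\<And>a. 0 \<le> g 0 a" and cheb: "\<And>a b. g 0 a * g 0 b \<le> R * g 0 (a + b)"
    and grow: "\<And>a. h * g 0 a \<le> g 0 (Suc a)" and h: "0 < h" and R: "0 \<le> R"
  shows "g b a \<le> g 0 (a + b) * (1 + R / h) ^ b"
proof (induction b arbitrary: a)
  case (Suc b)
  let ?q = "(1 + R / h) ^ b"
  have q: "0 \<le> ?q" using h R by simp
  have "g (Suc b) a \<le> g 0 (Suc a + b) * ?q + g 0 a * (g 0 b * ?q)"
    unfolding rec using Suc[of "Suc a"] Suc[of 0] pos by (intro add_mono mult_left_mono) auto
  also have "g 0 a * (g 0 b * ?q) \<le> R * g 0 (a + b) * ?q"
    using mult_right_mono[OF cheb q] by (simp add: mult.assoc)
  also have "R * g 0 (a + b) * ?q \<le> (R / h) * g 0 (Suc (a + b)) * ?q"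
  proof (intro mult_right_mono q)
    have "R * g 0 (a+b) = (R/h) * (h * g 0 (a+b))" using h by simp
    also have "\<dots> \<le> (R/h) * g 0 (Suc (a + b))" using h R grow by (intro mult_left_mono) auto
    finally show "R * g 0 (a + b) \<le> (R / h) * g 0 (Suc (a + b))" .
  qed
  finally show ?case by (simp add: algebra_simps)
qed simp

text \<open>The product is now subtracted and needs an upper bound. Positivity of the forms of
  \<open>K\<close> first gives \<open>g b a \<le> g 0 (a + b)\<close>; each step then loses at most
  \<open>R / h\<close> of an unperturbed moment, so the losses add up instead of
  multiplying.\<close>

lemma moment_recurrence_down:
  fixes g :: "nat \<Rightarrow> nat \<Rightarrow> real"
  assumes rec: "\<And>b a. g (Suc b) a = g b (Suc a) - g 0 a * g b 0"
    and pos: "\<And>a. 0 \<le> g 0 a" and posK: "\<And>b. 0 \<le> g b 0"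
    and cheb: "\<And>a b. g 0 a * g 0 b \<le> R * g 0 (a + b)"
    and grow: "\<And>a. h * g 0 a \<le> g 0 (Suc a)" and h: "0 < h" and R: "0 \<le> R"
  shows "g 0 (a + b) * (1 - b * (R / h)) \<le> g b a"
proof -
  have le: "g b a \<le> g 0 (a + b)" for a b
  proof (induction b arbitrary: a)
    case (Suc b)
    have "0 \<le> g 0 a * g b 0" using pos posK by simp
    then show ?case using rec[of b a] Suc[of "Suc a"] by simp
  qed simp
  show ?thesis
  proof (induction b arbitrary: a)
    case (Suc b)
    have "g 0 a * g b 0 \<le> g 0 a * g 0 b" using le[of b 0] pos by (simp add: mult_left_mono)
    also have "\<dots> \<le> R * g 0 (a + b)" by (rule cheb)
    also have "\<dots> = (R/h) * (h * g 0 (a+b))" using h by simp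
    also have "\<dots> \<le> (R/h) * g 0 (Suc (a + b))" using h R grow by (intro mult_left_mono) auto
    finally show ?case using Suc[of "Suc a"] rec[of b a] by (simp add: algebra_simps)
  qed simp
qed

text \<open>These are the hypotheses of both recurrences. The weights are squared coordinates of
  \<open>x\<close>, of total mass \<open>x \<bullet> x\<close>, which is where \<open>R\<close>
  enters; the lower bound \<open>h\<close> on the form makes all eigenvalues positive.\<close>

lemma (in spectral) moments:
  assumes x: "x \<in> carrier_vec n" and xR: "x \<bullet> x \<le> R" and h: "0 < h"
    and low: "\<And>v. v \<in> carrier_vec n \<Longrightarrow> h * (v \<bullet> v) \<le> v \<bullet> (A *\<^sub>v v)"
  defines "m \<equiv> \<lambda>a. x \<bullet> (A ^\<^sub>m a *\<^sub>v x)"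
  shows "0 \<le> m a" and "m a * m b \<le> R * m (a + b)" and "h * m a \<le> m (Suc a)"
proof -
  let ?w = "\<lambda>i. (col Q i \<bullet> x)\<^sup>2"
  have m: "m a = (\<Sum>i<n. l i ^ a * ?w i)" for a unfolding m_def by (rule quad_pow[OF x])
  have lh: "h \<le> l i" if "i < n" for i using eigenvalue_ge[OF low that] by blast
  have l0: "0 \<le> l i" if "i < n" for i using lh[OF that] h by simp
  show m0: "0 \<le> m a" for a unfolding m using l0 by (intro sum_nonneg mult_nonneg_nonneg) auto
  have "m a * m b \<le> (x \<bullet> x) * m (a + b)"
    unfolding m parseval[OF x] using l0 by (intro chebyshev_moments) auto
  also have "\<dots> \<le> R * m (a + b)" using xR m0 by (intro mult_right_mono) auto
  finally show "m a * m b \<le> R * m (a + b)" .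
  show "h * m a \<le> m (Suc a)"
    unfolding m sum_distrib_left
  proof (rule sum_mono)
    fix i assume "i \<in> {..<n}"
    then have i: "i < n" by simp
    show "h * (l i ^ a * ?w i) \<le> l i ^ Suc a * ?w i"
      using mult_right_mono[OF lh[OF i], of "l i ^ a * ?w i"] l0[OF i] by (simp add: mult.assoc)
  qed
qed

text \<open>All \<open>p\<close> mixed forms have total degree p - 1, so each is at most (1 + R/h)^p
  times one and the same moment of \<open>H\<close>.\<close>

lemma trace_pow_add_outer:
  assumes H: "H \<in> carrier_mat n n" "H\<^sup>T = H" and x: "x \<in> carrier_vec n" and xR: "x \<bullet> x \<le> R"
    and h: "0 < h" and R: "0 \<le> R"
    and low: "\<And>v. v \<in> carrier_vec n \<Longrightarrow> h * (v \<bullet> v) \<le> v \<bullet> (H *\<^sub>v v)"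
  shows "mat_trace ((H + outer x) ^\<^sub>m p)
    \<le> mat_trace (H ^\<^sub>m p) + p * (1 + R / h) ^ p * (x \<bullet> (H ^\<^sub>m (p - 1) *\<^sub>v x))"
proof -
  obtain Q l where "spectral n H Q l" using spectral_exists[OF H] .
  then interpret spectral n H Q l .
  define K where "K = H + 1 \<cdot>\<^sub>m outer x"
  define g where "g b a = x \<bullet> (H ^\<^sub>m a *\<^sub>v (K ^\<^sub>m b *\<^sub>v x))" for b a
  have K: "K \<in> carrier_mat n n" using H x by (simp add: K_def)
  have KO: "K = H + outer x" unfolding K_def by (rule arg_cong[of _ _ "\<lambda>M. H + M"]) (rule eq_matI, auto)
  note tr = trace_pow_rank_one[OF H(1) x, where e = 1, folded K_def, folded g_def]
  have g0: "g 0 a = x \<bullet> (H ^\<^sub>m a *\<^sub>v x)" for a using K x by (simp add: g_def)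
  have ub: "g b a \<le> g 0 (a + b) * (1 + R / h) ^ b" for a b
    by (rule moment_recurrence_up) (use tr(1) moments[OF x xR h low, folded g0] h R in auto)
  have "g b (p - 1 - b) \<le> g 0 (p - 1) * (1 + R / h) ^ p" if "b < p" for b
  proof -
    have "g b (p - 1 - b) \<le> g 0 (p - 1) * (1 + R / h) ^ b" using ub[of b "p - 1 - b"] that by simp
    also have "\<dots> \<le> g 0 (p - 1) * (1 + R / h) ^ p"
      using moments(1)[OF x xR h low, folded g0] h R that by (intro mult_left_mono power_increasing) auto
    finally show ?thesis .
  qed
  then have "(\<Sum>b<p. g b (p - 1 - b)) \<le> p * (g 0 (p - 1) * (1 + R / h) ^ p)"
    using sum_mono[of "{..<p}" "\<lambda>b. g b (p - 1 - b)" "\<lambda>_. g 0 (p - 1) * (1 + R / h) ^ p"] by simp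
  then show ?thesis using tr(2)[of p] unfolding KO[symmetric] g0[symmetric] by (simp add: algebra_simps)
qed

text \<open>Positivity of the forms of the smaller matrix is part of the argument, hence the
  hypothesis \<open>lowK\<close>. With p R \<le> h the accumulated relative losses leave at least
  half of the first-order decrease.\<close>

lemma trace_pow_minus_outer:
  assumes H: "H \<in> carrier_mat n n" "H\<^sup>T = H" and x: "x \<in> carrier_vec n" and xR: "x \<bullet> x \<le> R"
    and h: "0 < h" and R: "0 \<le> R"
    and low: "\<And>v. v \<in> carrier_vec n \<Longrightarrow> h * (v \<bullet> v) \<le> v \<bullet> (H *\<^sub>v v)"
    and lowK: "\<And>v. v \<in> carrier_vec n \<Longrightarrow> h * (v \<bullet> v) \<le> v \<bullet> ((H - outer x) *\<^sub>v v)"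
    and p: "p * R \<le> h"
  shows "mat_trace ((H - outer x) ^\<^sub>m p)
    \<le> mat_trace (H ^\<^sub>m p) - p / 2 * (x \<bullet> (H ^\<^sub>m (p - 1) *\<^sub>v x))"
proof -
  obtain Q l where "spectral n H Q l" using spectral_exists[OF H] .
  then interpret spectral n H Q l .
  define K where "K = H + (-1) \<cdot>\<^sub>m outer x"
  define g where "g b a = x \<bullet> (H ^\<^sub>m a *\<^sub>v (K ^\<^sub>m b *\<^sub>v x))" for b a
  have K: "K \<in> carrier_mat n n" using H x by (simp add: K_def)
  have KO: "K = H - outer x" unfolding K_def by (rule eq_matI) (use H x in \<open>auto simp: outer_def\<close>)
  have KT: "K\<^sup>T = K"
    unfolding KO by (rule eq_matI) (use H x in \<open>auto simp: outer_def mult.commute\<close>,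
      metis H carrier_matD index_transpose_mat(1))
  obtain Q' l' where sK: "spectral n K Q' l'" using spectral_exists[OF K KT] .
  note tr = trace_pow_rank_one[OF H(1) x, where e = "-1", folded K_def, folded g_def]
  have g0: "g 0 a = x \<bullet> (H ^\<^sub>m a *\<^sub>v x)" for a using K x by (simp add: g_def)
  have gb: "g b 0 = x \<bullet> (K ^\<^sub>m b *\<^sub>v x)" for b
    using carrier_matD[OF H(1)] mult_mat_vec_carrier[OF pow_carrier_mat[OF K] x] by (simp add: g_def)
  have m0: "0 \<le> g 0 a" for a using moments(1)[OF x xR h low, folded g0] .
  have gK: "0 \<le> g b 0" for b
    unfolding gb by (rule spectral.moments(1)[OF sK x xR h]) (use lowK in \<open>simp add: KO\<close>)
  have lb: "g 0 (a + b) * (1 - b * (R / h)) \<le> g b a" for a b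
    by (rule moment_recurrence_down) (use tr(1) gK moments[OF x xR h low, folded g0] h R in auto)
  have "g 0 (p - 1) * (p / 2) \<le> (\<Sum>b<p. g b (p - 1 - b))"
  proof -
    \<comment> \<open>The total loss is R/h times the sum of all b < p, hence at most (p/2)(p R/h)
      \<le> p/2 out of \<open>p\<close>.\<close>
    have 1: "(\<Sum>b<p. real b) \<le> real p * real p / 2" by (induction p) (auto simp: algebra_simps)
    have "(\<Sum>b<p. real b) * (R / h) \<le> (real p * real p / 2) * (R / h)"
      using 1 R h by (intro mult_right_mono) auto
    also have "\<dots> = p / 2 * (p * R / h)" by simp
    also have "\<dots> \<le> p / 2 * 1" using p h by (intro mult_left_mono) auto
    finally have 2: "real p / 2 \<le> (\<Sum>b<p. 1 - b * (R / h))"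
      unfolding sum_subtractf sum_distrib_right[symmetric] by simp
    have "g 0 (p - 1) * (p / 2) \<le> g 0 (p - 1) * (\<Sum>b<p. 1 - b * (R / h))"
      using 2 m0 by (intro mult_left_mono) auto
    also have "\<dots> = (\<Sum>b<p. g 0 (p - 1) * (1 - b * (R / h)))" by (rule sum_distrib_left)
    also have "\<dots> \<le> (\<Sum>b<p. g b (p - 1 - b))"
    proof (rule sum_mono)
      fix b assume "b \<in> {..<p}"
      then show "g 0 (p - 1) * (1 - b * (R / h)) \<le> g b (p - 1 - b)" using lb[of "p - 1 - b" b] by simp
    qed
    finally show ?thesis .
  qed
  then show ?thesis using tr(2)[of p] unfolding KO[symmetric] g0[symmetric] by (simp add: algebra_simps)
qed

section \<open>Random subsets of a tight frame\<close>

text \<open>The expectation under a uniform \<open>k\<close>-subset, kept as a finite sum so that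
  sampling without replacement reduces to double counting.\<close>

definition subset_avg :: "'i set \<Rightarrow> nat \<Rightarrow> ('i set \<Rightarrow> real) \<Rightarrow> real" where
  "subset_avg I k f = (\<Sum>T | T \<subseteq> I \<and> card T = k. f T) / (card I choose k)"

text \<open>Double counting of pairs of a set with k + 1 elements and a distinguished member,
  regarded as the element added last.\<close>

lemma sum_subsets_Suc:
  fixes f :: "'i set \<Rightarrow> real"
  assumes I: "finite I"
  shows "Suc k * (\<Sum>T | T \<subseteq> I \<and> card T = Suc k. f T)
    = (\<Sum>T | T \<subseteq> I \<and> card T = k. \<Sum>i\<in>I - T. f (insert i T))"
proof -
  let ?S = "\<lambda>k. {T. T \<subseteq> I \<and> card T = k}"
  have fin: "finite (?S k)" for k using I by simp
  have finT: "finite T" if "T \<in> ?S k" for T k using that I finite_subset by auto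
  have "Suc k * (\<Sum>T\<in>?S (Suc k). f T) = (\<Sum>T\<in>?S (Suc k). \<Sum>i\<in>T. f T)"
    by (simp add: sum_distrib_left)
  also have "\<dots> = (\<Sum>(T,i)\<in>Sigma (?S (Suc k)) (\<lambda>T. T). f T)"
    using fin finT by (intro sum.Sigma) blast+
  also have "\<dots> = (\<Sum>(T,i)\<in>Sigma (?S k) (\<lambda>T. I - T). f (insert i T))"
    by (rule sum.reindex_bij_witness[where i = "\<lambda>(T,i). (insert i T, i)" and j = "\<lambda>(T,i). (T - {i}, i)"])
      (use I in \<open>auto simp: insert_absorb card_Diff_singleton finite_subset card_insert_if\<close>)
  also have "\<dots> = (\<Sum>T\<in>?S k. \<Sum>i\<in>I - T. f (insert i T))"
    using fin I by (intro sum.Sigma[symmetric]) auto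
  finally show ?thesis .
qed

text \<open>One draw without replacement: \<open>step\<close> bounds the mean over the N - k
  possible next elements. The affine form serves both tails, with b = 0 for growth and b > 0 for
  decay down to a floor.\<close>

lemma subset_avg_Suc_le:
  fixes f :: "'i set \<Rightarrow> real"
  assumes I: "finite I" and k: "k < card I"
    and step: "\<And>T. T \<subseteq> I \<Longrightarrow> card T = k
      \<Longrightarrow> (\<Sum>i\<in>I - T. f (insert i T)) \<le> (real (card I) - k) * (a * f T + b)"
  shows "subset_avg I (Suc k) f \<le> a * subset_avg I k f + b"
proof -
  let ?N = "card I"
  let ?S = "\<lambda>k. {T. T \<subseteq> I \<and> card T = k}"
  have cS: "card (?S k) = ?N choose k" using n_subsets[OF I] by simp
  have C: "real (Suc k) * (?N choose Suc k) = (real ?N - k) * (?N choose k)"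
  proof -
    have "Suc k * (?N choose Suc k) = (?N - k) * (?N choose k)"
      using binomial_absorb_comp[of ?N k] binomial_absorption[of k ?N] by simp
    then have "real (Suc k * (?N choose Suc k)) = real ((?N - k) * (?N choose k))" by (rule arg_cong)
    then show ?thesis using k by (simp only: of_nat_mult of_nat_diff less_imp_le_nat)
  qed
  have pos: "0 < real (?N choose k)" "0 < real (?N choose Suc k)" "0 < real ?N - k"
    using k by (auto simp: zero_less_binomial_iff)
  have "real (Suc k) * sum f (?S (Suc k)) \<le> (\<Sum>T\<in>?S k. (real ?N - k) * (a * f T + b))"
    unfolding sum_subsets_Suc[OF I] using step by (intro sum_mono) auto
  also have "\<dots> = (real ?N - k) * (a * sum f (?S k) + b * (?N choose k))"
    by (simp only: sum_distrib_left[symmetric] sum.distrib) (simp add: cS)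
  also have "\<dots> = (real ?N - k) * (?N choose k) * (a * subset_avg I k f + b)"
    using pos by (simp add: subset_avg_def field_simps)
  also have "\<dots> = real (Suc k) * ((?N choose Suc k) * (a * subset_avg I k f + b))"
    unfolding C[symmetric] by simp
  finally have "sum f (?S (Suc k)) \<le> (?N choose Suc k) * (a * subset_avg I k f + b)"
    by (simp del: of_nat_Suc)
  then show ?thesis using pos by (simp add: subset_avg_def field_simps)
qed

lemma card_subsets_le_avg:
  fixes f :: "'i set \<Rightarrow> real" and t :: real
  assumes I: "finite I" and k: "k \<le> card I"
    and nonneg: "\<And>T. T \<subseteq> I \<Longrightarrow> card T = k \<Longrightarrow> 0 \<le> f T"
    and large: "\<And>T. T \<subseteq> I \<Longrightarrow> card T = k \<Longrightarrow> P T \<Longrightarrow> t \<le> f T"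
  shows "card {T. T \<subseteq> I \<and> card T = k \<and> P T} * t \<le> (card I choose k) * subset_avg I k f"
proof -
  have "card {T. T \<subseteq> I \<and> card T = k \<and> P T} * t \<le> (\<Sum>T | T \<subseteq> I \<and> card T = k \<and> P T. f T)"
    using sum_bounded_below[of "{T. T \<subseteq> I \<and> card T = k \<and> P T}" t f] large by auto
  also have "\<dots> \<le> (\<Sum>T | T \<subseteq> I \<and> card T = k. f T)"
    using I nonneg by (intro sum_mono2) auto
  finally show ?thesis using k by (simp add: subset_avg_def zero_less_binomial_iff)
qed

lemma subset_avg_0: "finite I \<Longrightarrow> subset_avg I 0 f = f {}"
proof -
  assume I: "finite I"
  have "{T. T \<subseteq> I \<and> card T = 0} = {{}}" using finite_subset[OF _ I] by auto
  then show ?thesis by (simp add: subset_avg_def)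
qed

lemma one_plus_ge_exp_half:
  fixes y :: real
  assumes "0 \<le> y" "y \<le> 1"
  shows "exp (y / 2) \<le> 1 + y"
proof -
  have "exp (y/2) \<le> 1 + y/2 + (y/2)\<^sup>2" using assms by (intro exp_bound) auto
  also have "(y/2)\<^sup>2 \<le> y/2" using assms mult_left_mono[of y 2 y] by (simp add: power2_eq_square)
  finally show ?thesis by simp
qed

lemma one_minus_ge_exp:
  fixes y :: real
  assumes "0 \<le> y" "y \<le> 1/2"
  shows "exp (- (2 * y)) \<le> 1 - y"
proof -
  have "0 \<le> y * (1 - 2 * y)" using assms by (intro mult_nonneg_nonneg) auto
  then have "1 \<le> (1 - y) * (1 + 2 * y)" by (simp add: algebra_simps)
  also have "\<dots> \<le> (1 - y) * exp (2 * y)" using assms exp_ge_add_one_self[of "2 * y"] by (intro mult_left_mono) auto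
  finally show ?thesis by (simp add: exp_minus field_simps)
qed

text \<open>\<open>tight\<close> says that the whole family sums to the identity, so a random
  \<open>m\<close>-subset has mean m/N times the identity. \<open>R\<close> caps the effect of one
  draw; the relevant sample size is m/(N R), called \<rho> below.\<close>

locale tight_frame =
  fixes I :: "'i set" and x :: "'i \<Rightarrow> real vec" and D :: nat and R :: real
  assumes finI: "finite I"
    and x_carrier: "i \<in> I \<Longrightarrow> x i \<in> carrier_vec D"
    and tight: "a < D \<Longrightarrow> b < D \<Longrightarrow> (\<Sum>i\<in>I. x i $ a * x i $ b) = (if a = b then 1 else 0)"
    and x_le: "i \<in> I \<Longrightarrow> x i \<bullet> x i \<le> R"
    and R: "0 < R"
begin

definition S :: "'i set \<Rightarrow> real mat" where
  "S T = mat D D (\<lambda>(a,b). \<Sum>i\<in>T. x i $ a * x i $ b)"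

abbreviation N :: real where "N \<equiv> real (card I)"

lemma S_carrier [simp]: "S T \<in> carrier_mat D D" by (simp add: S_def)

lemma S_all: "S I = 1\<^sub>m D"
  by (rule eq_matI) (auto simp: S_def tight)

lemma S_empty: "S {} = 0\<^sub>m D D"
  by (rule eq_matI) (auto simp: S_def)

lemma S_insert:
  assumes "finite T" "i \<notin> T" "i \<in> I"
  shows "S (insert i T) = S T + outer (x i)"
  by (rule eq_matI) (use assms x_carrier[of i] in \<open>auto simp: S_def outer_def add.commute\<close>)

lemma S_quad:
  assumes T: "T \<subseteq> I" and v: "v \<in> carrier_vec D"
  shows "v \<bullet> (S T *\<^sub>v v) = (\<Sum>i\<in>T. (x i \<bullet> v)\<^sup>2)"
  using finite_subset[OF T finI] T
proof (induction T)
  case empty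
  have "0\<^sub>m D D *\<^sub>v v = 0\<^sub>v D" using v by auto
  then show ?case using v by (simp add: S_empty)
next
  case (insert i T)
  have xi: "x i \<in> carrier_vec D" using x_carrier insert by simp
  have "v \<bullet> ((S T + outer (x i)) *\<^sub>v v) = v \<bullet> (S T *\<^sub>v v + (x i \<bullet> v) \<cdot>\<^sub>v x i)"
    using add_mult_distrib_mat_vec[OF S_carrier outer_carrier[OF xi] v] outer_mult_vec[OF xi v] by simp
  also have "\<dots> = v \<bullet> (S T *\<^sub>v v) + (x i \<bullet> v) * (v \<bullet> x i)"
    using scalar_prod_add_distrib[OF v mult_mat_vec_carrier[OF S_carrier v]] scalar_prod_smult_distrib[OF v xi] xi
    by simp
  finally show ?case using insert S_insert[of T i] comm_scalar_prod[OF v xi]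
    by (simp add: power2_eq_square)
qed

text \<open>Summing the one-step changes over candidate elements thus produces a trace, and over the
  whole frame simply the trace of \<open>M\<close>.\<close>

lemma trace_mult_S:
  assumes T: "T \<subseteq> I" and M: "M \<in> carrier_mat D D"
  shows "mat_trace (M * S T) = (\<Sum>i\<in>T. x i \<bullet> (M *\<^sub>v x i))"
  using finite_subset[OF T finI] T
proof (induction T)
  case empty
  show ?case using right_mult_zero_mat[OF M] by (simp add: S_empty mat_trace_def)
next
  case (insert i T)
  have xi: "x i \<in> carrier_vec D" using x_carrier insert by simp
  have "mat_trace (M * (S T + outer (x i))) = mat_trace (M * S T) + mat_trace (M * outer (x i))"
    using mult_add_distrib_mat[OF M S_carrier outer_carrier[OF xi]]
      mat_trace_add[OF mult_carrier_mat[OF M S_carrier] mult_carrier_mat[OF M outer_carrier[OF xi]]] by simp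
  then show ?case using insert S_insert[of T i] mat_trace_mult_outer[OF M xi] by simp
qed

lemma S_quad_nonneg: "T \<subseteq> I \<Longrightarrow> v \<in> carrier_vec D \<Longrightarrow> 0 \<le> v \<bullet> (S T *\<^sub>v v)"
  by (simp add: S_quad sum_nonneg)

lemma S_quad_le: "T \<subseteq> I \<Longrightarrow> v \<in> carrier_vec D \<Longrightarrow> v \<bullet> (S T *\<^sub>v v) \<le> v \<bullet> v"
proof -
  assume T: "T \<subseteq> I" and v: "v \<in> carrier_vec D"
  have "(\<Sum>i\<in>T. (x i \<bullet> v)\<^sup>2) \<le> (\<Sum>i\<in>I. (x i \<bullet> v)\<^sup>2)"
    using T finI by (intro sum_mono2) auto
  then show "v \<bullet> (S T *\<^sub>v v) \<le> v \<bullet> v"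
    using S_quad[OF T v] S_quad[OF order_refl v] v by (simp add: S_all)
qed

text \<open>Since \<open>S T\<close> is at most the identity, \<open>HL h T\<close> is bounded below by \<open>h\<close>, uniformly in \<open>T\<close>; moreover
  \<open>HL h T - h\<close> is the frame operator of the unsampled vectors.\<close>

definition HU :: "real \<Rightarrow> 'i set \<Rightarrow> real mat" where "HU h T = h \<cdot>\<^sub>m 1\<^sub>m D + S T"
definition HL :: "real \<Rightarrow> 'i set \<Rightarrow> real mat" where "HL h T = (h + 1) \<cdot>\<^sub>m 1\<^sub>m D - S T"

lemma H_carrier [simp]: "HU h T \<in> carrier_mat D D" "HL h T \<in> carrier_mat D D"
  by (auto simp: HU_def HL_def intro!: minus_carrier_mat)

lemma H_sym: "(HU h T)\<^sup>T = HU h T" "(HL h T)\<^sup>T = HL h T"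
proof -
  have "S T $$ (i,j) = S T $$ (j,i)" if "i < D" "j < D" for i j using that by (simp add: S_def mult.commute)
  then show "(HU h T)\<^sup>T = HU h T" "(HL h T)\<^sup>T = HL h T"
    by (auto simp: HU_def HL_def S_def intro!: eq_matI)
qed

lemma HU_quad:
  assumes "v \<in> carrier_vec D"
  shows "v \<bullet> (HU h T *\<^sub>v v) = h * (v \<bullet> v) + v \<bullet> (S T *\<^sub>v v)"
proof -
  have "(h \<cdot>\<^sub>m 1\<^sub>m D) *\<^sub>v v = h \<cdot>\<^sub>v v" using assms by (intro eq_vecI) auto
  then have "HU h T *\<^sub>v v = h \<cdot>\<^sub>v v + S T *\<^sub>v v"
    unfolding HU_def using add_mult_distrib_mat_vec[of "h \<cdot>\<^sub>m 1\<^sub>m D" D D "S T" v] assms by simp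
  then show ?thesis
    using scalar_prod_add_distrib[OF assms smult_carrier_vec[THEN iffD2, OF assms] mult_mat_vec_carrier[OF S_carrier assms]]
      scalar_prod_smult_distrib[OF assms assms] by simp
qed

lemma HL_quad:
  assumes "v \<in> carrier_vec D"
  shows "v \<bullet> (HL h T *\<^sub>v v) = (h + 1) * (v \<bullet> v) - v \<bullet> (S T *\<^sub>v v)"
proof -
  have "((h + 1) \<cdot>\<^sub>m 1\<^sub>m D) *\<^sub>v v = (h + 1) \<cdot>\<^sub>v v" using assms by (intro eq_vecI) auto
  then have "HL h T *\<^sub>v v = (h + 1) \<cdot>\<^sub>v v - S T *\<^sub>v v"
    unfolding HL_def using minus_mult_distrib_mat_vec[of "(h + 1) \<cdot>\<^sub>m 1\<^sub>m D" D D "S T" v] assms by simp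
  then show ?thesis
    using scalar_prod_minus_distrib[OF assms smult_carrier_vec[THEN iffD2, OF assms] mult_mat_vec_carrier[OF S_carrier assms]]
      scalar_prod_smult_distrib[OF assms assms] by simp
qed

lemma HU_insert: "finite T \<Longrightarrow> i \<notin> T \<Longrightarrow> i \<in> I \<Longrightarrow> HU h (insert i T) = HU h T + outer (x i)"
  unfolding HU_def using S_insert assoc_add_mat[of "h \<cdot>\<^sub>m 1\<^sub>m D" D D "S T" "outer (x i)"] x_carrier by simp

lemma HL_insert: "finite T \<Longrightarrow> i \<notin> T \<Longrightarrow> i \<in> I \<Longrightarrow> HL h (insert i T) = HL h T - outer (x i)"
proof -
  assume *: "finite T" "i \<notin> T" "i \<in> I"
  show ?thesis unfolding HL_def S_insert[OF *]
    by (rule eq_matI) (use x_carrier[OF *(3)] in \<open>auto simp: outer_def S_def\<close>)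
qed

lemma HU_low: "T \<subseteq> I \<Longrightarrow> v \<in> carrier_vec D \<Longrightarrow> h * (v \<bullet> v) \<le> v \<bullet> (HU h T *\<^sub>v v)"
  using S_quad_nonneg by (simp add: HU_quad)

lemma HL_low: "T \<subseteq> I \<Longrightarrow> v \<in> carrier_vec D \<Longrightarrow> h * (v \<bullet> v) \<le> v \<bullet> (HL h T *\<^sub>v v)"
  using S_quad_le[of T v] by (simp add: HL_quad algebra_simps)

lemma HL_up: "T \<subseteq> I \<Longrightarrow> v \<in> carrier_vec D \<Longrightarrow> v \<bullet> (HL h T *\<^sub>v v) \<le> (h + 1) * (v \<bullet> v)"
  using S_quad_nonneg[of T v] by (simp add: HL_quad)

section \<open>Tail bounds from the trace-power potentials\<close>

lemma trace_pow_ge_eigenvalue: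
  assumes "spectral D H Q l" "\<And>i. i < D \<Longrightarrow> 0 \<le> l i" "j < D" "0 \<le> y" "y \<le> l j"
  shows "y ^ p \<le> mat_trace (H ^\<^sub>m p)"
proof -
  have "y ^ p \<le> l j ^ p" using assms by (intro power_mono) auto
  also have "\<dots> \<le> (\<Sum>i<D. l i ^ p)" using assms by (intro member_le_sum) auto
  finally show ?thesis using spectral.trace_pow[OF assms(1)] by simp
qed

text \<open>A direction in which \<open>S T\<close> exceeds \<open>z\<close> forces an eigenvalue of
  \<open>HU h T\<close> above h + z, and its p-th power alone is at most the trace. Combined with
  averaging, this is the event side of Markov's inequality.\<close>

lemma HU_trace_ge:
  assumes T: "T \<subseteq> I" and h: "0 < h" and z: "0 \<le> z"
    and v: "v \<in> carrier_vec D" "z * (v \<bullet> v) < v \<bullet> (S T *\<^sub>v v)"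
  shows "(h + z) ^ p \<le> mat_trace (HU h T ^\<^sub>m p)"
proof -
  obtain Q l where sp: "spectral D (HU h T) Q l" using spectral_exists[OF H_carrier(1) H_sym(1)] .
  have low: "h \<le> l i" if "i < D" for i using spectral.eigenvalue_ge[OF sp HU_low[OF T] that] .
  obtain j where "j < D" "h + z < l j"
    using spectral.exists_large_eigenvalue[OF sp v(1), of "h + z"] v by (auto simp: HU_quad algebra_simps)
  then show ?thesis using low h z by (intro trace_pow_ge_eigenvalue[OF sp, of j]) (force intro: order_trans)+
qed

lemma HL_trace_ge:
  assumes T: "T \<subseteq> I" and h: "0 < h" and z: "z \<le> h + 1"
    and v: "v \<in> carrier_vec D" "v \<bullet> (S T *\<^sub>v v) < z * (v \<bullet> v)"
  shows "(h + 1 - z) ^ p \<le> mat_trace (HL h T ^\<^sub>m p)"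
proof -
  obtain Q l where sp: "spectral D (HL h T) Q l" using spectral_exists[OF H_carrier(2) H_sym(2)] .
  have low: "h \<le> l i" if "i < D" for i using spectral.eigenvalue_ge[OF sp HL_low[OF T] that] .
  obtain j where "j < D" "h + 1 - z < l j"
    using spectral.exists_large_eigenvalue[OF sp v(1), of "h + 1 - z"] v by (auto simp: HL_quad algebra_simps)
  then show ?thesis using low h z by (intro trace_pow_ge_eigenvalue[OF sp, of j]) (force intro: order_trans)+
qed

lemma HU_trace_nonneg: "T \<subseteq> I \<Longrightarrow> 0 < h \<Longrightarrow> 0 \<le> mat_trace (HU h T ^\<^sub>m p)"
proof -
  assume T: "T \<subseteq> I" and h: "0 < h"
  obtain Q l where sp: "spectral D (HU h T) Q l" using spectral_exists[OF H_carrier(1) H_sym(1)] .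
  have low: "h \<le> l i" if "i < D" for i using spectral.eigenvalue_ge[OF sp HU_low[OF T] that] .
  show ?thesis unfolding spectral.trace_pow[OF sp] using low h by (intro sum_nonneg zero_le_power) force
qed

lemma HL_trace_nonneg: "T \<subseteq> I \<Longrightarrow> 0 < h \<Longrightarrow> 0 \<le> mat_trace (HL h T ^\<^sub>m p)"
proof -
  assume T: "T \<subseteq> I" and h: "0 < h"
  obtain Q l where sp: "spectral D (HL h T) Q l" using spectral_exists[OF H_carrier(2) H_sym(2)] .
  have low: "h \<le> l i" if "i < D" for i using spectral.eigenvalue_ge[OF sp HL_low[OF T] that] .
  show ?thesis unfolding spectral.trace_pow[OF sp] using low h by (intro sum_nonneg zero_le_power) force
qed

lemma trace_pow_scalar:
  fixes c :: real
  shows "mat_trace ((c \<cdot>\<^sub>m 1\<^sub>m D) ^\<^sub>m p) = D * c ^ p"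
proof -
  have "c \<cdot>\<^sub>m 1\<^sub>m D = 1\<^sub>m D * mat_diag D (\<lambda>_. c) * (1\<^sub>m D)\<^sup>T"
    by (simp add: left_mult_one_mat[OF mat_diag_dim] right_mult_one_mat[OF mat_diag_dim])
      (rule eq_matI, auto simp: mat_diag_def)
  then have "spectral D (c \<cdot>\<^sub>m 1\<^sub>m D) (1\<^sub>m D) (\<lambda>_. c)" by unfold_locales auto
  from spectral.trace_pow[OF this] show ?thesis by simp
qed

text \<open>With h = p R the factor (1 + R/h)^p is at most e, hence at most 3. The added terms total
  at most 3 p/h = 3/R times the potential, and dividing by the number of choices costs another
  factor 2. The \<open>+ 0\<close> fits the affine form of the averaging lemma.\<close>

lemma HU_step:
  assumes T: "T \<subseteq> I" "card T = k" and k: "2 * k \<le> card I" "k < card I"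
    and p: "0 < p" and h: "h = p * R"
  shows "(\<Sum>i\<in>I - T. mat_trace (HU h (insert i T) ^\<^sub>m p))
     \<le> (N - k) * ((1 + 6 / (R * N)) * mat_trace (HU h T ^\<^sub>m p) + 0)"
proof -
  let ?H = "HU h T" and ?t = "\<lambda>p. mat_trace (HU h T ^\<^sub>m p)"
  have finT: "finite T" using T finI finite_subset by auto
  have h0: "0 < h" using h p R by simp
  have q: "(1 + R / h) ^ p \<le> 3"
  proof -
    have "(1 + R / h) ^ p \<le> exp (R / h) ^ p" using exp_ge_add_one_self[of "R/h"] h0 R by (intro power_mono) auto
    also have "\<dots> = exp 1" using h p R by (simp add: exp_of_nat_mult[symmetric])
    finally show ?thesis using exp_le by simp
  qed
  have M: "?H ^\<^sub>m (p - 1) \<in> carrier_mat D D" using pow_carrier_mat by simp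
  obtain Q l where sp: "spectral D ?H Q l" using spectral_exists[OF H_carrier(1) H_sym(1)] .
  have low: "h \<le> l i" if "i < D" for i using spectral.eigenvalue_ge[OF sp HU_low[OF T(1)] that] .
  have m0: "0 \<le> x i \<bullet> (?H ^\<^sub>m (p - 1) *\<^sub>v x i)" if "i \<in> I" for i
    using spectral.moments(1)[OF sp x_carrier[OF that] x_le[OF that] h0 HU_low[OF T(1)]] .
  \<comment> \<open>Passing to all of \<open>I\<close> makes the frame operator the identity; the
    surplus terms are nonnegative.\<close>
  have "(\<Sum>i\<in>I - T. x i \<bullet> (?H ^\<^sub>m (p - 1) *\<^sub>v x i)) \<le> (\<Sum>i\<in>I. x i \<bullet> (?H ^\<^sub>m (p - 1) *\<^sub>v x i))"
    using m0 finI by (intro sum_mono2) auto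
  also have "\<dots> = ?t (p - 1)"
    using trace_mult_S[OF order_refl M] right_mult_one_mat[OF M] by (simp add: S_all)
  also have "\<dots> \<le> ?t p / h"
  proof -
    have "h * ?t (p - 1) \<le> ?t p"
      unfolding spectral.trace_pow[OF sp] sum_distrib_left
    proof (rule sum_mono)
      fix i assume "i \<in> {..<D}"
      then have "h \<le> l i" using low by simp
      then have "h * l i ^ (p - 1) \<le> l i * l i ^ (p - 1)" using h0 by (intro mult_right_mono) auto
      then show "h * l i ^ (p - 1) \<le> l i ^ p" using p by (simp add: power_eq_if)
    qed
    then show ?thesis using h0 by (simp add: field_simps)
  qed
  finally have sum_m: "(\<Sum>i\<in>I - T. x i \<bullet> (?H ^\<^sub>m (p - 1) *\<^sub>v x i)) \<le> ?t p / h" .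
  have t0: "0 \<le> ?t p" using HU_trace_nonneg T h0 by blast
  have "mat_trace (HU h (insert i T) ^\<^sub>m p) \<le> ?t p + p * 3 * (x i \<bullet> (?H ^\<^sub>m (p - 1) *\<^sub>v x i))"
    if i: "i \<in> I - T" for i
  proof -
    have iI: "i \<in> I" "i \<notin> T" using i by auto
    have "mat_trace (HU h (insert i T) ^\<^sub>m p)
        \<le> ?t p + p * (1 + R / h) ^ p * (x i \<bullet> (?H ^\<^sub>m (p - 1) *\<^sub>v x i))"
      unfolding HU_insert[OF finT iI(2,1)]
      by (rule trace_pow_add_outer[OF H_carrier(1) H_sym(1) x_carrier[OF iI(1)] x_le[OF iI(1)] h0])
        (use R HU_low[OF T(1)] in auto)
    also have "\<dots> \<le> ?t p + p * 3 * (x i \<bullet> (?H ^\<^sub>m (p - 1) *\<^sub>v x i))"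
      using mult_right_mono[OF mult_left_mono[OF q, of p] m0[OF iI(1)]] by simp
    finally show ?thesis .
  qed
  then have "(\<Sum>i\<in>I - T. mat_trace (HU h (insert i T) ^\<^sub>m p))
     \<le> (\<Sum>i\<in>I - T. ?t p + p * 3 * (x i \<bullet> (?H ^\<^sub>m (p - 1) *\<^sub>v x i)))"
    by (rule sum_mono)
  also have "\<dots> = card (I - T) * ?t p + p * 3 * (\<Sum>i\<in>I - T. x i \<bullet> (?H ^\<^sub>m (p - 1) *\<^sub>v x i))"
    by (simp add: sum.distrib sum_distrib_left)
  also have "\<dots> \<le> card (I - T) * ?t p + p * 3 * (?t p / h)"
    using sum_m by (intro add_left_mono mult_left_mono) auto
  also have "real (card (I - T)) = N - k"
    using T k finT by (simp add: card_Diff_subset of_nat_diff)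
  also have "p * 3 * (?t p / h) = 3 / R * ?t p" using h p R by (simp add: field_simps)
  \<comment> \<open>At most half of the elements are used up, so N - k \<ge> N/2.\<close>
  also have "3 / R * ?t p \<le> (N - k) * (6 / (R * N)) * ?t p"
  proof (intro mult_right_mono t0)
    have "3 * N \<le> (N - k) * 6" using k by simp
    then show "3 / R \<le> (N - k) * (6 / (R * N))" using R k by (simp add: field_simps)
  qed
  finally show ?thesis by (simp add: algebra_simps)
qed

text \<open>The threshold is 16 times the mean m/N. The average potential grows by at most exp(6
  \<rho>), whereas a bad set has potential at least exp(8 \<rho>) times h^p; the quotient is exp(-2
  \<rho>), with the initial trace D h^p supplying the factor \<open>D\<close>.\<close>

lemma upper_tail:
  assumes m: "2 * m \<le> card I" and I0: "0 < card I"
  defines "\<rho> \<equiv> m / (N * R)"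
  shows "card {T. T \<subseteq> I \<and> card T = m \<and> (\<exists>v\<in>carrier_vec D. 16 * real m / N * (v \<bullet> v) < v \<bullet> (S T *\<^sub>v v))}
     \<le> D * exp (- 2 * \<rho>) * (card I choose m)"
proof -
  \<comment> \<open>p \<ge> 16 \<rho> puts 16 \<rho>/p into [0, 1], where 1 + y \<ge> exp(y/2). The
    power \<open>p\<close> has no upper limit, because h^p cancels at the end.\<close>
  obtain p0 :: nat where p0: "16 * \<rho> \<le> p0" using real_arch_simple by blast
  define p where "p = Suc p0"
  have p: "0 < p" "16 * \<rho> \<le> p" using p0 by (auto simp: p_def)
  define h where "h = p * R"
  have h0: "0 < h" using p R by (simp add: h_def)
  have N0: "0 < N" using I0 by simp
  have \<rho>0: "0 \<le> \<rho>" using R by (simp add: \<rho>_def)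
  let ?f = "\<lambda>T. mat_trace (HU h T ^\<^sub>m p)"
  let ?a = "1 + 6 / (R * N)"
  let ?B = "{T. T \<subseteq> I \<and> card T = m \<and> (\<exists>v\<in>carrier_vec D. 16 * real m / N * (v \<bullet> v) < v \<bullet> (S T *\<^sub>v v))}"
  have "subset_avg I k ?f \<le> ?a ^ k * (D * h ^ p)" if "k \<le> m" for k
    using that
  proof (induction k)
    case 0
    have "HU h {} = h \<cdot>\<^sub>m 1\<^sub>m D" by (simp add: HU_def S_empty right_add_zero_mat[of _ D D])
    then show ?case using trace_pow_scalar[of h p] by (simp add: subset_avg_0[OF finI])
  next
    case (Suc k)
    have "subset_avg I (Suc k) ?f \<le> ?a * subset_avg I k ?f + 0"
      by (rule subset_avg_Suc_le[OF finI]) (use Suc.prems m HU_step[of _ k p h] p h_def in auto)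
    also have "\<dots> \<le> ?a * (?a ^ k * (D * h ^ p))"
      using Suc R N0 by (simp add: mult_left_mono)
    finally show ?case by simp
  qed
  from this[of m] have "subset_avg I m ?f \<le> ?a ^ m * (D * h ^ p)" by simp
  also have "?a ^ m \<le> exp (6 / (R * N)) ^ m"
    using exp_ge_add_one_self[of "6 / (R*N)"] R N0 by (intro power_mono) auto
  also have "exp (6 / (R * N)) ^ m = exp (6 * \<rho>)"
    by (simp add: exp_of_nat_mult[symmetric] \<rho>_def mult.commute)
  finally have avg: "subset_avg I m ?f \<le> exp (6 * \<rho>) * (D * h ^ p)" using h0 by (simp add: mult_right_mono)
  \<comment> \<open>Measured in units of \<open>h\<close> the threshold is 16 \<rho>/p, so its p-th
    power is exponential in \<rho> alone.\<close>
  have y: "16 * real m / N = h * (16 * \<rho> / p)" using R p N0 by (simp add: h_def \<rho>_def)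
  have "h ^ p * exp (8 * \<rho>) = h ^ p * exp ((16 * \<rho> / p) / 2) ^ p"
    using p by (simp add: exp_of_nat_mult[symmetric])
  also have "\<dots> \<le> h ^ p * (1 + 16 * \<rho> / p) ^ p"
    using h0 p \<rho>0 by (intro mult_left_mono power_mono one_plus_ge_exp_half) auto
  also have "\<dots> = (h + 16 * real m / N) ^ p" unfolding y by (simp add: power_mult_distrib[symmetric] algebra_simps)
  finally have "card ?B * (h ^ p * exp (8 * \<rho>)) \<le> card ?B * (h + 16 * real m / N) ^ p"
    by (simp add: mult_left_mono)
  also have "\<dots> \<le> (card I choose m) * subset_avg I m ?f"
    by (rule card_subsets_le_avg[OF finI])
      (use m h0 in \<open>auto intro: HU_trace_nonneg HU_trace_ge\<close>)
  also have "\<dots> \<le> (card I choose m) * (exp (6 * \<rho>) * (D * h ^ p))"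
    using avg by (intro mult_left_mono) auto
  finally have "h ^ p * (card ?B * exp (8 * \<rho>)) \<le> h ^ p * ((card I choose m) * (exp (6 * \<rho>) * D))"
    by (simp only: ac_simps)
  then have "card ?B * exp (8 * \<rho>) \<le> (card I choose m) * (exp (6 * \<rho>) * D)"
    using h0 by (subst (asm) mult_le_cancel_left_pos) auto
  then have "card ?B * exp (8 * \<rho>) * exp (- 8 * \<rho>) \<le> (card I choose m) * (exp (6 * \<rho>) * D) * exp (- 8 * \<rho>)"
    by (intro mult_right_mono) auto
  also have "card ?B * exp (8 * \<rho>) * exp (- 8 * \<rho>) = card ?B"
    by (simp add: mult.assoc mult_exp_exp)
  also have "(card I choose m) * (exp (6 * \<rho>) * D) * exp (- 8 * \<rho>)
      = D * (exp (6 * \<rho>) * exp (- 8 * \<rho>)) * (card I choose m)" by (simp only: ac_simps)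
  also have "exp (6 * \<rho>) * exp (- 8 * \<rho>) = exp (- 2 * \<rho>)"
    by (simp add: mult_exp_exp)
  finally show ?thesis .
qed

text \<open>The unsampled frame operator is H - h, so the total first-order decrease involves the
  sum of l^(p-1) (l - h) over the eigenvalues. Those above h + 1/2 lose a fixed share; the others
  contribute at most the floor \<open>E\<close>, the fixed point of the recursion. In \<beta>, the
  1/4 is 1/2 from the rank-one estimate times 1/2 from l - h.\<close>

lemma HL_step:
  assumes T: "T \<subseteq> I" "card T = k" and k: "k < card I"
    and p: "0 < p" and h: "h = p * R"
  defines "\<beta> \<equiv> p / (4 * N * (h + 1))" and "E \<equiv> (h + 1) * (D * (h + 1/2) ^ (p - 1))"
  shows "(\<Sum>i\<in>I - T. mat_trace (HL h (insert i T) ^\<^sub>m p))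
     \<le> (N - k) * ((1 - \<beta>) * mat_trace (HL h T ^\<^sub>m p) + \<beta> * E)"
proof -
  let ?H = "HL h T" and ?t = "\<lambda>p. mat_trace (HL h T ^\<^sub>m p)"
  define M where "M = (\<Sum>i\<in>I - T. x i \<bullet> (?H ^\<^sub>m (p - 1) *\<^sub>v x i))"
  have finT: "finite T" using T finI finite_subset by auto
  have h0: "0 < h" using h p R by simp
  have N0: "0 < N" using k by simp
  have Hp: "?H ^\<^sub>m (p - 1) \<in> carrier_mat D D" using pow_carrier_mat by simp
  obtain Q l where sp: "spectral D ?H Q l" using spectral_exists[OF H_carrier(2) H_sym(2)] .
  have low: "h \<le> l i" if "i < D" for i using spectral.eigenvalue_ge[OF sp HL_low[OF T(1)] that] .
  have up: "l i \<le> h + 1" if "i < D" for i using spectral.eigenvalue_le[OF sp HL_up[OF T(1)] that] .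
  have "M = ?t (p - 1) - mat_trace (?H ^\<^sub>m (p - 1) * S T)"
    unfolding M_def
    using trace_mult_S[OF order_refl Hp] trace_mult_S[OF T(1) Hp] right_mult_one_mat[OF Hp] T finI
    by (simp add: S_all sum_diff)
  moreover have "(h + 1) * ?t (p - 1) = ?t p + mat_trace (?H ^\<^sub>m (p - 1) * S T)"
  proof -
    have "?H + S T = (h + 1) \<cdot>\<^sub>m 1\<^sub>m D" by (rule eq_matI) (auto simp: HL_def S_def)
    then have "?H ^\<^sub>m (p - 1) * ?H + ?H ^\<^sub>m (p - 1) * S T = (h + 1) \<cdot>\<^sub>m (?H ^\<^sub>m (p - 1))"
      using mult_add_distrib_mat[OF Hp H_carrier(2) S_carrier, of h T T]
        mult_smult_distrib[OF Hp, of "1\<^sub>m D" D "h + 1"] right_mult_one_mat[OF Hp] by simp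
    moreover have "?H ^\<^sub>m (p - 1) * ?H = ?H ^\<^sub>m p" using p by (cases p) auto
    ultimately show ?thesis
      using mat_trace_add[OF pow_carrier_mat[OF H_carrier(2)] mult_carrier_mat[OF Hp S_carrier], of h T p]
        mat_trace_smult[OF Hp, of "h + 1"] by metis
  qed
  ultimately have "M = ?t p - h * ?t (p - 1)" by (simp add: algebra_simps)
  also have "\<dots> = (\<Sum>i<D. l i ^ (p - 1) * (l i - h))"
    unfolding spectral.trace_pow[OF sp] sum_distrib_left sum_subtractf[symmetric]
    using p by (intro sum.cong refl) (cases p, auto simp: algebra_simps)
  finally have M: "M = (\<Sum>i<D. l i ^ (p - 1) * (l i - h))" .
  have M0: "0 \<le> M"
    unfolding M using low h0 by (intro sum_nonneg mult_nonneg_nonneg zero_le_power) force+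
  have "1/2 * (?t p / (h + 1)) - 1/2 * (D * (h + 1/2) ^ (p - 1))
      = (\<Sum>i<D. 1/2 * (l i ^ p / (h + 1)) - 1/2 * (h + 1/2) ^ (p - 1))"
    unfolding spectral.trace_pow[OF sp] by (simp add: sum_subtractf sum_distrib_left[symmetric] sum_divide_distrib[symmetric])
  also have "\<dots> \<le> M"
    unfolding M
  proof (rule sum_mono)
    fix i assume "i \<in> {..<D}"
    then have i: "h \<le> l i" "l i \<le> h + 1" using low up by auto
    have pw: "l i ^ p = l i ^ (p - 1) * l i" using p by (cases p) auto
    have l0: "0 \<le> l i ^ (p - 1)" using i h0 by simp
    have "l i ^ (p - 1) * l i \<le> l i ^ (p - 1) * (h + 1)" using i l0 by (intro mult_left_mono) auto
    then have le: "l i ^ p / (h + 1) \<le> l i ^ (p - 1)" using h0 by (simp add: pw field_simps)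
    \<comment> \<open>Split at the middle of the interval [h, h + 1]: above it l - h \<ge> 1/2,
      below it the subtracted power already makes the left side nonpositive.\<close>
    show "1/2 * (l i ^ p / (h + 1)) - 1/2 * (h + 1/2) ^ (p - 1) \<le> l i ^ (p - 1) * (l i - h)"
    proof (cases "h + 1/2 \<le> l i")
      case True
      then have "l i ^ (p - 1) * (1/2) \<le> l i ^ (p - 1) * (l i - h)" using l0 by (intro mult_left_mono) auto
      moreover have "0 \<le> (h + 1/2) ^ (p - 1)" using h0 by simp
      ultimately show ?thesis using le by linarith
    next
      case False
      then have "l i ^ (p - 1) \<le> (h + 1/2) ^ (p - 1)" using i h0 by (intro power_mono) auto
      moreover have "0 \<le> l i ^ (p - 1) * (l i - h)" using l0 i by simp
      ultimately show ?thesis using le by linarith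
    qed
  qed
  finally have Mge: "1/2 * (?t p / (h + 1)) - 1/2 * (D * (h + 1/2) ^ (p - 1)) \<le> M" .
  have "\<beta> * (?t p - E) = p / (2 * N) * (1/2 * (?t p / (h + 1)) - 1/2 * (D * (h + 1/2) ^ (p - 1)))"
  proof -
    have "p / (4 * N * X) * (t - X * W) = p / (2 * N) * (1/2 * (t / X) - 1/2 * W)" if "0 < X" for X t W :: real
      using that N0 by (simp add: field_simps)
    from this[of "h + 1"] show ?thesis unfolding \<beta>_def E_def using h0 by simp
  qed
  also have "\<dots> \<le> p / (2 * N) * M" using Mge N0 by (intro mult_left_mono) auto
  finally have "(N - k) * (\<beta> * (?t p - E)) \<le> (N - k) * (p / (2 * N) * M)"
    using k by (intro mult_left_mono) auto
  also have "\<dots> \<le> N * (p / (2 * N) * M)" using M0 N0 by (intro mult_right_mono) auto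
  also have "\<dots> = p / 2 * M" using N0 by simp
  finally have key: "(N - k) * (\<beta> * (?t p - E)) \<le> p / 2 * M" .
  have "mat_trace (HL h (insert i T) ^\<^sub>m p) \<le> ?t p - p / 2 * (x i \<bullet> (?H ^\<^sub>m (p - 1) *\<^sub>v x i))"
    if i: "i \<in> I - T" for i
  proof -
    have iI: "i \<in> I" "i \<notin> T" and iT: "insert i T \<subseteq> I" using i T by auto
    show ?thesis
      unfolding HL_insert[OF finT iI(2,1)]
      by (rule trace_pow_minus_outer[OF H_carrier(2) H_sym(2) x_carrier[OF iI(1)] x_le[OF iI(1)] h0])
        (use R h HL_low[OF T(1)] HL_low[OF iT] in \<open>auto simp: HL_insert[OF finT iI(2,1)]\<close>)
  qed
  then have "(\<Sum>i\<in>I - T. mat_trace (HL h (insert i T) ^\<^sub>m p))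
     \<le> (\<Sum>i\<in>I - T. ?t p - p / 2 * (x i \<bullet> (?H ^\<^sub>m (p - 1) *\<^sub>v x i)))"
    by (rule sum_mono)
  also have "\<dots> = card (I - T) * ?t p - p / 2 * M"
    by (simp add: sum_subtractf sum_distrib_left M_def)
  also have "real (card (I - T)) = N - k"
    using T k finT by (simp add: card_Diff_subset of_nat_diff)
  also have "(N - k) * ?t p - p / 2 * M \<le> (N - k) * ?t p - (N - k) * (\<beta> * (?t p - E))" using key by simp
  finally show ?thesis by (simp add: algebra_simps)
qed

text \<open>Decay of the initial potential and the floor \<open>E\<close> are each at most
  exp(-\<rho>/5) times \<open>a0\<close>, hence the factor 2. A threshold of one percent of the mean
  costs exp(\<rho>/50), leaving 1/5 - 1/50 = 9/50.\<close>

lemma lower_tail: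
  assumes m: "m \<le> card I" and I0: "0 < card I" and NR: "1 \<le> N * R"
  defines "\<rho> \<equiv> m / (N * R)"
  shows "card {T. T \<subseteq> I \<and> card T = m \<and> (\<exists>v\<in>carrier_vec D. v \<bullet> (S T *\<^sub>v v) < m / (100 * N) * (v \<bullet> v))}
     \<le> 2 * real D * exp (- 9 / 50 * \<rho>) * (card I choose m)"
proof -
  \<comment> \<open>p \<ge> 4/R gives h \<ge> 4, so h + 1 \<le> (5/4) p R; p \<ge> 16 \<rho> keeps
    the relative threshold below 1/2; adding 2 gives p - 1 \<ge> p/2.\<close>
  obtain p0 :: nat where p0: "max (16 * \<rho>) (4 / R) \<le> p0" using real_arch_simple by blast
  define p where "p = p0 + 2"
  have p: "2 \<le> p" "16 * \<rho> \<le> p" "4 / R \<le> p" using p0 by (auto simp: p_def)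
  define h where "h = p * R"
  have h4: "4 \<le> h" using mult_right_mono[OF p(3), of R] R by (simp add: h_def)
  then have h0: "0 < h" and h54: "h + 1 \<le> 5/4 * (p * R)" unfolding h_def[symmetric] by linarith+
  have N0: "0 < N" using I0 by simp
  have \<rho>0: "0 \<le> \<rho>" using R by (simp add: \<rho>_def)
  define \<beta> where "\<beta> = p / (4 * N * (h + 1))"
  define E where "E = (h + 1) * (D * (h + 1/2) ^ (p - 1))"
  define a0 where "a0 = D * (h + 1) ^ p"
  have \<beta>0: "0 \<le> \<beta>" using N0 h0 by (simp add: \<beta>_def)
  have \<beta>1: "\<beta> \<le> 1"
  proof -
    have "real p * 1 \<le> p * (N * R)" using NR by (intro mult_left_mono) auto
    also have "\<dots> = N * h" by (simp add: h_def)
    also have "\<dots> \<le> 4 * N * (h + 1)" using N0 h0 by (simp add: algebra_simps)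
    finally show ?thesis using N0 h0 by (simp add: \<beta>_def)
  qed
  have E0: "0 \<le> E" using h0 by (simp add: E_def)
  have a00: "0 \<le> a0" using h0 by (simp add: a0_def)
  let ?f = "\<lambda>T. mat_trace (HL h T ^\<^sub>m p)"
  let ?B = "{T. T \<subseteq> I \<and> card T = m \<and> (\<exists>v\<in>carrier_vec D. v \<bullet> (S T *\<^sub>v v) < m / (100 * N) * (v \<bullet> v))}"
  have "subset_avg I k ?f \<le> (1 - \<beta>) ^ k * a0 + E" if "k \<le> m" for k
    using that
  proof (induction k)
    case 0
    have "HL h {} = (h + 1) \<cdot>\<^sub>m 1\<^sub>m D" by (rule eq_matI) (auto simp: HL_def S_empty)
    then show ?case using trace_pow_scalar[of "h + 1" p] E0 by (simp add: subset_avg_0[OF finI] a0_def)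
  next
    case (Suc k)
    have "subset_avg I (Suc k) ?f \<le> (1 - \<beta>) * subset_avg I k ?f + \<beta> * E"
      by (rule subset_avg_Suc_le[OF finI])
        (use Suc.prems m HL_step[of _ k p h, folded \<beta>_def E_def] p h_def in auto)
    also have "\<dots> \<le> (1 - \<beta>) * ((1 - \<beta>) ^ k * a0 + E) + \<beta> * E"
      using Suc \<beta>1 by (simp add: mult_left_mono)
    finally show ?case by (simp add: algebra_simps)
  qed
  from this[of m] have avg1: "subset_avg I m ?f \<le> (1 - \<beta>) ^ m * a0 + E" by simp
  have "(1 - \<beta>) ^ m \<le> exp (- (\<rho> / 5))"
  proof -
    have "(1 - \<beta>) ^ m \<le> exp (- \<beta>) ^ m" using exp_ge_add_one_self[of "- \<beta>"] \<beta>1 by (intro power_mono) auto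
    also have "\<dots> = exp (- (m * \<beta>))" by (simp add: exp_of_nat_mult[symmetric])
    also have "\<dots> \<le> exp (- (m * (p / (4 * N * (5/4 * (p * R))))))"
    proof -
      \<comment> \<open>This lower bound for \<beta> is 1/(5 N R), free of \<open>p\<close>; over
        \<open>m\<close> draws it gives \<rho>/5.\<close>
      have "p / (4 * N * (5/4 * (p * R))) \<le> \<beta>"
        unfolding \<beta>_def using h54 h0 N0 p R by (intro divide_left_mono mult_left_mono mult_pos_pos) auto
      then show ?thesis by (simp add: mult_left_mono)
    qed
    also have "m * (p / (4 * N * (5/4 * (p * R)))) = \<rho> / 5" using p N0 R by (simp add: \<rho>_def)
    finally show ?thesis .
  qed
  then have A: "(1 - \<beta>) ^ m * a0 \<le> exp (- (\<rho> / 5)) * a0" using a00 by (rule mult_right_mono)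
  \<comment> \<open>The floor is compared with the starting value \<open>a0\<close> through the
    ratio (h + 1/2)/(h + 1) to the power p - 1. The exponent gained is about 1/(5 R), and this
    dominates \<rho>/5 since m \<le> N.\<close>
  have B: "E \<le> exp (- (\<rho> / 5)) * a0"
  proof -
    let ?y = "1 / (2 * (h + 1))"
    have y: "?y \<le> 1" "0 \<le> ?y" using h0 by (auto simp: field_simps)
    have "(1 - ?y) ^ (p - 1) \<le> exp (- ?y) ^ (p - 1)"
      using exp_ge_add_one_self[of "- ?y"] y by (intro power_mono) auto
    also have "\<dots> = exp (- (real (p - 1) * ?y))" by (simp add: exp_of_nat_mult[symmetric])
    also have "\<dots> \<le> exp (- (\<rho> / 5))"
    proof -
      have "\<rho> \<le> 1 / R" using m N0 R by (simp add: \<rho>_def field_simps)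
      then have "\<rho> / 5 \<le> 1 / (5 * R)" by simp
      also have "1 / (5 * R) = (p / 2) * (1 / (2 * (5/4 * (p * R))))" using p R by simp
      also have "\<dots> \<le> real (p - 1) * (1 / (2 * (5/4 * (p * R))))"
        using p R by (intro mult_right_mono) (auto simp: of_nat_diff)
      also have "\<dots> \<le> real (p - 1) * ?y"
        using h54 h0 p R by (intro mult_left_mono divide_left_mono mult_pos_pos) auto
      finally show ?thesis by simp
    qed
    finally have *: "(1 - ?y) ^ (p - 1) \<le> exp (- (\<rho> / 5))" .
    have "h + 1/2 = (h + 1) * (1 - ?y)" using h0 by (simp add: field_simps)
    then have "E = (h + 1) * (D * ((h + 1) ^ (p - 1) * (1 - ?y) ^ (p - 1)))"
      by (simp only: E_def power_mult_distrib)
    also have "\<dots> = (1 - ?y) ^ (p - 1) * (D * ((h + 1) * (h + 1) ^ (p - 1)))" by (simp only: ac_simps)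
    also have "(h + 1) * (h + 1) ^ (p - 1) = (h + 1) ^ p" using p by (cases p) auto
    also have "(1 - ?y) ^ (p - 1) * (D * (h + 1) ^ p) \<le> exp (- (\<rho> / 5)) * a0"
      unfolding a0_def using * h0 by (intro mult_right_mono) auto
    finally show ?thesis .
  qed
  let ?z = "m / (100 * N)"
  have avg: "subset_avg I m ?f \<le> 2 * (exp (- (\<rho> / 5)) * a0)" using avg1 A B by linarith
  have z1: "?z \<le> h + 1"
  proof -
    have "?z \<le> 1" using m N0 by (simp add: field_simps)
    then show ?thesis using h0 by simp
  qed
  \<comment> \<open>The threshold divided by \<open>h\<close> is \<rho>/(100 p), so p factors 1 - y
    \<ge> exp(-2y) together cost exp(-\<rho>/50).\<close>
  have "(h + 1) ^ p * exp (- (\<rho> / 50)) \<le> (h + 1 - ?z) ^ p"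
  proof -
    let ?y = "?z / (h + 1)"
    have y0: "0 \<le> ?y" using h0 N0 by simp
    have y: "?y \<le> \<rho> / (100 * p)"
    proof -
      have "?y \<le> ?z / h" using h0 N0 by (intro divide_left_mono) auto
      then show ?thesis by (simp add: \<rho>_def h_def ac_simps)
    qed
    then have yy: "- (2 * (\<rho> / (100 * p))) \<le> - (2 * ?y)" by linarith
    note y
    also have "\<rho> / (100 * p) \<le> 1/2" using p \<rho>0 by (simp add: field_simps)
    finally have y1: "?y \<le> 1/2" .
    have "exp (- (\<rho> / 50)) = exp (- (2 * (\<rho> / (100 * p)))) ^ p"
      using p by (simp add: exp_of_nat_mult[symmetric])
    also have "\<dots> \<le> exp (- (2 * ?y)) ^ p"
      using yy by (intro power_mono) (simp_all only: exp_le_cancel_iff exp_ge_zero)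
    also have "\<dots> \<le> (1 - ?y) ^ p" using y0 y1 by (intro power_mono one_minus_ge_exp) auto
    finally have "(h + 1) ^ p * exp (- (\<rho> / 50)) \<le> (h + 1) ^ p * (1 - ?y) ^ p"
      using h0 by (intro mult_left_mono) auto
    also have "\<dots> = (h + 1 - ?z) ^ p"
      unfolding power_mult_distrib[symmetric] using h0 by (simp add: right_diff_distrib)
    finally show ?thesis .
  qed
  then have "card ?B * ((h + 1) ^ p * exp (- (\<rho> / 50))) \<le> card ?B * (h + 1 - ?z) ^ p"
    by (simp add: mult_left_mono)
  also have "\<dots> \<le> (card I choose m) * subset_avg I m ?f"
    by (rule card_subsets_le_avg[OF finI])
      (use m h0 z1 in \<open>auto intro: HL_trace_nonneg HL_trace_ge\<close>)
  also have "\<dots> \<le> (card I choose m) * (2 * (exp (- (\<rho> / 5)) * a0))"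
    using avg by (intro mult_left_mono) auto
  finally have "(h + 1) ^ p * (card ?B * exp (- (\<rho> / 50)))
      \<le> (h + 1) ^ p * ((card I choose m) * (2 * (exp (- (\<rho> / 5)) * D)))"
    by (simp add: a0_def ac_simps)
  then have "card ?B * exp (- (\<rho> / 50)) \<le> (card I choose m) * (2 * (exp (- (\<rho> / 5)) * D))"
    using h0 by (subst (asm) mult_le_cancel_left_pos) auto
  then have "card ?B * exp (- (\<rho> / 50)) * exp (\<rho> / 50)
      \<le> (card I choose m) * (2 * (exp (- (\<rho> / 5)) * D)) * exp (\<rho> / 50)"
    by (intro mult_right_mono) auto
  also have "card ?B * exp (- (\<rho> / 50)) * exp (\<rho> / 50) = card ?B"
    by (simp add: mult.assoc mult_exp_exp)
  also have "(card I choose m) * (2 * (exp (- (\<rho> / 5)) * D)) * exp (\<rho> / 50)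
      = 2 * real D * (exp (- (\<rho> / 5)) * exp (\<rho> / 50)) * (card I choose m)" by (simp only: ac_simps)
  also have "exp (- (\<rho> / 5)) * exp (\<rho> / 50) = exp (- 9 / 50 * \<rho>)"
    by (simp add: mult_exp_exp)
  finally show ?thesis .
qed

end

section \<open>Frobenius inner product\<close>

definition frob_inner :: "real mat \<Rightarrow> real mat \<Rightarrow> real" where
  "frob_inner X Y = (\<Sum>i<dim_row X. \<Sum>j<dim_col X. X $$ (i,j) * Y $$ (i,j))"

lemma frob_norm_nonneg [simp]: "0 \<le> frob_norm X"
  by (simp add: frob_norm_def sum_nonneg)

lemma frob_inner_self: "frob_inner X X = (frob_norm X)\<^sup>2"
  by (simp add: frob_inner_def frob_norm_def sum_nonneg power2_eq_square)

lemma frob_inner_trace: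
  assumes "X \<in> carrier_mat n m" "Y \<in> carrier_mat n m"
  shows "frob_inner X Y = mat_trace (X\<^sup>T * Y)"
  using assms
  by (auto simp: frob_inner_def mat_trace_def scalar_prod_def atLeast0LessThan
      intro!: trans[OF sum.swap] sum.cong)

lemma frob_inner_commute:
  assumes "X \<in> carrier_mat n m" "Y \<in> carrier_mat n m"
  shows "frob_inner X Y = frob_inner Y X"
  using assms by (simp add: frob_inner_def mult.commute)

lemma frob_inner_diff_right:
  assumes "X \<in> carrier_mat n m" "Y \<in> carrier_mat n m" "Z \<in> carrier_mat n m"
  shows "frob_inner X (Y - Z) = frob_inner X Y - frob_inner X Z"
  using assms by (simp add: frob_inner_def algebra_simps sum_subtractf)

lemma frob_inner_transpose:
  assumes "X \<in> carrier_mat n m" "Y \<in> carrier_mat n m"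
  shows "frob_inner X\<^sup>T Y\<^sup>T = frob_inner X Y"
  using assms by (auto simp: frob_inner_def intro!: trans[OF sum.swap] sum.cong)

lemma frob_norm_transpose [simp]: "frob_norm X\<^sup>T = frob_norm X"
  by (auto simp: frob_norm_def intro!: trans[OF sum.swap] sum.cong)

lemma frob_norm_eq_0:
  assumes "X \<in> carrier_mat n m" "frob_norm X = 0"
  shows "X = 0\<^sub>m n m"
proof -
  have "(\<Sum>i<dim_row X. \<Sum>j<dim_col X. (X $$ (i,j))\<^sup>2) = 0" using assms(2) by (simp add: frob_norm_def)
  then have "X $$ (i,j) = 0" if "i < n" "j < m" for i j
    using that assms(1) by (auto simp: sum_nonneg_eq_0_iff sum_nonneg)
  then show ?thesis using assms(1) by (intro eq_matI) auto
qed

lemma frob_norm_add_sq: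
  assumes "X \<in> carrier_mat n m" "Y \<in> carrier_mat n m"
  shows "(frob_norm (X + Y))\<^sup>2 = (frob_norm X)\<^sup>2 + 2 * frob_inner X Y + (frob_norm Y)\<^sup>2"
  unfolding frob_inner_self[symmetric] using assms
  by (simp add: frob_inner_def algebra_simps sum.distrib sum_distrib_left)

lemma frob_norm_smult: "frob_norm (c \<cdot>\<^sub>m X) = \<bar>c\<bar> * frob_norm X"
proof -
  have "(\<Sum>i<dim_row X. \<Sum>j<dim_col X. (c * X $$ (i,j))\<^sup>2) = c\<^sup>2 * (\<Sum>i<dim_row X. \<Sum>j<dim_col X. (X $$ (i,j))\<^sup>2)"
    by (simp add: sum_distrib_left power_mult_distrib)
  then show ?thesis by (simp add: frob_norm_def real_sqrt_mult)
qed

lemma frob_inner_le: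
  assumes "X \<in> carrier_mat n m" "Y \<in> carrier_mat n m"
  shows "\<bar>frob_inner X Y\<bar> \<le> frob_norm X * frob_norm Y"
proof -
  let ?S = "{..<n} \<times> {..<m}"
  have "(frob_inner X Y)\<^sup>2 = (\<Sum>p\<in>?S. X $$ p * Y $$ p)\<^sup>2"
    using assms by (simp add: frob_inner_def sum.cartesian_product)
  also have "\<dots> \<le> (\<Sum>p\<in>?S. (X $$ p)\<^sup>2) * (\<Sum>p\<in>?S. (Y $$ p)\<^sup>2)"
    by (rule Cauchy_Schwarz_ineq_sum)
  also have "\<dots> = (frob_norm X)\<^sup>2 * (frob_norm Y)\<^sup>2"
    using assms by (simp add: frob_norm_def sum.cartesian_product sum_nonneg)
  finally show ?thesis by (metis abs_le_square_iff abs_of_nonneg frob_norm_nonneg mult_nonneg_nonneg power_mult_distrib)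
qed

lemma frob_norm_triangle:
  assumes "X \<in> carrier_mat n m" "Y \<in> carrier_mat n m"
  shows "frob_norm (X + Y) \<le> frob_norm X + frob_norm Y"
proof (rule power2_le_imp_le)
  show "(frob_norm (X + Y))\<^sup>2 \<le> (frob_norm X + frob_norm Y)\<^sup>2"
    using frob_inner_le[OF assms] unfolding frob_norm_add_sq[OF assms] by (simp add: power2_sum)
qed simp

lemma frob_norm_triangle_diff:
  assumes "X \<in> carrier_mat n m" "Y \<in> carrier_mat n m"
  shows "frob_norm (X - Y) \<le> frob_norm X + frob_norm Y"
proof -
  have "X - Y = X + (-1) \<cdot>\<^sub>m Y" using assms by (intro eq_matI) auto
  then show ?thesis using frob_norm_triangle[of X n m "(-1) \<cdot>\<^sub>m Y"] assms by (simp add: frob_norm_smult)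
qed

lemma frob_inner_mult_left:
  assumes A: "A \<in> carrier_mat n k" and X: "X \<in> carrier_mat k m" and Y: "Y \<in> carrier_mat n m"
  shows "frob_inner (A * X) Y = frob_inner X (A\<^sup>T * Y)"
proof -
  have XT: "X\<^sup>T \<in> carrier_mat m k" and AT: "A\<^sup>T \<in> carrier_mat k n" using A X by auto
  show ?thesis
    using frob_inner_trace[OF mult_carrier_mat[OF A X] Y] frob_inner_trace[OF X mult_carrier_mat[OF AT Y]]
      transpose_mult[OF A X] assoc_mult_mat[OF XT AT Y] by simp
qed

lemma frob_inner_mult_right:
  assumes X: "X \<in> carrier_mat n k" and B: "B \<in> carrier_mat k m" and Y: "Y \<in> carrier_mat n m"
  shows "frob_inner (X * B) Y = frob_inner X (Y * B\<^sup>T)"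
proof -
  have t: "X\<^sup>T \<in> carrier_mat k n" "B\<^sup>T \<in> carrier_mat m k" "Y\<^sup>T \<in> carrier_mat m n" using X B Y by auto
  have "frob_inner (X * B) Y = frob_inner (B\<^sup>T * X\<^sup>T) Y\<^sup>T"
    using frob_inner_transpose[OF mult_carrier_mat[OF X B] Y] transpose_mult[OF X B] by simp
  also have "\<dots> = frob_inner X\<^sup>T (B * Y\<^sup>T)" using frob_inner_mult_left[OF t(2,1,3)] by simp
  also have "B * Y\<^sup>T = (Y * B\<^sup>T)\<^sup>T" using transpose_mult[OF Y t(2)] by simp
  finally show ?thesis using frob_inner_transpose[OF X mult_carrier_mat[OF Y t(2)]] by simp
qed

lemma frob_norm_mult:
  assumes X: "X \<in> carrier_mat n k" and Y: "Y \<in> carrier_mat k m"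
  shows "frob_norm (X * Y) \<le> frob_norm X * frob_norm Y"
proof (rule power2_le_imp_le)
  have "(frob_norm (X * Y))\<^sup>2 = (\<Sum>i<n. \<Sum>j<m. (\<Sum>l<k. X $$ (i,l) * Y $$ (l,j))\<^sup>2)"
    using X Y by (auto simp: frob_norm_def sum_nonneg scalar_prod_def atLeast0LessThan intro!: sum.cong)
  also have "\<dots> \<le> (\<Sum>i<n. \<Sum>j<m. (\<Sum>l<k. (X $$ (i,l))\<^sup>2) * (\<Sum>l<k. (Y $$ (l,j))\<^sup>2))"
    by (intro sum_mono Cauchy_Schwarz_ineq_sum)
  also have "\<dots> = (\<Sum>i<n. \<Sum>l<k. (X $$ (i,l))\<^sup>2) * (\<Sum>j<m. \<Sum>l<k. (Y $$ (l,j))\<^sup>2)"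
    by (rule sum_product[symmetric])
  also have "(\<Sum>j<m. \<Sum>l<k. (Y $$ (l,j))\<^sup>2) = (\<Sum>l<k. \<Sum>j<m. (Y $$ (l,j))\<^sup>2)" by (rule sum.swap)
  also have "(\<Sum>i<n. \<Sum>l<k. (X $$ (i,l))\<^sup>2) * (\<Sum>l<k. \<Sum>j<m. (Y $$ (l,j))\<^sup>2) = (frob_norm X * frob_norm Y)\<^sup>2"
    using X Y by (simp add: frob_norm_def sum_nonneg power_mult_distrib)
  finally show "(frob_norm (X * Y))\<^sup>2 \<le> (frob_norm X * frob_norm Y)\<^sup>2" .
qed simp

lemma frob_norm_isometry_mult:
  assumes A: "A \<in> carrier_mat n k" "A\<^sup>T * A = 1\<^sub>m k" and X: "X \<in> carrier_mat k m"
  shows "frob_norm (A * X) = frob_norm X"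
proof -
  have AT: "A\<^sup>T \<in> carrier_mat k n" using A by simp
  have "frob_inner (A * X) (A * X) = frob_inner X X"
    using frob_inner_mult_left[OF A(1) X mult_carrier_mat[OF A(1) X]] assoc_mult_mat[OF AT A(1) X] A(2) X by simp
  then show ?thesis by (simp add: frob_inner_self)
qed

lemma frob_norm_mult_isometry_transpose:
  assumes B: "B \<in> carrier_mat n k" "B\<^sup>T * B = 1\<^sub>m k" and X: "X \<in> carrier_mat m k"
  shows "frob_norm (X * B\<^sup>T) = frob_norm X"
proof -
  have "(X * B\<^sup>T)\<^sup>T = B * X\<^sup>T" using transpose_mult[of X m k "B\<^sup>T" n] B X by simp
  then have "frob_norm (X * B\<^sup>T) = frob_norm (B * X\<^sup>T)" by (metis frob_norm_transpose)
  then show ?thesis using frob_norm_isometry_mult[OF B, of "X\<^sup>T" m] X by simp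
qed

text \<open>By adjointness the square is the inner product of X with A A^T X. Cauchy-Schwarz and
  norm preservation by \<open>A\<close> reproduce the norm of A^T X on the right, which is then
  cancelled.\<close>

lemma frob_norm_isometry_transpose_mult_le:
  assumes A: "A \<in> carrier_mat n k" "A\<^sup>T * A = 1\<^sub>m k" and X: "X \<in> carrier_mat n m"
  shows "frob_norm (A\<^sup>T * X) \<le> frob_norm X"
proof -
  have AT: "A\<^sup>T \<in> carrier_mat k n" using A by simp
  have AX: "A\<^sup>T * X \<in> carrier_mat k m" using AT X by (rule mult_carrier_mat)
  have "(frob_norm (A\<^sup>T * X))\<^sup>2 = frob_inner X (A * (A\<^sup>T * X))"
    using frob_inner_mult_left[OF AT X AX] by (simp add: frob_inner_self)
  also have "\<dots> \<le> frob_norm X * frob_norm (A * (A\<^sup>T * X))"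
    using frob_inner_le[OF X mult_carrier_mat[OF A(1) AX]] by simp
  also have "frob_norm (A * (A\<^sup>T * X)) = frob_norm (A\<^sup>T * X)" by (rule frob_norm_isometry_mult[OF A AX])
  finally have "frob_norm (A\<^sup>T * X) * frob_norm (A\<^sup>T * X) \<le> frob_norm X * frob_norm (A\<^sup>T * X)"
    by (simp add: power2_eq_square)
  then show ?thesis
    using frob_norm_nonneg[of "A\<^sup>T * X"] frob_norm_nonneg[of X] by (cases "frob_norm (A\<^sup>T * X) = 0") (simp_all del: frob_norm_nonneg)
qed

lemma frob_norm_mult_isometry_le:
  assumes B: "B \<in> carrier_mat n k" "B\<^sup>T * B = 1\<^sub>m k" and X: "X \<in> carrier_mat m n"
  shows "frob_norm (X * B) \<le> frob_norm X"
proof -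
  have "(X * B)\<^sup>T = B\<^sup>T * X\<^sup>T" using transpose_mult[OF X B(1)] .
  then show ?thesis
    using frob_norm_isometry_transpose_mult_le[OF B, of "X\<^sup>T" m] X by (metis frob_norm_transpose transpose_carrier_mat)
qed

lemma frob_norm_diag_mult_ge:
  assumes X: "X \<in> carrier_mat k m" and s: "\<And>i. i < k \<Longrightarrow> \<sigma> \<le> s i" and \<sigma>: "0 \<le> \<sigma>"
  shows "\<sigma> * frob_norm X \<le> frob_norm (mat_diag k s * X)"
proof (rule power2_le_imp_le)
  have "(\<sigma> * frob_norm X)\<^sup>2 = (\<Sum>i<k. \<Sum>j<m. \<sigma>\<^sup>2 * (X $$ (i,j))\<^sup>2)"
    using X by (simp add: frob_norm_def sum_nonneg power_mult_distrib sum_distrib_left)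
  also have "\<dots> \<le> (\<Sum>i<k. \<Sum>j<m. (s i)\<^sup>2 * (X $$ (i,j))\<^sup>2)"
    using s \<sigma> by (intro sum_mono mult_right_mono power_mono) auto
  also have "\<dots> = (frob_norm (mat_diag k s * X))\<^sup>2"
    using X by (simp add: mat_diag_mult_left[OF X] frob_norm_def sum_nonneg power_mult_distrib)
  finally show "(\<sigma> * frob_norm X)\<^sup>2 \<le> (frob_norm (mat_diag k s * X))\<^sup>2" .
qed simp

lemma frob_norm_mult_diag_inverse_le:
  assumes X: "X \<in> carrier_mat m k" and s: "\<And>i. i < k \<Longrightarrow> \<sigma> \<le> s i" and \<sigma>: "0 < \<sigma>"
  shows "frob_norm (X * mat_diag k (\<lambda>i. 1 / s i)) \<le> frob_norm X / \<sigma>"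
proof (rule power2_le_imp_le)
  have "(frob_norm (X * mat_diag k (\<lambda>i. 1 / s i)))\<^sup>2 = (\<Sum>i<m. \<Sum>j<k. (X $$ (i,j))\<^sup>2 * (1 / s j)\<^sup>2)"
    using X by (simp add: mat_diag_mult_right[OF X] frob_norm_def sum_nonneg power_divide)
  also have "\<dots> \<le> (\<Sum>i<m. \<Sum>j<k. (X $$ (i,j))\<^sup>2 * (1 / \<sigma>)\<^sup>2)"
  proof (intro sum_mono mult_left_mono power_mono)
    fix j assume "j \<in> {..<k}"
    then have "\<sigma> \<le> s j" using s by simp
    then show "1 / s j \<le> 1 / \<sigma>" "0 \<le> 1 / s j" using \<sigma> by (auto simp: frac_le)
  qed auto
  also have "\<dots> = (frob_norm X / \<sigma>)\<^sup>2"
    using X by (simp add: frob_norm_def sum_nonneg power_divide sum_divide_distrib)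
  finally show "(frob_norm (X * mat_diag k (\<lambda>i. 1 / s i)))\<^sup>2 \<le> (frob_norm X / \<sigma>)\<^sup>2" .
qed (use \<sigma> in simp)

section \<open>One Gauss-Newton step\<close>

lemma det_nonzero_right_inverse:
  assumes "K \<in> carrier_mat r r" and "det (K :: real mat) \<noteq> 0"
  obtains K' where "K' \<in> carrier_mat r r" "K * K' = 1\<^sub>m r"
  using det_non_zero_imp_unit[OF assms, of "()"] by (auto simp: Units_def ring_mat_def)

text \<open>The problem in the coordinates of the two subspaces: the target is d1 by d2 and the
  isometries have disappeared. \<sigma> is kept as a mere lower bound for the diagonal.\<close>

locale low_rank_target =
  fixes d1 d2 r :: nat and M P N :: "real mat" and s :: "nat \<Rightarrow> real" and \<sigma> :: real
  assumes P: "P \<in> carrier_mat d1 r" "P\<^sup>T * P = 1\<^sub>m r"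
    and N: "N \<in> carrier_mat d2 r" "N\<^sup>T * N = 1\<^sub>m r"
    and M_eq: "M = P * mat_diag r s * N\<^sup>T"
    and \<sigma>: "0 < \<sigma>" and s_ge: "\<And>i. i < r \<Longrightarrow> \<sigma> \<le> s i"
begin

definition G :: "real mat" where "G = N * mat_diag r (\<lambda>i. 1 / s i) * P\<^sup>T"

lemma carriers: "M \<in> carrier_mat d1 d2" "G \<in> carrier_mat d2 d1" "P\<^sup>T \<in> carrier_mat r d1" "N\<^sup>T \<in> carrier_mat r d2"
  "mat_diag r f \<in> carrier_mat r r"
proof -
  show T: "P\<^sup>T \<in> carrier_mat r d1" "N\<^sup>T \<in> carrier_mat r d2" using P N by auto
  show "M \<in> carrier_mat d1 d2" "G \<in> carrier_mat d2 d1"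
    unfolding M_eq G_def using T P N mult_carrier_mat[OF P(1) mat_diag_dim] mult_carrier_mat[OF N(1) mat_diag_dim]
    by (metis mult_carrier_mat)+
qed simp

lemma M_mult_N:
  assumes Z: "Z \<in> carrier_mat r k"
  shows "M * (N * Z) = P * (mat_diag r s * Z)"
proof -
  have NZ: "N * Z \<in> carrier_mat d2 k" using N(1) Z by (rule mult_carrier_mat)
  have "M * (N * Z) = P * mat_diag r s * (N\<^sup>T * (N * Z))"
    unfolding M_eq using assoc_mult_mat[OF mult_carrier_mat[OF P(1) carriers(5)] carriers(4) NZ] .
  also have "N\<^sup>T * (N * Z) = Z" using assoc_mult_mat[OF carriers(4) N(1) Z] N(2) Z by simp
  finally show ?thesis using assoc_mult_mat[OF P(1) carriers(5) Z] by simp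
qed

lemma M_mult_N_ge:
  assumes Z: "Z \<in> carrier_mat r k"
  shows "\<sigma> * frob_norm Z \<le> frob_norm (M * (N * Z))"
  using frob_norm_isometry_mult[OF P mult_carrier_mat[OF carriers(5) Z]] frob_norm_diag_mult_ge[OF Z s_ge] \<sigma>
  by (simp add: M_mult_N[OF Z])

lemma M_G_M: "M * G * M = M"
proof -
  let ?D' = "mat_diag r (\<lambda>i. 1 / s i)"
  have "\<And>i. i < r \<Longrightarrow> s i \<noteq> 0" using s_ge \<sigma> by force
  then have DD: "mat_diag r s * ?D' = 1\<^sub>m r"
    unfolding mat_diag_diag mat_diag_one[symmetric] by (auto simp: mat_diag_def)
  have D'P: "?D' * P\<^sup>T \<in> carrier_mat r d1" using carriers by (metis mult_carrier_mat)
  have "M * G = M * (N * (?D' * P\<^sup>T))"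
    unfolding G_def using assoc_mult_mat[OF N(1) carriers(5) carriers(3)] by simp
  also have "\<dots> = P * (mat_diag r s * ?D' * P\<^sup>T)"
    by (simp only: M_mult_N[OF D'P] assoc_mult_mat[OF carriers(5) carriers(5) carriers(3)])
  also have "\<dots> = P * P\<^sup>T" using DD carriers(3) by simp
  finally have MG: "M * G = P * P\<^sup>T" .
  have DN: "mat_diag r s * N\<^sup>T \<in> carrier_mat r d2" using carriers by (metis mult_carrier_mat)
  have M2: "M = P * (mat_diag r s * N\<^sup>T)" unfolding M_eq using assoc_mult_mat[OF P(1) carriers(5,4)] .
  have "P * P\<^sup>T * (P * (mat_diag r s * N\<^sup>T)) = P * (P\<^sup>T * (P * (mat_diag r s * N\<^sup>T)))"
    using assoc_mult_mat[OF P(1) carriers(3) mult_carrier_mat[OF P(1) DN]] .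
  also have "P\<^sup>T * (P * (mat_diag r s * N\<^sup>T)) = mat_diag r s * N\<^sup>T"
    by (simp only: assoc_mult_mat[OF carriers(3) P(1) DN, symmetric] P(2) left_mult_one_mat[OF DN])
  finally show ?thesis unfolding MG using M2 by simp
qed

text \<open>Grouping as (E N D')(P^T E), with D' the inverted diagonal, spends 1/\<sigma> once and
  yields one Frobenius norm per factor \<open>E\<close>. The Frobenius norm of \<open>G\<close>
  itself would introduce a dependence on the rank.\<close>

lemma frob_norm_G:
  assumes E: "E \<in> carrier_mat d1 d2"
  shows "frob_norm (E * G * E) \<le> (frob_norm E)\<^sup>2 / \<sigma>"
proof -
  let ?D' = "mat_diag r (\<lambda>i. 1 / s i)"
  have EN: "E * N \<in> carrier_mat d1 r" and PE: "P\<^sup>T * E \<in> carrier_mat r d2"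
    using E N P by auto
  have END: "E * N * ?D' \<in> carrier_mat d1 r" using EN carriers(5) by (rule mult_carrier_mat)
  have "E * G * E = (E * N * ?D') * (P\<^sup>T * E)"
    unfolding G_def
    using assoc_mult_mat[OF E mult_carrier_mat[OF N(1) carriers(5)] carriers(3), of "\<lambda>i. 1 / s i"]
      assoc_mult_mat[OF E N(1) carriers(5), of "\<lambda>i. 1 / s i"] assoc_mult_mat[OF END carriers(3) E] by simp
  then have "frob_norm (E * G * E) \<le> frob_norm (E * N * ?D') * frob_norm (P\<^sup>T * E)"
    using frob_norm_mult[OF END PE] by simp
  also have "\<dots> \<le> (frob_norm E / \<sigma>) * frob_norm E"
  proof (intro mult_mono)
    show "frob_norm (E * N * ?D') \<le> frob_norm E / \<sigma>"
      using frob_norm_mult_diag_inverse_le[OF EN s_ge \<sigma>] divide_right_mono[OF frob_norm_mult_isometry_le[OF N E], of \<sigma>] \<sigma>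
      by (meson less_imp_le order_trans)
    show "frob_norm (P\<^sup>T * E) \<le> frob_norm E" by (rule frob_norm_isometry_transpose_mult_le[OF P E])
  qed (use \<sigma> in auto)
  finally show ?thesis by (simp add: power2_eq_square)
qed

text \<open>Writing \<open>W = U V\<^sup>T\<close> and \<open>E = W - M\<close>, expanding \<open>E G E\<close> with \<open>M G M = M\<close> shows that
  \<open>M - E G E\<close> is a sum of matrices of the forms \<open>U *\<close> and \<open>* V\<^sup>T\<close>: this is a point of the
  tangent space at \<open>W\<close> that is second-order close to \<open>M\<close>.\<close>

lemma tangent_approximation:
  assumes U: "U \<in> carrier_mat d1 r" and V: "V \<in> carrier_mat d2 r"
  defines "E \<equiv> U * V\<^sup>T - M"
  shows "\<exists>P' Q'. P' \<in> carrier_mat d1 r \<and> Q' \<in> carrier_mat d2 r \<and>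
    U * V\<^sup>T + U * Q'\<^sup>T + P' * V\<^sup>T - M = (-1) \<cdot>\<^sub>m (E * G * E)"
proof -
  note M = carriers(1) and G = carriers(2)
  have VT: "V\<^sup>T \<in> carrier_mat r d2" using V by simp
  let ?W = "U * V\<^sup>T"
  have W: "?W \<in> carrier_mat d1 d2" using U VT by (rule mult_carrier_mat)
  \<comment> \<open>The step collects W G M on the left factor and M G W - W G W on the right
    factor. The extra \<open>- U\<close> in \<open>P1 - P2 - U\<close> cancels the base point
    \<open>U * V\<^sup>T\<close>.\<close>
  define Qt where "Qt = V\<^sup>T * (G * M)"
  define P1 where "P1 = M * (G * U)"
  define P2 where "P2 = ?W * (G * U)"
  have GM: "G * M \<in> carrier_mat d2 d2" and GU: "G * U \<in> carrier_mat d2 r" and GW: "G * ?W \<in> carrier_mat d2 d2"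
    using G M U W by auto
  have Qt: "Qt \<in> carrier_mat r d2" and P1: "P1 \<in> carrier_mat d1 r" and P2: "P2 \<in> carrier_mat d1 r"
    unfolding Qt_def P1_def P2_def using VT GM M GU W by (metis mult_carrier_mat)+
  have a: "U * Qt = ?W * (G * M)" unfolding Qt_def using assoc_mult_mat[OF U VT GM] by simp
  have GWe: "(G * U) * V\<^sup>T = G * ?W" using assoc_mult_mat[OF G U VT] .
  have b: "P1 * V\<^sup>T = M * (G * ?W)" "P2 * V\<^sup>T = ?W * (G * ?W)"
    unfolding P1_def P2_def using assoc_mult_mat[OF M GU VT] assoc_mult_mat[OF W GU VT] GWe by simp_all
  have c: "(P1 - P2 - U) * V\<^sup>T = M * (G * ?W) - ?W * (G * ?W) - ?W"
    using minus_mult_distrib_mat[OF minus_carrier_mat[OF P2] U VT, of P1] minus_mult_distrib_mat[OF P1 P2 VT] b by simp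
  have E: "E \<in> carrier_mat d1 d2" unfolding E_def using M by (rule minus_carrier_mat)
  have WG: "?W * G \<in> carrier_mat d1 d1" and MG: "M * G \<in> carrier_mat d1 d1" using W M G by auto
  have t: "?W * (G * ?W) \<in> carrier_mat d1 d2" "?W * (G * M) \<in> carrier_mat d1 d2" "M * (G * ?W) \<in> carrier_mat d1 d2"
    using W M GW GM by (metis mult_carrier_mat)+
  have "E * G * E = (?W * G - M * G) * (?W - M)"
    unfolding E_def using minus_mult_distrib_mat[OF W M G] by simp
  also have "\<dots> = (?W * G) * (?W - M) - (M * G) * (?W - M)"
    using minus_mult_distrib_mat[OF WG MG minus_carrier_mat[OF M]] .
  also have "(?W * G) * (?W - M) = ?W * (G * ?W) - ?W * (G * M)"
    using mult_minus_distrib_mat[OF WG W M] assoc_mult_mat[OF W G W] assoc_mult_mat[OF W G M] by simp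
  also have "(M * G) * (?W - M) = M * (G * ?W) - M"
    using mult_minus_distrib_mat[OF MG W M] assoc_mult_mat[OF M G W] M_G_M by simp
  finally have EGE: "E * G * E = ?W * (G * ?W) - ?W * (G * M) - (M * (G * ?W) - M)" .
  have arith: "W' + X + (Y - Z - W') - M' = (-1) \<cdot>\<^sub>m (Z - X - (Y - M'))"
    if "W' \<in> carrier_mat d1 d2" "X \<in> carrier_mat d1 d2" "Y \<in> carrier_mat d1 d2" "Z \<in> carrier_mat d1 d2" "M' \<in> carrier_mat d1 d2"
    for W' X Y Z M' :: "real mat"
    by (rule eq_matI) (use that in auto)
  have "?W + U * (Qt\<^sup>T)\<^sup>T + (P1 - P2 - U) * V\<^sup>T - M = (-1) \<cdot>\<^sub>m (E * G * E)"
    using arith[OF W t(2) t(3) t(1) M] by (simp add: a c EGE)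
  then show ?thesis
    using U Qt by (intro exI[of _ "P1 - P2 - U"] exI[of _ "Qt\<^sup>T"]) (auto intro: minus_carrier_mat)
qed

text \<open>Closeness to \<open>M\<close> bounds only the product of the two norms from below: with
  X = V^T N Z, the square of \<open>frob_norm X\<close> is at most the norm of Z times that of V X,
  and Z is controlled by U X. Near balance makes the norms of U X and V X comparable, so neither can
  be small.\<close>

lemma factors_bounded_below:
  assumes U: "U \<in> carrier_mat d1 r" and V: "V \<in> carrier_mat d2 r"
    and err: "frob_norm (U * V\<^sup>T - M) \<le> \<sigma> / 100"
    and bal: "frob_norm (U\<^sup>T * U - V\<^sup>T * V) \<le> \<sigma> / 100"
    and X: "X \<in> carrier_mat r k"
  shows "\<sigma> / 4 * (frob_norm X)\<^sup>2 \<le> (frob_norm (U * X))\<^sup>2"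
    and "\<sigma> / 4 * (frob_norm X)\<^sup>2 \<le> (frob_norm (V * X))\<^sup>2"
proof -
  define E where "E = U * V\<^sup>T - M"
  note M = carriers(1)
  have VT: "V\<^sup>T \<in> carrier_mat r d2" and UT: "U\<^sup>T \<in> carrier_mat r d1" using V U by auto
  have W: "U * V\<^sup>T \<in> carrier_mat d1 d2" using U VT by (rule mult_carrier_mat)
  have E: "E \<in> carrier_mat d1 d2" unfolding E_def using M by (rule minus_carrier_mat)
  have WE: "U * V\<^sup>T = M + E" unfolding E_def by (rule eq_matI) (use W M in auto)
  define K where "K = V\<^sup>T * N"
  have K: "K \<in> carrier_mat r r" unfolding K_def using VT N(1) by (rule mult_carrier_mat)
  have UKZ: "99/100 * \<sigma> * frob_norm Z \<le> frob_norm (U * (K * Z))" if Z: "Z \<in> carrier_mat r j" for Z j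
  proof -
    have NZ: "N * Z \<in> carrier_mat d2 j" using N(1) Z by (rule mult_carrier_mat)
    have MNZ: "M * (N * Z) \<in> carrier_mat d1 j" and ENZ: "E * (N * Z) \<in> carrier_mat d1 j"
      using M E NZ by (metis mult_carrier_mat)+
    have "U * (K * Z) = (U * V\<^sup>T) * (N * Z)"
      unfolding K_def using assoc_mult_mat[OF VT N(1) Z] assoc_mult_mat[OF U VT NZ] by simp
    also have "\<dots> = M * (N * Z) + E * (N * Z)" unfolding WE using add_mult_distrib_mat[OF M E NZ] .
    finally have eq: "U * (K * Z) = M * (N * Z) + E * (N * Z)" .
    have "A = A + B - B" if "A \<in> carrier_mat d1 j" "B \<in> carrier_mat d1 j" for A B :: "real mat"
      by (rule eq_matI) (use that in auto)
    from this[OF MNZ ENZ] have "frob_norm (M * (N * Z)) \<le> frob_norm (U * (K * Z)) + frob_norm (E * (N * Z))"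
      unfolding eq using frob_norm_triangle_diff[OF add_carrier_mat[OF ENZ] ENZ, of "M * (N * Z)"] by simp
    moreover have "frob_norm (E * (N * Z)) \<le> \<sigma> / 100 * frob_norm Z"
      using frob_norm_mult[OF E NZ] frob_norm_isometry_mult[OF N Z] err[folded E_def]
        mult_right_mono[OF err[folded E_def] frob_norm_nonneg[of Z]] by simp
    ultimately show ?thesis using M_mult_N_ge[OF Z] by (simp add: algebra_simps)
  qed
  \<comment> \<open>Invertibility allows an arbitrary \<open>X\<close> to be written as
    \<open>K * Z\<close>. A kernel vector, recast as a one-column matrix, would contradict the lower
    bound \<open>UKZ\<close>.\<close>
  have "det K \<noteq> 0"
  proof
    assume "det K = 0"
    then obtain v where v: "v \<in> carrier_vec r" "v \<noteq> 0\<^sub>v r" "K *\<^sub>v v = 0\<^sub>v r"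
      using det_0_iff_vec_prod_zero_field[OF K] by blast
    define Z where "Z = mat r 1 (\<lambda>(i,_). v $ i)"
    have Z: "Z \<in> carrier_mat r 1" by (simp add: Z_def)
    have colZ: "col Z 0 = v" using v by (auto simp: Z_def)
    have "K * Z = 0\<^sub>m r 1"
    proof (rule eq_matI)
      fix i j assume "i < dim_row (0\<^sub>m r 1 :: real mat)" "j < dim_col (0\<^sub>m r 1 :: real mat)"
      then have ij: "i < r" "j = 0" by auto
      then have "(K * Z) $$ (i,j) = (K *\<^sub>v v) $ i" using K Z colZ by simp
      then show "(K * Z) $$ (i,j) = 0\<^sub>m r 1 $$ (i,j)" using v ij by simp
    qed (use K Z in auto)
    then have "99/100 * \<sigma> * frob_norm Z \<le> frob_norm (0\<^sub>m d1 1)" using UKZ[OF Z] U by simp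
    also have "\<dots> = 0" by (simp add: frob_norm_def)
    finally have "frob_norm Z \<le> 0" using \<sigma> by (simp add: mult_le_0_iff)
    then have "Z = 0\<^sub>m r 1" using frob_norm_eq_0[OF Z] frob_norm_nonneg[of Z] by linarith
    then have "col Z 0 = 0\<^sub>v r" by (intro eq_vecI) auto
    then show False using v colZ by simp
  qed
  then obtain K' where K': "K' \<in> carrier_mat r r" "K * K' = 1\<^sub>m r" using det_nonzero_right_inverse[OF K] by blast
  define Z where "Z = K' * X"
  have Z: "Z \<in> carrier_mat r k" unfolding Z_def using K'(1) X by (rule mult_carrier_mat)
  have KZ: "K * Z = X" unfolding Z_def using assoc_mult_mat[OF K K'(1) X] K'(2) X by simp
  have UX: "99/100 * \<sigma> * frob_norm Z \<le> frob_norm (U * X)" using UKZ[OF Z] KZ by simp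
  have NZ: "N * Z \<in> carrier_mat d2 k" using N(1) Z by (rule mult_carrier_mat)
  have VX: "V * X \<in> carrier_mat d2 k" and UXc: "U * X \<in> carrier_mat d1 k" using U V X by auto
  have "(frob_norm X)\<^sup>2 = frob_inner (V\<^sup>T * (N * Z)) X"
    using KZ assoc_mult_mat[OF VT N(1) Z] unfolding K_def frob_inner_self[symmetric] by simp
  also have "\<dots> = frob_inner (N * Z) (V * X)" using frob_inner_mult_left[OF VT NZ X] by simp
  also have "\<dots> \<le> frob_norm Z * frob_norm (V * X)"
    using frob_inner_le[OF NZ VX] frob_norm_isometry_mult[OF N Z] by simp
  finally have x2: "(frob_norm X)\<^sup>2 \<le> frob_norm Z * frob_norm (V * X)" .
  have "99/100 * \<sigma> * (frob_norm X)\<^sup>2 \<le> (99/100 * \<sigma> * frob_norm Z) * frob_norm (V * X)"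
    using x2 \<sigma> by simp
  also have "\<dots> \<le> frob_norm (U * X) * frob_norm (V * X)" using UX by (intro mult_right_mono) auto
  finally have prod: "99/100 * \<sigma> * (frob_norm X)\<^sup>2 \<le> frob_norm (U * X) * frob_norm (V * X)" .
  have UU: "U\<^sup>T * U \<in> carrier_mat r r" and VV: "V\<^sup>T * V \<in> carrier_mat r r" using U V by auto
  have D: "U\<^sup>T * U - V\<^sup>T * V \<in> carrier_mat r r" using VV by (rule minus_carrier_mat)
  have "(frob_norm (U * X))\<^sup>2 - (frob_norm (V * X))\<^sup>2 = frob_inner X ((U\<^sup>T * U - V\<^sup>T * V) * X)"
  proof -
    have "(frob_norm (U * X))\<^sup>2 = frob_inner X ((U\<^sup>T * U) * X)"
      using frob_inner_mult_left[OF U X UXc] assoc_mult_mat[OF UT U X] by (simp add: frob_inner_self)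
    moreover have "(frob_norm (V * X))\<^sup>2 = frob_inner X ((V\<^sup>T * V) * X)"
      using frob_inner_mult_left[OF V X VX] assoc_mult_mat[OF VT V X] by (simp add: frob_inner_self)
    ultimately show ?thesis
      using minus_mult_distrib_mat[OF UU VV X] frob_inner_diff_right[OF X mult_carrier_mat[OF UU X] mult_carrier_mat[OF VV X]]
      by simp
  qed
  also have "\<bar>\<dots>\<bar> \<le> frob_norm X * frob_norm ((U\<^sup>T * U - V\<^sup>T * V) * X)"
    by (rule frob_inner_le[OF X mult_carrier_mat[OF D X]])
  also have "\<dots> \<le> frob_norm X * (\<sigma> / 100 * frob_norm X)"
    using frob_norm_mult[OF D X] mult_right_mono[OF bal frob_norm_nonneg[of X]]
    by (intro mult_left_mono) auto
  also have "frob_norm X * (\<sigma> / 100 * frob_norm X) = \<sigma> / 100 * (frob_norm X)\<^sup>2"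
    by (simp add: power2_eq_square)
  finally have diff: "\<bar>(frob_norm (U * X))\<^sup>2 - (frob_norm (V * X))\<^sup>2\<bar> \<le> \<sigma> / 100 * (frob_norm X)\<^sup>2" .
  \<comment> \<open>If a^2 < y/4 then b^2 \<le> 0.26 y, so (a b)^2 \<le> 0.065 y^2, far below 0.99^2
    y^2.\<close>
  have key: "y / 4 \<le> a\<^sup>2" if "0 \<le> a" "0 \<le> b" "0 \<le> y" "99/100 * y \<le> a * b" "b\<^sup>2 \<le> a\<^sup>2 + y / 100" for a b y :: real
  proof (rule ccontr)
    assume "\<not> y / 4 \<le> a\<^sup>2"
    then have a: "a\<^sup>2 < y / 4" by simp
    then have "b\<^sup>2 \<le> 26/100 * y" using that(5) by simp
    then have "(a * b)\<^sup>2 \<le> y / 4 * (26/100 * y)"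
      unfolding power_mult_distrib using a that(3) by (intro mult_mono) auto
    moreover have "(99/100 * y)\<^sup>2 \<le> (a * b)\<^sup>2" using that by (intro power_mono) auto
    ultimately have "(99/100)\<^sup>2 * y\<^sup>2 \<le> 26/400 * y\<^sup>2" by (simp add: power2_eq_square power_mult_distrib)
    then have "y = 0" by (auto simp: power2_eq_square mult_le_0_iff)
    then show False using a by simp
  qed
  have y: "0 \<le> \<sigma> * (frob_norm X)\<^sup>2" using \<sigma> by simp
  have d: "(frob_norm (V * X))\<^sup>2 \<le> (frob_norm (U * X))\<^sup>2 + \<sigma> * (frob_norm X)\<^sup>2 / 100"
    "(frob_norm (U * X))\<^sup>2 \<le> (frob_norm (V * X))\<^sup>2 + \<sigma> * (frob_norm X)\<^sup>2 / 100"
    using abs_le_D1[OF diff] abs_le_D2[OF diff] unfolding times_divide_eq_left by linarith+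
  have pr: "99/100 * (\<sigma> * (frob_norm X)\<^sup>2) \<le> frob_norm (U * X) * frob_norm (V * X)"
    using prod by (simp add: mult.assoc)
  show "\<sigma> / 4 * (frob_norm X)\<^sup>2 \<le> (frob_norm (U * X))\<^sup>2"
    using key[OF frob_norm_nonneg frob_norm_nonneg y pr d(1)] by simp
  show "\<sigma> / 4 * (frob_norm X)\<^sup>2 \<le> (frob_norm (V * X))\<^sup>2"
    using key[OF frob_norm_nonneg frob_norm_nonneg y _ d(2)] pr by (simp add: mult.commute)
qed

end

lemma quadratic_nonneg_imp_zero:
  fixes a b :: real
  assumes "\<And>t. 0 \<le> - 2 * t * a + t\<^sup>2 * b" "0 \<le> a" "0 \<le> b"
  shows "a = 0"
proof (rule ccontr)
  assume "a \<noteq> 0"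
  then have a: "0 < a" using assms by simp
  define t where "t = a / (b + 1)"
  have t: "0 < t" using a assms(3) by (simp add: t_def)
  have "0 \<le> t * (- 2 * a + t * b)" using assms(1)[of t] by (simp add: power2_eq_square algebra_simps)
  then have "2 * a \<le> t * b" using t by (simp add: zero_le_mult_iff)
  also have "\<dots> \<le> a" using a assms(3) by (simp add: t_def field_simps)
  finally show False using a by simp
qed

text \<open>Moving along (-U R, V R^T) leaves U dV^T + dU V^T unchanged: this is the infinitesimal
  form of replacing (U, V) by (U g, V g^-T). A minimal norm solution is orthogonal to all these
  directions.\<close>

lemma min_norm_balanced:
  assumes U: "U \<in> carrier_mat d1 r" and V: "V \<in> carrier_mat d2 r"
    and dU: "dU \<in> carrier_mat d1 r" and dV: "dV \<in> carrier_mat d2 r"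
    and min: "\<And>P' Q'. P' \<in> carrier_mat d1 r \<Longrightarrow> Q' \<in> carrier_mat d2 r \<Longrightarrow>
      U * Q'\<^sup>T + P' * V\<^sup>T = U * dV\<^sup>T + dU * V\<^sup>T \<Longrightarrow>
      (frob_norm dU)\<^sup>2 + (frob_norm dV)\<^sup>2 \<le> (frob_norm P')\<^sup>2 + (frob_norm Q')\<^sup>2"
  shows "U\<^sup>T * dU = dV\<^sup>T * V"
proof -
  have T: "U\<^sup>T \<in> carrier_mat r d1" "V\<^sup>T \<in> carrier_mat r d2" "dV\<^sup>T \<in> carrier_mat r d2" using U V dV by auto
  have UdU: "U\<^sup>T * dU \<in> carrier_mat r r" and dVV: "dV\<^sup>T * V \<in> carrier_mat r r" and VdV: "V\<^sup>T * dV \<in> carrier_mat r r"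
    using T dU V dV by auto
  \<comment> \<open>Taking the defect itself as the direction makes the derivative of the squared
    norm equal to -2 times the squared norm of \<open>R\<close>, so stationarity forces R =
    0.\<close>
  define R where "R = U\<^sup>T * dU - dV\<^sup>T * V"
  have R: "R \<in> carrier_mat r r" unfolding R_def using dVV by (rule minus_carrier_mat)
  have RT: "R\<^sup>T \<in> carrier_mat r r" using R by simp
  have UR: "U * R \<in> carrier_mat d1 r" and VR: "V * R\<^sup>T \<in> carrier_mat d2 r" using U V R RT by auto
  have iU: "frob_inner dU (U * R) = frob_inner (U\<^sup>T * dU) R"
    using frob_inner_mult_left[OF T(1) dU R] by simp
  have "frob_inner dV (V * R\<^sup>T) = frob_inner (V\<^sup>T * dV) R\<^sup>T"
    using frob_inner_mult_left[OF T(2) dV RT] by simp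
  also have "V\<^sup>T * dV = (dV\<^sup>T * V)\<^sup>T" using transpose_mult[OF T(3) V] by simp
  finally have iV: "frob_inner dV (V * R\<^sup>T) = frob_inner (dV\<^sup>T * V) R"
    using frob_inner_transpose[OF dVV R] by simp
  have iR: "(frob_norm R)\<^sup>2 = frob_inner (U\<^sup>T * dU) R - frob_inner (dV\<^sup>T * V) R"
    using frob_inner_diff_right[OF R UdU dVV] frob_inner_commute[OF R UdU] frob_inner_commute[OF R dVV]
    by (simp add: R_def[symmetric] frob_inner_self)
  have "0 \<le> - 2 * t * (frob_norm R)\<^sup>2 + t\<^sup>2 * ((frob_norm (U * R))\<^sup>2 + (frob_norm (V * R\<^sup>T))\<^sup>2)" for t
  proof -
    have smult_inner: "frob_inner X (c \<cdot>\<^sub>m Y) = c * frob_inner X Y"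
      if "X \<in> carrier_mat n m" "Y \<in> carrier_mat n m" for X Y c n m
      using that by (simp add: frob_inner_def sum_distrib_left mult.left_commute)
    let ?P = "dU + (- t) \<cdot>\<^sub>m (U * R)" and ?Q = "dV + t \<cdot>\<^sub>m (V * R\<^sup>T)"
    have P: "?P \<in> carrier_mat d1 r" and Q: "?Q \<in> carrier_mat d2 r" using dU dV UR VR by auto
    have sU: "(- t) \<cdot>\<^sub>m (U * R) \<in> carrier_mat d1 r" and sV: "t \<cdot>\<^sub>m (V * R\<^sup>T) \<in> carrier_mat d2 r" using UR VR by auto
    have VRT: "(V * R\<^sup>T)\<^sup>T = R * V\<^sup>T" using transpose_mult[OF V RT] by simp
    have RV: "R * V\<^sup>T \<in> carrier_mat r d2" using R T by simp
    have URV: "U * (R * V\<^sup>T) \<in> carrier_mat d1 d2" using U RV by (rule mult_carrier_mat)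
    have "?Q\<^sup>T = dV\<^sup>T + t \<cdot>\<^sub>m (R * V\<^sup>T)"
    proof -
      have "(t \<cdot>\<^sub>m (V * R\<^sup>T))\<^sup>T = t \<cdot>\<^sub>m (V * R\<^sup>T)\<^sup>T" by (rule eq_matI) auto
      then show ?thesis using transpose_add[OF dV sV] VRT by simp
    qed
    then have 1: "U * ?Q\<^sup>T = U * dV\<^sup>T + t \<cdot>\<^sub>m (U * (R * V\<^sup>T))"
      using mult_add_distrib_mat[OF U T(3) smult_carrier_mat[OF RV]] mult_smult_distrib[OF U RV] by simp
    have 2: "?P * V\<^sup>T = dU * V\<^sup>T + (- t) \<cdot>\<^sub>m (U * (R * V\<^sup>T))"
      using add_mult_distrib_mat[OF dU sU T(2)] mult_smult_assoc_mat[OF UR T(2)] assoc_mult_mat[OF U R T(2)] by simp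
    have arith: "A + t \<cdot>\<^sub>m C + (B + (- t) \<cdot>\<^sub>m C) = A + B"
      if "A \<in> carrier_mat d1 d2" "B \<in> carrier_mat d1 d2" "C \<in> carrier_mat d1 d2" for A B C :: "real mat"
      by (rule eq_matI) (use that in auto)
    have "U * ?Q\<^sup>T + ?P * V\<^sup>T = U * dV\<^sup>T + dU * V\<^sup>T"
      unfolding 1 2 by (rule arith[OF mult_carrier_mat[OF U T(3)] mult_carrier_mat[OF dU T(2)] URV])
    from min[OF P Q this] show ?thesis
      unfolding frob_norm_add_sq[OF dU sU] frob_norm_add_sq[OF dV sV] smult_inner[OF dU UR] smult_inner[OF dV VR]
        frob_norm_smult iU iV iR by (simp add: power_mult_distrib algebra_simps)
  qed
  then have "(frob_norm R)\<^sup>2 = 0" by (rule quadratic_nonneg_imp_zero) auto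
  then have "R = 0\<^sub>m r r" using frob_norm_eq_0[OF R] by simp
  then have "U\<^sup>T * dU - dV\<^sup>T * V = 0\<^sub>m r r" by (simp add: R_def)
  moreover have "A = B" if "A - B = 0\<^sub>m r r" "A \<in> carrier_mat r r" "B \<in> carrier_mat r r" for A B :: "real mat"
  proof (rule eq_matI)
    fix i j assume "i < dim_row B" "j < dim_col B"
    then show "A $$ (i,j) = B $$ (i,j)"
      using arg_cong[OF that(1), of "\<lambda>M. M $$ (i,j)"] that(2,3) by simp
  qed (use that in auto)
  ultimately show ?thesis using UdU dVV by blast
qed

context low_rank_target
begin

text \<open>\<open>q\<close> stands for the squared measured residual and enters only through its
  equivalence with the squared Frobenius norm. The new error is the linearised residual plus dU
  dV^T; these are at most 40 and 8 times e^2/\<sigma>, so 100/\<sigma> has slack.\<close>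

lemma gauss_newton_step:
  fixes q :: "real mat \<Rightarrow> real"
  assumes U: "U \<in> carrier_mat d1 r" and V: "V \<in> carrier_mat d2 r"
    and dU: "dU \<in> carrier_mat d1 r" and dV: "dV \<in> carrier_mat d2 r"
    and err: "frob_norm (U * V\<^sup>T - M) \<le> \<sigma> / 200"
    and bal: "frob_norm (U\<^sup>T * U - V\<^sup>T * V) \<le> \<sigma> / 100"
    and \<alpha>: "0 < \<alpha>"
    and q: "\<And>Z. Z \<in> carrier_mat d1 d2 \<Longrightarrow> \<alpha> * (frob_norm Z)\<^sup>2 \<le> q Z"
      "\<And>Z. Z \<in> carrier_mat d1 d2 \<Longrightarrow> q Z \<le> 1600 * \<alpha> * (frob_norm Z)\<^sup>2"
    and min: "\<And>P' Q'. P' \<in> carrier_mat d1 r \<Longrightarrow> Q' \<in> carrier_mat d2 r \<Longrightarrow>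
      q (U * V\<^sup>T + U * dV\<^sup>T + dU * V\<^sup>T - M) \<le> q (U * V\<^sup>T + U * Q'\<^sup>T + P' * V\<^sup>T - M)"
    and min_norm: "\<And>P' Q'. P' \<in> carrier_mat d1 r \<Longrightarrow> Q' \<in> carrier_mat d2 r \<Longrightarrow>
      U * Q'\<^sup>T + P' * V\<^sup>T = U * dV\<^sup>T + dU * V\<^sup>T \<Longrightarrow>
      (frob_norm dU)\<^sup>2 + (frob_norm dV)\<^sup>2 \<le> (frob_norm P')\<^sup>2 + (frob_norm Q')\<^sup>2"
  defines "e \<equiv> frob_norm (U * V\<^sup>T - M)"
  shows "frob_norm ((U + dU) * (V + dV)\<^sup>T - M) \<le> 100 / \<sigma> * e\<^sup>2" (is ?error)
    and "frob_norm ((U + dU)\<^sup>T * (U + dU) - (V + dV)\<^sup>T * (V + dV))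
      \<le> frob_norm (U\<^sup>T * U - V\<^sup>T * V) + 16 / \<sigma> * e\<^sup>2" (is ?balance)
proof -
  note M = carriers(1) and G = carriers(2)
  have T: "U\<^sup>T \<in> carrier_mat r d1" "V\<^sup>T \<in> carrier_mat r d2" "dU\<^sup>T \<in> carrier_mat r d1" "dV\<^sup>T \<in> carrier_mat r d2"
    using U V dU dV by auto
  define E where "E = U * V\<^sup>T - M"
  define F where "F = U * V\<^sup>T + U * dV\<^sup>T + dU * V\<^sup>T - M"
  have E: "E \<in> carrier_mat d1 d2" and F: "F \<in> carrier_mat d1 d2"
    unfolding E_def F_def using M by (auto intro: minus_carrier_mat)
  have eE: "e = frob_norm E" by (simp add: e_def E_def)
  have e0: "0 \<le> e" by (simp add: eE)
  have e_le: "e \<le> \<sigma> / 200" using err by (simp add: e_def)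
  have EGE: "E * G * E \<in> carrier_mat d1 d2" using E G by (metis mult_carrier_mat)
  have e_sq: "e\<^sup>2 / \<sigma> \<le> e / 200"
  proof -
    have "e * e \<le> e * (\<sigma> / 200)" using e_le e0 by (intro mult_left_mono)
    then show ?thesis using \<sigma> by (simp add: field_simps power2_eq_square)
  qed
  \<comment> \<open>The minimiser is compared with the tangent point close to \<open>M\<close>; 40
    is the square root of the ratio 1600.\<close>
  have F_le: "frob_norm F \<le> 40 * (e\<^sup>2 / \<sigma>)"
  proof -
    obtain P' Q' where PQ: "P' \<in> carrier_mat d1 r" "Q' \<in> carrier_mat d2 r"
      "U * V\<^sup>T + U * Q'\<^sup>T + P' * V\<^sup>T - M = (-1) \<cdot>\<^sub>m (E * G * E)"
      using tangent_approximation[OF U V] unfolding E_def by blast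
    have "\<alpha> * (frob_norm F)\<^sup>2 \<le> q F" by (rule q(1)[OF F])
    also have "\<dots> \<le> q ((-1) \<cdot>\<^sub>m (E * G * E))" using min[OF PQ(1,2)] PQ(3) by (simp add: F_def)
    also have "\<dots> \<le> 1600 * \<alpha> * (frob_norm (E * G * E))\<^sup>2"
      using q(2)[OF smult_carrier_mat[OF EGE, of "-1"]] by (simp add: frob_norm_smult)
    finally have "(frob_norm F)\<^sup>2 \<le> (40 * frob_norm (E * G * E))\<^sup>2" using \<alpha> by (simp add: power_mult_distrib)
    then have "frob_norm F \<le> 40 * frob_norm (E * G * E)" by (rule power2_le_imp_le) simp
    then show ?thesis using frob_norm_G[OF E] by (simp add: eE)
  qed
  have orth: "U\<^sup>T * dU = dV\<^sup>T * V" by (rule min_norm_balanced[OF U V dU dV min_norm])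
  have UdV: "U * dV\<^sup>T \<in> carrier_mat d1 d2" and dUV: "dU * V\<^sup>T \<in> carrier_mat d1 d2"
    and UV: "U * V\<^sup>T \<in> carrier_mat d1 d2" and dUdV: "dU * dV\<^sup>T \<in> carrier_mat d1 d2" using U V dU dV by auto
  define W where "W = U * dV\<^sup>T + dU * V\<^sup>T"
  have W: "W \<in> carrier_mat d1 d2" using UdV dUV by (simp add: W_def)
  \<comment> \<open>W = F - E, and e \<le> \<sigma>/200 turns 40 e^2/\<sigma> into e/5.\<close>
  have "frob_norm W \<le> 2 * e"
  proof -
    have "A + B = C + A + B - M - (C - M)"
      if "A \<in> carrier_mat d1 d2" "B \<in> carrier_mat d1 d2" "C \<in> carrier_mat d1 d2" for A B C
      by (rule eq_matI) (use that M in auto)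
    from this[OF UdV dUV UV] have "W = F - E" by (simp add: W_def F_def E_def)
    then have "frob_norm W \<le> frob_norm F + e" using frob_norm_triangle_diff[OF F E] by (simp add: eE)
    then show ?thesis using F_le e_sq e0 by linarith
  qed
  then have W_le: "(frob_norm W)\<^sup>2 \<le> 4 * e\<^sup>2" using power_mono[of "frob_norm W" "2 * e" 2] by (simp add: power_mult_distrib)
  \<comment> \<open>Cyclic rearrangement gives the inner product of dV^T V with U^T dU; these agree
    by \<open>orth\<close>, so it is a squared norm.\<close>
  have cross: "0 \<le> frob_inner (U * dV\<^sup>T) (dU * V\<^sup>T)"
  proof -
    have UdU: "U\<^sup>T * dU \<in> carrier_mat r r" using T dU by simp
    have "frob_inner (U * dV\<^sup>T) (dU * V\<^sup>T) = frob_inner dV\<^sup>T ((U\<^sup>T * dU) * V\<^sup>T)"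
      using frob_inner_mult_left[OF U T(4) dUV] assoc_mult_mat[OF T(1) dU T(2)] by simp
    also have "\<dots> = frob_inner (dV\<^sup>T * V) (U\<^sup>T * dU)"
      using frob_inner_mult_right[OF T(4) V UdU] by simp
    finally show ?thesis unfolding orth frob_inner_self by simp
  qed
  have below: "\<sigma> / 4 * ((frob_norm dU)\<^sup>2 + (frob_norm dV)\<^sup>2) \<le> (frob_norm W)\<^sup>2"
  proof -
    have err': "frob_norm (U * V\<^sup>T - M) \<le> \<sigma> / 100" using err \<sigma> by simp
    have "\<sigma> / 4 * (frob_norm dV)\<^sup>2 \<le> (frob_norm (U * dV\<^sup>T))\<^sup>2"
      using factors_bounded_below(1)[OF U V err' bal T(4)] by simp
    moreover have "\<sigma> / 4 * (frob_norm dU)\<^sup>2 \<le> (frob_norm (dU * V\<^sup>T))\<^sup>2"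
    proof -
      have "(dU * V\<^sup>T)\<^sup>T = V * dU\<^sup>T" using transpose_mult[OF dU T(2)] by simp
      then have "frob_norm (dU * V\<^sup>T) = frob_norm (V * dU\<^sup>T)" by (metis frob_norm_transpose)
      then show ?thesis using factors_bounded_below(2)[OF U V err' bal T(3)] by simp
    qed
    ultimately show ?thesis unfolding W_def frob_norm_add_sq[OF UdV dUV] using cross by (simp add: algebra_simps)
  qed
  have steps: "(frob_norm dU)\<^sup>2 + (frob_norm dV)\<^sup>2 \<le> 16 * (e\<^sup>2 / \<sigma>)"
  proof -
    have "\<sigma> / 4 * ((frob_norm dU)\<^sup>2 + (frob_norm dV)\<^sup>2) \<le> 4 * e\<^sup>2" using below W_le by linarith
    then show ?thesis using \<sigma> by (simp add: field_simps)
  qed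
  have "(U + dU) * (V + dV)\<^sup>T - M = F + dU * dV\<^sup>T"
  proof -
    have "(U + dU) * (V + dV)\<^sup>T = (U + dU) * (V\<^sup>T + dV\<^sup>T)" using transpose_add[OF V dV] by simp
    also have "\<dots> = U * (V\<^sup>T + dV\<^sup>T) + dU * (V\<^sup>T + dV\<^sup>T)"
      by (rule add_mult_distrib_mat[OF U dU]) (use T in auto)
    also have "\<dots> = (U * V\<^sup>T + U * dV\<^sup>T) + (dU * V\<^sup>T + dU * dV\<^sup>T)"
      using mult_add_distrib_mat[OF U T(2,4)] mult_add_distrib_mat[OF dU T(2,4)] by simp
    finally have eq: "(U + dU) * (V + dV)\<^sup>T = (U * V\<^sup>T + U * dV\<^sup>T) + (dU * V\<^sup>T + dU * dV\<^sup>T)" .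
    have "(A + B) + (C + D) - M = A + B + C - M + D"
      if "A \<in> carrier_mat d1 d2" "B \<in> carrier_mat d1 d2" "C \<in> carrier_mat d1 d2" "D \<in> carrier_mat d1 d2" for A B C D
      by (rule eq_matI) (use that M in auto)
    from this[OF UV UdV dUV dUdV] show ?thesis unfolding eq F_def .
  qed
  then have "frob_norm ((U + dU) * (V + dV)\<^sup>T - M) \<le> frob_norm F + frob_norm (dU * dV\<^sup>T)"
    using frob_norm_triangle[OF F dUdV] by simp
  moreover have "frob_norm (dU * dV\<^sup>T) \<le> ((frob_norm dU)\<^sup>2 + (frob_norm dV)\<^sup>2) / 2"
    using frob_norm_mult[OF dU T(4)] sum_squares_bound[of "frob_norm dU" "frob_norm dV"] by simp
  moreover have "z \<le> 48 * x" if "z \<le> f + g" "g \<le> h / 2" "f \<le> 40 * x" "h \<le> 16 * x" for f g h x z :: real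
    using that by simp
  ultimately have "frob_norm ((U + dU) * (V + dV)\<^sup>T - M) \<le> 48 * (e\<^sup>2 / \<sigma>)" using F_le steps by blast
  also have "\<dots> \<le> 100 * (e\<^sup>2 / \<sigma>)" using \<sigma> by (intro mult_right_mono) auto
  finally show ?error by simp
  have sq: "(X + dX)\<^sup>T * (X + dX) = (X\<^sup>T * X + X\<^sup>T * dX) + (dX\<^sup>T * X + dX\<^sup>T * dX)"
    if X: "X \<in> carrier_mat d r" and dX: "dX \<in> carrier_mat d r" for X dX :: "real mat" and d
  proof -
    have t: "X\<^sup>T \<in> carrier_mat r d" "dX\<^sup>T \<in> carrier_mat r d" using X dX by auto
    have "(X + dX)\<^sup>T * (X + dX) = (X\<^sup>T + dX\<^sup>T) * (X + dX)" using transpose_add[OF X dX] by simp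
    also have "\<dots> = X\<^sup>T * (X + dX) + dX\<^sup>T * (X + dX)"
      by (rule add_mult_distrib_mat[OF t]) (use X dX in auto)
    finally show ?thesis using mult_add_distrib_mat[OF t(1) X dX] mult_add_distrib_mat[OF t(2) X dX] by simp
  qed
  have orth': "dU\<^sup>T * U = V\<^sup>T * dV"
    using arg_cong[OF orth, of transpose_mat] transpose_mult[OF T(1) dU] transpose_mult[OF T(4) V] by simp
  have C: "U\<^sup>T * U \<in> carrier_mat r r" "U\<^sup>T * dU \<in> carrier_mat r r" "dU\<^sup>T * U \<in> carrier_mat r r" "dU\<^sup>T * dU \<in> carrier_mat r r"
    "V\<^sup>T * V \<in> carrier_mat r r" "V\<^sup>T * dV \<in> carrier_mat r r" "dV\<^sup>T * V \<in> carrier_mat r r" "dV\<^sup>T * dV \<in> carrier_mat r r"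
    using U V dU dV by auto
  have arith: "(a + b) + (c + d) - ((a' + c) + (b + d')) = (a - a') + (d - d')"
    if "a \<in> carrier_mat r r" "b \<in> carrier_mat r r" "c \<in> carrier_mat r r" "d \<in> carrier_mat r r"
      "a' \<in> carrier_mat r r" "d' \<in> carrier_mat r r" for a b c d a' d' :: "real mat"
    by (rule eq_matI) (use that in auto)
  \<comment> \<open>By \<open>orth\<close> and its transpose, the first-order terms of the two Gram
    matrices are the same pair in opposite order and cancel exactly.\<close>
  have "(U + dU)\<^sup>T * (U + dU) - (V + dV)\<^sup>T * (V + dV) = (U\<^sup>T * U - V\<^sup>T * V) + (dU\<^sup>T * dU - dV\<^sup>T * dV)"
    unfolding sq[OF U dU] sq[OF V dV] orth orth' by (rule arith[OF C(1,7,6,4,5,8)])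
  then have "frob_norm ((U + dU)\<^sup>T * (U + dU) - (V + dV)\<^sup>T * (V + dV))
      \<le> frob_norm (U\<^sup>T * U - V\<^sup>T * V) + frob_norm (dU\<^sup>T * dU - dV\<^sup>T * dV)"
    using frob_norm_triangle[OF minus_carrier_mat[OF C(5)] minus_carrier_mat[OF C(8)], of "U\<^sup>T * U" "dU\<^sup>T * dU"] by simp
  also have "frob_norm (dU\<^sup>T * dU - dV\<^sup>T * dV) \<le> (frob_norm dU)\<^sup>2 + (frob_norm dV)\<^sup>2"
    using frob_norm_triangle_diff[OF C(4,8)] frob_norm_mult[OF T(3) dU] frob_norm_mult[OF T(4) dV]
    by (simp add: power2_eq_square)
  also note steps
  finally show ?balance by simp
qed

end

text \<open>At err \<le> \<sigma>/200 the quadratic bound is a contraction by 1/2. The balance may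
  therefore drift only by a geometric series, and it stays below \<sigma>/200, inside the region
  where the step applies.\<close>

lemma quadratic_convergence_invariant:
  fixes err bal :: "nat \<Rightarrow> real"
  assumes \<sigma>: "0 < \<sigma>" and err0: "err 0 \<le> \<sigma> / 200" and bal0: "bal 0 \<le> \<sigma> / 400"
    and nonneg: "\<And>t. 0 \<le> err t"
    and step: "\<And>t. err t \<le> \<sigma> / 200 \<Longrightarrow> bal t \<le> \<sigma> / 100 \<Longrightarrow>
      err (Suc t) \<le> 100 / \<sigma> * (err t)\<^sup>2 \<and> bal (Suc t) \<le> bal t + 16 / \<sigma> * (err t)\<^sup>2"
  shows "err (Suc t) \<le> 100 / \<sigma> * (err t)\<^sup>2"
proof -
  \<comment> \<open>The factor 2 - (1/2)^t allows a drift of \<sigma>/800 (1/2)^t in step t; the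
    actual drift is at most 16 \<sigma>/40000 (1/2)^t.\<close>
  have inv: "err t \<le> \<sigma> / 200 * (1/2) ^ t \<and> bal t \<le> \<sigma> / 400 * (2 - (1/2) ^ t)" for t
  proof (induction t)
    case 0
    then show ?case using err0 bal0 by simp
  next
    case (Suc t)
    let ?p = "(1/2) ^ t :: real"
    have p: "0 < ?p" "?p \<le> 1" by (auto simp: power_le_one)
    have sp: "0 \<le> \<sigma> * ?p" "\<sigma> * ?p \<le> \<sigma>" using p \<sigma> by (auto simp: mult_left_le)
    have e1: "err t \<le> \<sigma> / 200" using Suc sp by (simp add: algebra_simps)
    have b1: "bal t \<le> \<sigma> / 100" using Suc sp by (simp add: algebra_simps)
    have "(err t)\<^sup>2 \<le> (\<sigma> / 200) * (\<sigma> / 200 * ?p)"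
      unfolding power2_eq_square using e1 Suc nonneg[of t] \<sigma> by (intro mult_mono) auto
    then have sq: "1 / \<sigma> * (err t)\<^sup>2 \<le> \<sigma> / 40000 * ?p" using \<sigma> by (simp add: field_simps)
    define w where "w = 1 / \<sigma> * (err t)\<^sup>2"
    have "err (Suc t) \<le> 100 * w" "bal (Suc t) \<le> bal t + 16 * w"
      using step[OF e1 b1] by (simp_all add: w_def)
    then show ?case using sq[folded w_def] Suc sp by (simp add: algebra_simps)
  qed
  have "0 < (1/2 :: real) ^ t" "(1/2) ^ t \<le> (1 :: real)" by (auto simp: power_le_one)
  then have sp: "0 \<le> \<sigma> * (1/2) ^ t" "\<sigma> * (1/2) ^ t \<le> \<sigma>" using \<sigma> by (auto simp: mult_left_le)
  have "err t \<le> \<sigma> / 200" using inv[of t] sp by (simp add: algebra_simps)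
  moreover have "bal t \<le> \<sigma> / 100" using inv[of t] sp by (simp add: algebra_simps)
  ultimately show ?thesis using step by blast
qed

section \<open>Sampled entries and the main theorem\<close>

lemma sum_div_mod:
  fixes f :: "nat \<Rightarrow> nat \<Rightarrow> real"
  shows "(\<Sum>k<d1 * d2. f (k div d2) (k mod d2)) = (\<Sum>p<d1. \<Sum>q<d2. f p q)"
  unfolding sum_mult_product by (intro sum.cong refl) simp

lemma entry_mult_mult_transpose:
  assumes A: "A \<in> carrier_mat n1 d1" and B: "B \<in> carrier_mat n2 d2" and Z: "Z \<in> carrier_mat d1 d2"
    and ij: "i < n1" "j < n2"
  shows "(A * Z * B\<^sup>T) $$ (i,j) = (\<Sum>p<d1. \<Sum>q<d2. A $$ (i,p) * B $$ (j,q) * Z $$ (p,q :: nat) :: real)"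
proof -
  have "(A * Z * B\<^sup>T) $$ (i,j) = (\<Sum>p<d1. A $$ (i,p) * (\<Sum>q<d2. Z $$ (p,q) * B $$ (j,q)))"
    using assms by (simp add: scalar_prod_def atLeast0LessThan)
  then show ?thesis by (simp add: sum_distrib_left ac_simps)
qed

lemma row_sum_sq_le_norm_2inf:
  assumes "A \<in> carrier_mat n d" "norm_2inf A \<le> sqrt c" "i < n"
  shows "(\<Sum>p<d. (A $$ (i,p))\<^sup>2) \<le> c"
proof -
  have "sqrt (\<Sum>p<d. (A $$ (i,p))\<^sup>2) \<le> norm_2inf A"
    unfolding norm_2inf_def using assms by (intro Max_ge) auto
  then show ?thesis using assms(2) by (meson order_trans real_sqrt_le_iff)
qed

lemma isometry_cols_orthonormal:
  assumes "A \<in> carrier_mat n d" "isometry A" "p < d" "q < d"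
  shows "(\<Sum>i<n. A $$ (i,p) * A $$ (i,q)) = (if p = q then 1 else 0)"
proof -
  have "(A\<^sup>T * A) $$ (p,q) = 1\<^sub>m d $$ (p,q)" using assms by (simp add: isometry_def)
  then show ?thesis using assms by (simp add: scalar_prod_def atLeast0LessThan)
qed

text \<open>Row (i, j) of the Kronecker product of \<open>A\<close> and \<open>B\<close>. The column
  index runs in row-major order, matching \<open>vec_of_mat\<close>, so the scalar product with a
  vectorised \<open>Z\<close> is the (i, j) entry of A Z B^T.\<close>

definition tensor_row :: "nat \<Rightarrow> nat \<Rightarrow> real mat \<Rightarrow> real mat \<Rightarrow> nat \<times> nat \<Rightarrow> real vec" where
  "tensor_row d1 d2 A B = (\<lambda>(i,j). vec (d1 * d2) (\<lambda>k. A $$ (i, k div d2) * B $$ (j, k mod d2)))"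

definition vec_of_mat :: "nat \<Rightarrow> nat \<Rightarrow> real mat \<Rightarrow> real vec" where
  "vec_of_mat d1 d2 Z = vec (d1 * d2) (\<lambda>k. Z $$ (k div d2, k mod d2))"

text \<open>The squared row norms of an isometry add up to \<open>d\<close>, so their maximum is at
  least d/n.\<close>

lemma coherence_ge_1:
  assumes A: "A \<in> carrier_mat n d" "isometry A" "norm_2inf A \<le> sqrt (\<mu> * d / n)" and d: "0 < d" and n: "0 < n"
  shows "1 \<le> \<mu>"
proof -
  have "real d = (\<Sum>p<d. \<Sum>i<n. A $$ (i,p) * A $$ (i,p))"
    using isometry_cols_orthonormal[OF A(1,2)] by simp
  also have "\<dots> = (\<Sum>i<n. \<Sum>p<d. (A $$ (i,p))\<^sup>2)" by (subst sum.swap) (simp add: power2_eq_square)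
  also have "\<dots> \<le> (\<Sum>i<n. \<mu> * d / n)" using row_sum_sq_le_norm_2inf[OF A(1,3)] by (intro sum_mono) auto
  also have "\<dots> = \<mu> * d" using n by simp
  finally show ?thesis using d by simp
qed

text \<open>The sum over entries factors into a sum over rows of \<open>A\<close> and one over rows
  of \<open>B\<close>, each giving column orthonormality. Squared lengths factor likewise, so the
  bound is the product of the two coherence bounds.\<close>

lemma tight_frame_tensor_row:
  assumes A: "A \<in> carrier_mat n1 d1" "isometry A" "norm_2inf A \<le> sqrt (\<mu> * d1 / n1)"
    and B: "B \<in> carrier_mat n2 d2" "isometry B" "norm_2inf B \<le> sqrt (\<mu> * d2 / n2)"
    and pos: "0 < d1" "0 < d2" "0 < n1" "0 < n2"
  shows "tight_frame ({0..<n1} \<times> {0..<n2}) (tensor_row d1 d2 A B) (d1 * d2) (\<mu>\<^sup>2 * real d1 * real d2 / (real n1 * real n2))"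
proof
  have \<mu>: "1 \<le> \<mu>" using coherence_ge_1[OF A pos(1,3)] .
  show "finite ({0..<n1} \<times> {0..<n2})" by simp
  show "0 < \<mu>\<^sup>2 * real d1 * real d2 / (real n1 * real n2)" using \<mu> pos by simp
  fix ij :: "nat \<times> nat"
  obtain i j where ij: "ij = (i,j)" by force
  show "tensor_row d1 d2 A B ij \<in> carrier_vec (d1 * d2)" by (simp add: tensor_row_def ij)
  assume "ij \<in> {0..<n1} \<times> {0..<n2}"
  then have lt: "i < n1" "j < n2" using ij by auto
  have "tensor_row d1 d2 A B ij \<bullet> tensor_row d1 d2 A B ij
      = (\<Sum>k<d1 * d2. (A $$ (i, k div d2))\<^sup>2 * (B $$ (j, k mod d2))\<^sup>2)"
    by (simp add: tensor_row_def ij scalar_prod_def atLeast0LessThan power2_eq_square ac_simps)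
  also have "\<dots> = (\<Sum>p<d1. (A $$ (i,p))\<^sup>2) * (\<Sum>q<d2. (B $$ (j,q))\<^sup>2)"
    unfolding sum_div_mod[of "\<lambda>p q. (A $$ (i,p))\<^sup>2 * (B $$ (j,q))\<^sup>2"] by (rule sum_product[symmetric])
  also have "\<dots> \<le> (\<mu> * d1 / n1) * (\<mu> * d2 / n2)"
    using row_sum_sq_le_norm_2inf[OF A(1,3) lt(1)] row_sum_sq_le_norm_2inf[OF B(1,3) lt(2)] \<mu>
    by (intro mult_mono) (auto intro: sum_nonneg)
  finally show "tensor_row d1 d2 A B ij \<bullet> tensor_row d1 d2 A B ij \<le> \<mu>\<^sup>2 * real d1 * real d2 / (real n1 * real n2)"
    by (simp add: power2_eq_square ac_simps)
next
  fix a b assume ab: "a < d1 * d2" "b < d1 * d2"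
  have dm: "a div d2 < d1" "b div d2 < d1" "a mod d2 < d2" "b mod d2 < d2"
    using ab pos by (auto simp: less_mult_imp_div_less)
  have "(\<Sum>ij\<in>{0..<n1} \<times> {0..<n2}. tensor_row d1 d2 A B ij $ a * tensor_row d1 d2 A B ij $ b)
      = (\<Sum>i<n1. \<Sum>j<n2. (A $$ (i, a div d2) * A $$ (i, b div d2)) * (B $$ (j, a mod d2) * B $$ (j, b mod d2)))"
    unfolding sum.cartesian_product atLeast0LessThan
    by (intro sum.cong refl) (use ab in \<open>auto simp: tensor_row_def\<close>)
  also have "\<dots> = (\<Sum>i<n1. A $$ (i, a div d2) * A $$ (i, b div d2)) * (\<Sum>j<n2. B $$ (j, a mod d2) * B $$ (j, b mod d2))"
    by (rule sum_product[symmetric])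
  also have "\<dots> = (if a div d2 = b div d2 \<and> a mod d2 = b mod d2 then 1 else 0)"
    using isometry_cols_orthonormal[OF A(1,2) dm(1,2)] isometry_cols_orthonormal[OF B(1,2) dm(3,4)] by simp
  also have "\<dots> = (if a = b then 1 else 0)" by (metis div_mult_mod_eq)
  finally show "(\<Sum>ij\<in>{0..<n1} \<times> {0..<n2}. tensor_row d1 d2 A B ij $ a * tensor_row d1 d2 A B ij $ b)
      = (if a = b then 1 else 0)" .
qed

lemma tensor_row_scalar_prod:
  assumes "A \<in> carrier_mat n1 d1" "B \<in> carrier_mat n2 d2" "Z \<in> carrier_mat d1 d2" "i < n1" "j < n2"
  shows "tensor_row d1 d2 A B (i,j) \<bullet> vec_of_mat d1 d2 Z = (A * Z * B\<^sup>T) $$ (i,j)"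
  unfolding entry_mult_mult_transpose[OF assms] sum_div_mod[symmetric, of "\<lambda>p q. A $$ (i,p) * B $$ (j,q) * Z $$ (p,q)"]
  by (simp add: tensor_row_def vec_of_mat_def scalar_prod_def atLeast0LessThan)

lemma vec_of_mat_sq:
  assumes "Z \<in> carrier_mat d1 d2"
  shows "vec_of_mat d1 d2 Z \<bullet> vec_of_mat d1 d2 Z = (frob_norm Z)\<^sup>2"
  using sum_div_mod[of "\<lambda>p q. Z $$ (p,q) * Z $$ (p,q)" d2 d1] assms
  by (simp add: vec_of_mat_def scalar_prod_def atLeast0LessThan frob_inner_self[symmetric] frob_inner_def)

lemma proj_Omega_sq:
  assumes A: "A \<in> carrier_mat n1 d1" and B: "B \<in> carrier_mat n2 d2" and Z: "Z \<in> carrier_mat d1 d2"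
    and \<Omega>: "\<Omega> \<subseteq> {0..<n1} \<times> {0..<n2}"
  shows "(frob_norm (proj_Omega \<Omega> (A * Z * B\<^sup>T)))\<^sup>2
    = (\<Sum>ij\<in>\<Omega>. (tensor_row d1 d2 A B ij \<bullet> vec_of_mat d1 d2 Z)\<^sup>2)"
proof -
  have "(frob_norm (proj_Omega \<Omega> (A * Z * B\<^sup>T)))\<^sup>2
      = (\<Sum>ij\<in>{0..<n1} \<times> {0..<n2}. if ij \<in> \<Omega> then ((A * Z * B\<^sup>T) $$ ij)\<^sup>2 else 0)"
    using A B by (auto simp: frob_norm_def sum_nonneg proj_Omega_def sum.cartesian_product atLeast0LessThan
        intro!: sum.cong)
  also have "\<dots> = (\<Sum>ij\<in>\<Omega>. ((A * Z * B\<^sup>T) $$ ij)\<^sup>2)"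
    using \<Omega> by (simp add: sum.inter_restrict[symmetric] Int_absorb1)
  also have "\<dots> = (\<Sum>ij\<in>\<Omega>. (tensor_row d1 d2 A B ij \<bullet> vec_of_mat d1 d2 Z)\<^sup>2)"
    using \<Omega> tensor_row_scalar_prod[OF A B Z] by (intro sum.cong refl) force
  finally show ?thesis .
qed

text \<open>The left factor is recovered from the product by multiplying with \<open>N\<close> and
  the inverted diagonal on the right, so whatever fixes the product fixes \<open>P\<close>. It
  transfers the subspace hypotheses on \<open>Xs\<close> to its singular vectors.\<close>

lemma fixes_left_factor:
  fixes C :: "real mat"
  assumes C: "C \<in> carrier_mat n n" and P: "P \<in> carrier_mat n r" and N: "N \<in> carrier_mat m r"
    and NN: "N\<^sup>T * N = 1\<^sub>m r" and s: "\<And>i. i < r \<Longrightarrow> s i \<noteq> 0"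
    and fix_X: "C * (P * mat_diag r s * N\<^sup>T) = P * mat_diag r s * N\<^sup>T"
  shows "C * P = P"
proof -
  let ?S = "mat_diag r s" and ?S' = "mat_diag r (\<lambda>i. 1 / s i)"
  have S: "?S \<in> carrier_mat r r" "?S' \<in> carrier_mat r r" by simp_all
  have PS: "P * ?S \<in> carrier_mat n r" using P S by (rule_tac mult_carrier_mat)
  have NT: "N\<^sup>T \<in> carrier_mat r m" using N by simp
  have X: "P * ?S * N\<^sup>T \<in> carrier_mat n m" using PS NT by (rule mult_carrier_mat)
  have NS: "N * ?S' \<in> carrier_mat m r" using N S by (rule_tac mult_carrier_mat)
  have SS: "?S * ?S' = 1\<^sub>m r"
    unfolding mat_diag_diag mat_diag_one[symmetric] using s by (auto simp: mat_diag_def)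
  have "N\<^sup>T * (N * ?S') = ?S'"
    by (simp only: assoc_mult_mat[OF NT N S(2), symmetric] NN left_mult_one_mat[OF S(2)])
  then have P_eq: "P * ?S * N\<^sup>T * (N * ?S') = P"
    by (simp only: assoc_mult_mat[OF PS NT NS] assoc_mult_mat[OF P S] SS right_mult_one_mat[OF P])
  have "C * (P * ?S * N\<^sup>T * (N * ?S')) = P * ?S * N\<^sup>T * (N * ?S')"
    by (simp only: assoc_mult_mat[OF C X NS, symmetric] fix_X)
  then show ?thesis unfolding P_eq .
qed

lemma isometry_proj_col:
  fixes X :: "real mat"
  assumes A: "A \<in> carrier_mat n d" "isometry A" and X: "X \<in> carrier_mat n m"
    and range: "\<And>j. j < m \<Longrightarrow> \<exists>w \<in> carrier_vec d. col X j = A *\<^sub>v w"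
  shows "A * A\<^sup>T * X = X"
proof (rule mat_col_eqI)
  have AT: "A\<^sup>T \<in> carrier_mat d n" and AAT: "A * A\<^sup>T \<in> carrier_mat n n" using A by auto
  fix j assume "j < dim_col X"
  then have j: "j < m" using X by simp
  obtain w where w: "w \<in> carrier_vec d" "col X j = A *\<^sub>v w" using range[OF j] by blast
  have Aw: "A *\<^sub>v w \<in> carrier_vec n" using A(1) w(1) by (rule mult_mat_vec_carrier)
  have "A\<^sup>T *\<^sub>v (A *\<^sub>v w) = w"
    unfolding assoc_mult_mat_vec[OF AT A(1) w(1), symmetric] using A w by (simp add: isometry_def)
  then show "col (A * A\<^sup>T * X) j = col X j"
    using col_mult2[OF AAT X j] assoc_mult_mat_vec[OF A(1) AT Aw] w(2) by simp
qed (use A X in auto)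

text \<open>The deterministic half, for a fixed sample with isometry constants of ratio 1600. Since
  \<open>A\<close> and \<open>B\<close> preserve Frobenius norms, errors and objectives equal those
  of the compressed d1 by d2 problem.\<close>

lemma gnimc_converges:
  fixes \<Omega> :: "(nat \<times> nat) set"
  assumes r: "0 < r"
    and A: "A \<in> carrier_mat n1 d1" "isometry A" and B: "B \<in> carrier_mat n2 d2" "isometry B"
    and Xs: "Xs \<in> carrier_mat n1 n2" "vec_space.rank n1 Xs = r"
    and col_range: "\<And>j. j < n2 \<Longrightarrow> \<exists>w \<in> carrier_vec d1. col Xs j = A *\<^sub>v w"
    and row_range: "\<And>i. i < n1 \<Longrightarrow> \<exists>w \<in> carrier_vec d2. row Xs i = B *\<^sub>v w"
    and \<alpha>: "0 < \<alpha>"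
    and rip: "\<And>Z. Z \<in> carrier_mat d1 d2 \<Longrightarrow>
        \<alpha> * (frob_norm Z)\<^sup>2 \<le> (frob_norm (proj_Omega \<Omega> (A * Z * B\<^sup>T)))\<^sup>2 \<and>
        (frob_norm (proj_Omega \<Omega> (A * Z * B\<^sup>T)))\<^sup>2 \<le> 1600 * \<alpha> * (frob_norm Z)\<^sup>2"
    and iter: "gnimc_iterates A B \<Omega> (proj_Omega \<Omega> Xs) d1 d2 r U V"
    and init: "frob_norm (A * U 0 * (V 0)\<^sup>T * B\<^sup>T - Xs) \<le> sing_val r Xs / 200"
    and balanced: "frob_norm ((U 0)\<^sup>T * U 0 - (V 0)\<^sup>T * V 0) \<le> sing_val r Xs / (2 * 200)"
  shows "frob_norm (A * U (Suc t) * (V (Suc t))\<^sup>T * B\<^sup>T - Xs)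
    \<le> 200 / (2 * sing_val r Xs) * (frob_norm (A * U t * (V t)\<^sup>T * B\<^sup>T - Xs))\<^sup>2"
proof -
  define \<sigma> where "\<sigma> = sing_val r Xs"
  obtain P N s where P: "P \<in> carrier_mat n1 r" "P\<^sup>T * P = 1\<^sub>m r" and N: "N \<in> carrier_mat n2 r" "N\<^sup>T * N = 1\<^sub>m r"
    and X_eq: "Xs = P * mat_diag r s * N\<^sup>T" and \<sigma>: "0 < \<sigma>" and s_ge: "\<And>i. i < r \<Longrightarrow> \<sigma> \<le> s i"
    unfolding \<sigma>_def using compact_svd[OF Xs r] by metis
  have s0: "s i \<noteq> 0" if "i < r" for i using s_ge[OF that] \<sigma> by simp
  have T: "A\<^sup>T \<in> carrier_mat d1 n1" "B\<^sup>T \<in> carrier_mat d2 n2" "P\<^sup>T \<in> carrier_mat r n1" "N\<^sup>T \<in> carrier_mat r n2"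
    "Xs\<^sup>T \<in> carrier_mat n2 n1" using A B P N Xs by auto
  have AA: "A * A\<^sup>T \<in> carrier_mat n1 n1" and BB: "B * B\<^sup>T \<in> carrier_mat n2 n2" using A B by auto
  have iso: "A\<^sup>T * A = 1\<^sub>m d1" "B\<^sup>T * B = 1\<^sub>m d2" using A B by (auto simp: isometry_def)
  let ?S = "mat_diag r s"
  have S: "?S \<in> carrier_mat r r" by simp
  have PS: "P * ?S \<in> carrier_mat n1 r" using P(1) S by (rule mult_carrier_mat)
  have AX: "A * A\<^sup>T * Xs = Xs" by (rule isometry_proj_col[OF A Xs(1) col_range])
  have BX: "B * B\<^sup>T * Xs\<^sup>T = Xs\<^sup>T"
    by (rule isometry_proj_col[OF B T(5)]) (use row_range Xs in auto)
  have AP: "A * A\<^sup>T * P = P"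
    by (rule fixes_left_factor[OF AA P(1) N s0 AX[unfolded X_eq]])
  have XT: "Xs\<^sup>T = N * ?S * P\<^sup>T"
  proof -
    have ST: "?S\<^sup>T = ?S" by (rule eq_matI) (auto simp: mat_diag_def)
    have "Xs\<^sup>T = N * (?S * P\<^sup>T)"
      unfolding X_eq using transpose_mult[OF PS T(4)] transpose_mult[OF P(1) S] ST by simp
    then show ?thesis using assoc_mult_mat[OF N(1) S T(3)] by simp
  qed
  have BN: "B * B\<^sup>T * N = N"
    by (rule fixes_left_factor[OF BB N(1) P s0 BX[unfolded XT]])
  \<comment> \<open>Compressing the singular vectors keeps them orthonormal because A A^T and B B^T
    fix them, so \<open>M\<close> inherits the diagonal \<open>s\<close> and hence the bound
    \<sigma>.\<close>
  define P' where "P' = A\<^sup>T * P"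
  define N' where "N' = B\<^sup>T * N"
  define M where "M = P' * ?S * N'\<^sup>T"
  have P': "P' \<in> carrier_mat d1 r" and N': "N' \<in> carrier_mat d2 r"
    unfolding P'_def N'_def using T P N by auto
  have AP': "A * P' = P" and BN': "B * N' = N"
    unfolding P'_def N'_def using AP BN assoc_mult_mat[OF A(1) T(1) P(1)] assoc_mult_mat[OF B(1) T(2) N(1)] by simp_all
  have PP': "P'\<^sup>T * P' = 1\<^sub>m r"
  proof -
    have "P'\<^sup>T * P' = P\<^sup>T * A * P'" unfolding P'_def using transpose_mult[OF T(1) P(1)] by simp
    also have "\<dots> = P\<^sup>T * P" using assoc_mult_mat[OF T(3) A(1) P'] AP' by simp
    finally show ?thesis using P by simp
  qed
  have NN': "N'\<^sup>T * N' = 1\<^sub>m r"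
  proof -
    have "N'\<^sup>T * N' = N\<^sup>T * B * N'" unfolding N'_def using transpose_mult[OF T(2) N(1)] by simp
    also have "\<dots> = N\<^sup>T * N" using assoc_mult_mat[OF T(4) B(1) N'] BN' by simp
    finally show ?thesis using N by simp
  qed
  interpret low_rank_target d1 d2 r M P' N' s \<sigma>
    by unfold_locales (use P' N' PP' NN' \<sigma> s_ge in \<open>auto simp: M_def\<close>)
  have M: "M \<in> carrier_mat d1 d2" by (rule carriers)
  have AMB: "A * M * B\<^sup>T = Xs"
  proof -
    have NT': "N'\<^sup>T \<in> carrier_mat r d2" using N' by simp
    have PS': "P' * ?S \<in> carrier_mat d1 r" using P' S by (rule mult_carrier_mat)
    have "A * M = A * (P' * ?S) * N'\<^sup>T"
      unfolding M_def using assoc_mult_mat[OF A(1) PS' NT'] by simp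
    also have "A * (P' * ?S) = P * ?S" using assoc_mult_mat[OF A(1) P' S] AP' by simp
    finally have "A * M * B\<^sup>T = P * ?S * (N'\<^sup>T * B\<^sup>T)" using assoc_mult_mat[OF PS NT' T(2)] by simp
    also have "N'\<^sup>T * B\<^sup>T = N\<^sup>T" using transpose_mult[OF B(1) N'] BN' by simp
    finally show ?thesis by (simp add: X_eq)
  qed
  have lift_diff: "A * Z * B\<^sup>T - Xs = A * (Z - M) * B\<^sup>T" if Z: "Z \<in> carrier_mat d1 d2" for Z
    using mult_minus_distrib_mat[OF A(1) Z M]
      minus_mult_distrib_mat[OF mult_carrier_mat[OF A(1) Z] mult_carrier_mat[OF A(1) M] T(2)] AMB by simp
  have lift_norm: "frob_norm (A * Z * B\<^sup>T) = frob_norm Z" if Z: "Z \<in> carrier_mat d1 d2" for Z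
    using frob_norm_mult_isometry_transpose[OF B(1) iso(2) mult_carrier_mat[OF A(1) Z]]
      frob_norm_isometry_mult[OF A(1) iso(1) Z] by simp
  have UV: "U t \<in> carrier_mat d1 r" "V t \<in> carrier_mat d2 r"
    "gnimc_step A B \<Omega> (proj_Omega \<Omega> Xs) d1 d2 r (U t) (V t) (U (Suc t) - U t) (V (Suc t) - V t)" for t
    using iter unfolding gnimc_iterates_def by blast+
  have VT: "(V t)\<^sup>T \<in> carrier_mat r d2" for t using UV by simp
  have UVT: "U t * (V t)\<^sup>T \<in> carrier_mat d1 d2" for t using UV VT by (metis mult_carrier_mat)
  have error_eq: "frob_norm (A * U t * (V t)\<^sup>T * B\<^sup>T - Xs) = frob_norm (U t * (V t)\<^sup>T - M)" for t
    using lift_diff[OF UVT, of t] lift_norm[OF minus_carrier_mat[OF M], of "U t * (V t)\<^sup>T"]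
      assoc_mult_mat[OF A(1) UV(1) VT] by simp
  define q where "q Z = (frob_norm (proj_Omega \<Omega> (A * Z * B\<^sup>T)))\<^sup>2" for Z
  have obj: "gnimc_obj A B \<Omega> (proj_Omega \<Omega> Xs) (U t) (V t) Q R = q (U t * (V t)\<^sup>T + U t * R\<^sup>T + Q * (V t)\<^sup>T - M)"
    if "Q \<in> carrier_mat d1 r" "R \<in> carrier_mat d2 r" for t Q R
  proof -
    let ?Z = "U t * (V t)\<^sup>T + U t * R\<^sup>T + Q * (V t)\<^sup>T"
    have Z: "?Z \<in> carrier_mat d1 d2" using that UV[of t] by auto
    have AZB: "A * ?Z * B\<^sup>T \<in> carrier_mat n1 n2" using A(1) Z T(2) by (metis mult_carrier_mat)
    have "proj_Omega \<Omega> X - proj_Omega \<Omega> Xs = proj_Omega \<Omega> (X - Xs)" if "X \<in> carrier_mat n1 n2" for X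
      by (rule eq_matI) (use that Xs in \<open>auto simp: proj_Omega_def\<close>)
    from this[OF AZB] show ?thesis unfolding gnimc_obj_def q_def lift_diff[OF Z] by simp
  qed
  define err where "err t = frob_norm (U t * (V t)\<^sup>T - M)" for t
  define bal where "bal t = frob_norm ((U t)\<^sup>T * U t - (V t)\<^sup>T * V t)" for t
  have "err (Suc t) \<le> 100 / \<sigma> * (err t)\<^sup>2"
  proof (rule quadratic_convergence_invariant[where bal = bal, OF \<sigma>])
    show "err 0 \<le> \<sigma> / 200" using init by (simp add: err_def \<sigma>_def error_eq)
    show "bal 0 \<le> \<sigma> / 400" using balanced by (simp add: bal_def \<sigma>_def)
    show "0 \<le> err t" for t by (simp add: err_def)
    fix t assume small: "err t \<le> \<sigma> / 200" "bal t \<le> \<sigma> / 100"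
    let ?dU = "U (Suc t) - U t" and ?dV = "V (Suc t) - V t"
    have dU: "?dU \<in> carrier_mat d1 r" and dV: "?dV \<in> carrier_mat d2 r"
      using UV by (auto intro: minus_carrier_mat)
    have next_U: "U t + ?dU = U (Suc t)"
      by (rule eq_matI) (use UV(1)[of t] UV(1)[of "Suc t"] in auto)
    have next_V: "V t + ?dV = V (Suc t)"
      by (rule eq_matI) (use UV(2)[of t] UV(2)[of "Suc t"] in auto)
    let ?res = "\<lambda>Q R. U t * (V t)\<^sup>T + U t * R\<^sup>T + Q * (V t)\<^sup>T - M"
    have min: "q (?res ?dU ?dV) \<le> q (?res Q R)" if "Q \<in> carrier_mat d1 r" "R \<in> carrier_mat d2 r" for Q R
      using UV(3)[of t] that dU dV unfolding gnimc_step_def Let_def by (auto simp: obj)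
    have min_norm: "(frob_norm ?dU)\<^sup>2 + (frob_norm ?dV)\<^sup>2 \<le> (frob_norm Q)\<^sup>2 + (frob_norm R)\<^sup>2"
      if QR: "Q \<in> carrier_mat d1 r" "R \<in> carrier_mat d2 r"
        and eq: "U t * R\<^sup>T + Q * (V t)\<^sup>T = U t * ?dV\<^sup>T + ?dU * (V t)\<^sup>T" for Q R
    proof -
      have assoc: "?res Q R = U t * (V t)\<^sup>T + (U t * R\<^sup>T + Q * (V t)\<^sup>T) - M"
        if "Q \<in> carrier_mat d1 r" "R \<in> carrier_mat d2 r" for Q R
        using assoc_add_mat[OF UVT, of "U t * R\<^sup>T" "Q * (V t)\<^sup>T" t] that UV[of t] by simp
      \<comment> \<open>A competitor with the same tangent matrix has the same residual, hence is
        itself a minimiser, and the minimal norm selection rule applies to it.\<close>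
      have "?res Q R = ?res ?dU ?dV" unfolding assoc[OF QR] assoc[OF dU dV] eq ..
      then have "\<forall>Q'\<in>carrier_mat d1 r. \<forall>R'\<in>carrier_mat d2 r.
          gnimc_obj A B \<Omega> (proj_Omega \<Omega> Xs) (U t) (V t) Q R \<le> gnimc_obj A B \<Omega> (proj_Omega \<Omega> Xs) (U t) (V t) Q' R'"
        using min QR by (simp add: obj)
      then show ?thesis using UV(3)[of t] QR unfolding gnimc_step_def Let_def by blast
    qed
    have q: "\<alpha> * (frob_norm Z)\<^sup>2 \<le> q Z" "q Z \<le> 1600 * \<alpha> * (frob_norm Z)\<^sup>2" if "Z \<in> carrier_mat d1 d2" for Z
      using rip[OF that] by (auto simp: q_def)
    show "err (Suc t) \<le> 100 / \<sigma> * (err t)\<^sup>2 \<and> bal (Suc t) \<le> bal t + 16 / \<sigma> * (err t)\<^sup>2"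
      using gauss_newton_step[OF UV(1,2) dU dV small[unfolded err_def bal_def] \<alpha> q min min_norm]
      unfolding next_U next_V err_def bal_def by blast
  qed
  then show ?thesis unfolding error_eq err_def \<sigma>_def by simp
qed

lemma exp_le_inverse_power:
  assumes "0 < n" "real k * ln (real n) \<le> a"
  shows "exp (- a) \<le> 1 / real n ^ k"
proof -
  have "exp (- a) \<le> exp (- (real k * ln (real n)))" using assms by simp
  also have "\<dots> = 1 / exp (ln (real n)) ^ k" by (simp add: exp_minus exp_of_nat_mult inverse_eq_divide)
  finally show ?thesis using assms by simp
qed

theorem theorem5p1:
  "\<exists>c::real. c > 1 \<and>
   (\<forall>n1 n2 d1 d2 r :: nat. \<forall>\<mu>::real. \<forall>A B Xs :: real mat. \<forall>m :: nat.
      0 < r \<and> r \<le> d1 \<and> d1 \<le> n1 \<and> r \<le> d2 \<and> d2 \<le> n2 \<and>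
      A \<in> carrier_mat n1 d1 \<and> B \<in> carrier_mat n2 d2 \<and>
      isometry A \<and> isometry B \<and>
      norm_2inf A \<le> sqrt (\<mu> * real d1 / real n1) \<and> norm_2inf B \<le> sqrt (\<mu> * real d2 / real n2) \<and>
      Xs \<in> carrier_mat n1 n2 \<and> vec_space.rank n1 Xs = r \<and>
      (\<forall>j<n2. \<exists>w \<in> carrier_vec d1. Matrix.col Xs j = A *\<^sub>v w) \<and>
      (\<forall>i<n1. \<exists>w \<in> carrier_vec d2. Matrix.row Xs i = B *\<^sub>v w) \<and>
      real m \<ge> 32 * \<mu>\<^sup>2 * real d1 * real d2 * ln (real (max n1 n2)) \<and> m \<le> n1 * n2
      \<longrightarrow>
      (let n = max n1 n2; \<sigma> = sing_val r Xs; \<gamma> = c / (2 * \<sigma>) in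
       measure_pmf.prob
         (pmf_of_set {\<Omega>. \<Omega> \<subseteq> {0..<n1} \<times> {0..<n2} \<and> card \<Omega> = m})
         {\<Omega>. \<forall>U V :: nat \<Rightarrow> real mat.
              gnimc_iterates A B \<Omega> (proj_Omega \<Omega> Xs) d1 d2 r U V \<and>
              frob_norm (A * U 0 * transpose_mat (V 0) * transpose_mat B - Xs) \<le> \<sigma> / c \<and>
              frob_norm (transpose_mat (U 0) * U 0 - transpose_mat (V 0) * V 0) \<le> \<sigma> / (2 * c)
              \<longrightarrow> (\<forall>t. frob_norm (A * U (Suc t) * transpose_mat (V (Suc t)) * transpose_mat B - Xs)
                     \<le> \<gamma> * (frob_norm (A * U t * transpose_mat (V t) * transpose_mat B - Xs))\<^sup>2)}
       \<ge> 1 - 2 / (real n)\<^sup>2))"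
proof (intro exI[of _ 200] conjI allI impI, goal_cases)
  \<comment> \<open>With c = 200, the factor c/(2 \<sigma>) is 100/\<sigma>, and the initial radii
    \<sigma>/c and \<sigma>/(2c) are \<sigma>/200 and \<sigma>/400, as in the convergence
    invariant.\<close>
  case 1
  show ?case by simp
next
  case (2 n1 n2 d1 d2 r \<mu> A B Xs m)
  then have r: "0 < r" and le: "r \<le> d1" "d1 \<le> n1" "r \<le> d2" "d2 \<le> n2"
    and A: "A \<in> carrier_mat n1 d1" "isometry A" "norm_2inf A \<le> sqrt (\<mu> * real d1 / real n1)"
    and B: "B \<in> carrier_mat n2 d2" "isometry B" "norm_2inf B \<le> sqrt (\<mu> * real d2 / real n2)"
    and Xs: "Xs \<in> carrier_mat n1 n2" "vec_space.rank n1 Xs = r"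
    and cols: "\<And>j. j < n2 \<Longrightarrow> \<exists>w \<in> carrier_vec d1. col Xs j = A *\<^sub>v w"
    and rows: "\<And>i. i < n1 \<Longrightarrow> \<exists>w \<in> carrier_vec d2. row Xs i = B *\<^sub>v w"
    and m: "32 * \<mu>\<^sup>2 * real d1 * real d2 * ln (real (max n1 n2)) \<le> real m" "m \<le> n1 * n2"
    by blast+
  define n where "n = max n1 n2"
  have pos: "0 < d1" "0 < d2" "0 < n1" "0 < n2" using r le by linarith+
  define I where "I = {0..<n1} \<times> {0..<n2}"
  have cardI: "card I = n1 * n2" and finI: "finite I" by (auto simp: I_def)
  define SS where "SS = {\<Omega>. \<Omega> \<subseteq> I \<and> card \<Omega> = m}"
  define good where "good = {\<Omega>. \<forall>U V :: nat \<Rightarrow> real mat.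
              gnimc_iterates A B \<Omega> (proj_Omega \<Omega> Xs) d1 d2 r U V \<and>
              frob_norm (A * U 0 * (V 0)\<^sup>T * B\<^sup>T - Xs) \<le> sing_val r Xs / 200 \<and>
              frob_norm ((U 0)\<^sup>T * U 0 - (V 0)\<^sup>T * V 0) \<le> sing_val r Xs / (2 * 200)
              \<longrightarrow> (\<forall>t. frob_norm (A * U (Suc t) * (V (Suc t))\<^sup>T * B\<^sup>T - Xs)
                     \<le> 200 / (2 * sing_val r Xs) * (frob_norm (A * U t * (V t)\<^sup>T * B\<^sup>T - Xs))\<^sup>2)}"
  have "1 - 2 / (real n)\<^sup>2 \<le> measure_pmf.prob (pmf_of_set SS) good"
  proof (cases "n = 1")
    \<comment> \<open>For n = 1 the logarithm vanishes and the sample may be empty, but the asserted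
      probability bound is negative.\<close>
    case True
    then have "1 - 2 / (real n)\<^sup>2 \<le> 0" by simp
    then show ?thesis using measure_nonneg[of "measure_pmf (pmf_of_set SS)" good] by linarith
  next
    case False
    then have n2: "2 \<le> n" using pos by (simp add: n_def max_def split: if_splits)
    have \<mu>: "1 \<le> \<mu>" using coherence_ge_1[OF A pos(1,3)] .
    define D where "D = d1 * d2"
    define R where "R = \<mu>\<^sup>2 * real d1 * real d2 / (real n1 * real n2)"
    interpret tight_frame I "tensor_row d1 d2 A B" D R
      unfolding I_def D_def R_def by (rule tight_frame_tensor_row[OF A B pos])
    \<comment> \<open>The sample size hypothesis thus says exactly that \<rho> = m/(N R) is at least
      32 ln n.\<close>
    have NR: "N * R = \<mu>\<^sup>2 * D" using pos by (simp add: cardI R_def D_def)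
    have "0 < D" using pos by (simp add: D_def)
    then have D1: "1 \<le> real D" by linarith
    have "1 * 1 \<le> \<mu>\<^sup>2 * D" using \<mu> D1 by (intro mult_mono) auto
    then have NR1: "1 \<le> N * R" by (simp add: NR)
    define \<rho> where "\<rho> = m / (N * R)"
    have "32 * ln n * (N * R) = 32 * \<mu>\<^sup>2 * real d1 * real d2 * ln n" unfolding NR by (simp add: D_def)
    also have "\<dots> \<le> m" using m(1) by (simp only: n_def)
    finally have "32 * ln n * (N * R) \<le> m" .
    then have \<rho>: "32 * ln n \<le> \<rho>" using NR1 by (simp add: \<rho>_def pos_le_divide_eq)
    have ln0: "0 < ln n" using n2 by simp
    have m0: "0 < m"
    proof (rule ccontr)
      assume "\<not> 0 < m"
      then have "\<rho> = 0" by (simp add: \<rho>_def)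
      then show False using \<rho> ln0 by simp
    qed
    have N0: "0 < N" using pos by (simp add: cardI)
    define \<alpha> where "\<alpha> = m / (100 * N)"
    have \<alpha>: "0 < \<alpha>" using m0 N0 by (simp add: \<alpha>_def)
    let ?low = "\<lambda>T. \<exists>v\<in>carrier_vec D. v \<bullet> (S T *\<^sub>v v) < \<alpha> * (v \<bullet> v)"
    let ?up = "\<lambda>T. \<exists>v\<in>carrier_vec D. 16 * real m / N * (v \<bullet> v) < v \<bullet> (S T *\<^sub>v v)"
    define L where "L = {T. T \<subseteq> I \<and> card T = m \<and> ?low T}"
    define H where "H = {T. T \<subseteq> I \<and> card T = m \<and> ?up T}"
    have finSS: "finite SS" unfolding SS_def using finI by simp
    have cardSS: "card SS = card I choose m" unfolding SS_def by (rule n_subsets[OF finI])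
    have SS0: "0 < card SS" unfolding cardSS using m(2) by (simp add: cardI zero_less_binomial_iff)
    have sub: "SS - (L \<union> H) \<subseteq> SS \<inter> good"
    proof
      fix \<Omega> assume \<Omega>: "\<Omega> \<in> SS - (L \<union> H)"
      then have \<Omega>I: "\<Omega> \<subseteq> I" by (auto simp: SS_def)
      have rip: "\<alpha> * (frob_norm Z)\<^sup>2 \<le> (frob_norm (proj_Omega \<Omega> (A * Z * B\<^sup>T)))\<^sup>2 \<and>
        (frob_norm (proj_Omega \<Omega> (A * Z * B\<^sup>T)))\<^sup>2 \<le> 1600 * \<alpha> * (frob_norm Z)\<^sup>2"
        if Z: "Z \<in> carrier_mat d1 d2" for Z
      proof -
        let ?v = "vec_of_mat d1 d2 Z"
        have v: "?v \<in> carrier_vec D" by (simp add: vec_of_mat_def D_def)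
        have "(frob_norm (proj_Omega \<Omega> (A * Z * B\<^sup>T)))\<^sup>2 = ?v \<bullet> (S \<Omega> *\<^sub>v ?v)"
          using proj_Omega_sq[OF A(1) B(1) Z \<Omega>I[unfolded I_def]] S_quad[OF \<Omega>I v] by simp
        moreover have "\<alpha> * (?v \<bullet> ?v) \<le> ?v \<bullet> (S \<Omega> *\<^sub>v ?v)"
          using \<Omega> v by (auto simp: SS_def L_def not_less)
        moreover have "?v \<bullet> (S \<Omega> *\<^sub>v ?v) \<le> 16 * real m / N * (?v \<bullet> ?v)"
          using \<Omega> v by (auto simp: SS_def H_def not_less simp del: times_divide_eq_left)
        \<comment> \<open>The two tail thresholds, 16 and 1/100 of the mean m/N, have ratio
          1600.\<close>
        moreover have "16 * real m / N = 1600 * \<alpha>" by (simp add: \<alpha>_def)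
        ultimately show ?thesis using vec_of_mat_sq[OF Z] by simp
      qed
      have "\<Omega> \<in> good"
        unfolding good_def
        using gnimc_converges[OF r A(1,2) B(1,2) Xs cols rows \<alpha> rip] by blast
      then show "\<Omega> \<in> SS \<inter> good" using \<Omega> by blast
    qed
    have D_le: "real D \<le> real n ^ 2"
    proof -
      have "D \<le> n * n" unfolding D_def n_def using le by (intro mult_le_mono) auto
      then show ?thesis by (metis of_nat_le_iff of_nat_mult power2_eq_square)
    qed
    \<comment> \<open>The exponent (9/50) 32 = 5.76 exceeds 5, and \<open>D\<close> is at most n^2,
      which leaves n^-3.\<close>
    have L_le: "card L \<le> 2 / real n ^ 3 * card SS"
    proof -
      have "card L \<le> 2 * real D * exp (- 9 / 50 * \<rho>) * card SS"
        unfolding L_def \<alpha>_def \<rho>_def cardSS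
        by (rule lower_tail) (use m(2) pos NR1 in \<open>auto simp: cardI\<close>)
      also have "exp (- 9 / 50 * \<rho>) \<le> 1 / real n ^ 5"
        using exp_le_inverse_power[of n 5 "9 / 50 * \<rho>"] \<rho> ln0 n2 by simp
      also have "2 * real D * (1 / real n ^ 5) * card SS \<le> 2 * real n ^ 2 * (1 / real n ^ 5) * card SS"
        using D_le by (intro mult_right_mono) auto
      also have "2 * real n ^ 2 * (1 / real n ^ 5) = 2 / real n ^ 3"
        using n2 by (simp add: field_simps flip: power_add)
      finally show ?thesis by (simp add: mult_right_mono mult_left_mono)
    qed
    have H_le: "card H \<le> 1 / real n ^ 3 * card SS"
    proof (cases "2 * m \<le> card I")
      case True
      have "card H \<le> real D * exp (- 2 * \<rho>) * card SS"
        unfolding H_def \<rho>_def cardSS by (rule upper_tail[OF True]) (use pos in \<open>simp add: cardI\<close>)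
      also have "exp (- 2 * \<rho>) \<le> 1 / real n ^ 5"
        using exp_le_inverse_power[of n 5 "2 * \<rho>"] \<rho> ln0 n2 by simp
      also have "real D * (1 / real n ^ 5) * card SS \<le> real n ^ 2 * (1 / real n ^ 5) * card SS"
        using D_le by (intro mult_right_mono) auto
      also have "real n ^ 2 * (1 / real n ^ 5) = 1 / real n ^ 3"
        using n2 by (simp add: field_simps flip: power_add)
      finally show ?thesis by (simp add: mult_right_mono mult_left_mono)
    next
      \<comment> \<open>More than half of the entries are sampled, so the threshold exceeds 1 while
        \<open>S\<close> is at most the identity: no set can be bad.\<close>
      case False
      then have "N < 2 * real m" by linarith
      then have ratio: "1 \<le> 16 * real m / N" using N0 by (simp add: pos_le_divide_eq)
      have "v \<bullet> (S T *\<^sub>v v) \<le> 16 * real m / N * (v \<bullet> v)" if "T \<subseteq> I" "v \<in> carrier_vec D" for T v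
        using S_quad_le[OF that] mult_right_mono[OF ratio scalar_prod_self_nonneg[of v]] by linarith
      then have "H = {}" unfolding H_def using not_less by blast
      then show ?thesis by simp
    qed
    have "real (card SS) \<le> card (SS \<inter> good) + (card L + card H)"
    proof -
      have "SS \<subseteq> (SS \<inter> good) \<union> (L \<union> H)" using sub by blast
      moreover have fin: "finite (SS \<inter> good)" "finite L" "finite H"
        using finSS finI by (auto simp: L_def H_def)
      ultimately have "card SS \<le> card ((SS \<inter> good) \<union> (L \<union> H))" by (intro card_mono) auto
      also have "\<dots> \<le> card (SS \<inter> good) + (card L + card H)"
        by (meson add_left_mono card_Un_le order_trans)
      finally show ?thesis by linarith
    qed
    moreover have "2 / real n ^ 3 * card SS + 1 / real n ^ 3 * card SS = 3 / real n ^ 3 * card SS"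
      using n2 by (simp add: field_simps)
    ultimately have "card SS \<le> card (SS \<inter> good) + 3 / real n ^ 3 * card SS"
      using L_le H_le by linarith
    \<comment> \<open>The failure fractions 2/n^3 and 1/n^3 together fit into 2/n^2 because n \<ge>
      2.\<close>
    also have "3 / real n ^ 3 * card SS \<le> 2 / (real n)\<^sup>2 * card SS"
    proof (rule mult_right_mono)
      have "3 / real n ^ 3 = 3 / real n * (1 / (real n)\<^sup>2)" by (simp add: power3_eq_cube power2_eq_square)
      also have "\<dots> \<le> 2 * (1 / (real n)\<^sup>2)" using n2 by (intro mult_right_mono) (auto simp: field_simps)
      finally show "3 / real n ^ 3 \<le> 2 / (real n)\<^sup>2" by simp
    qed simp
    finally have "(1 - 2 / (real n)\<^sup>2) * card SS \<le> card (SS \<inter> good)" by (simp add: algebra_simps)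
    then have "1 - 2 / (real n)\<^sup>2 \<le> card (SS \<inter> good) / card SS" using SS0 by (simp add: pos_le_divide_eq)
    also have "\<dots> = measure_pmf.prob (pmf_of_set SS) good"
      by (rule measure_pmf_of_set[symmetric]) (use SS0 finSS in auto)
    finally show ?thesis .
  qed
  then show ?case unfolding Let_def n_def SS_def I_def good_def .
qed

end
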